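(* For all $0<p,q<\infty$, $\mathcal M(\mathcal D^p_{p-1}\cap BMOA,\ \mathcal D^q_{q-1}\cap BMOA)\subset BMOA_{\log}\cap H^\infty=\mathcal M(BMOA)$.
   Context: $\mathbb D$ is the open unit disc, $dA=\frac1\pi dx\,dy$. For $0<p<\infty$, $\mathcal D^p_{p-1}$ is the space of analytic $f$ with $\int_{\mathbb D}(1-|z|)^{p-1}|f'(z)|^p\,dA(z)<\infty$. $BMOA$ is the space of $f\in H^1$ whose boundary values have bounded mean oscillation; equivalently, analytic $f$ with $(1-|z|^2)|f'(z)|^2dA(z)$ a Carleson measure. For an arc $I\subset\partial\mathbb D$ of length $|I|$, $S(I)=\{re^{it}: e^{it}\in I,\ 1-\frac{|I|}{2\pi}\le r<1\}$. $BMOA_{\log}$ is the space of $g\in H^1$ for which there is $C>0$ with $\int_{S(I)}(1-|z|^2)|g'(z)|^2\,dA(z)\le C|I|(\log\frac{2}{|I|})^{-2}$ for every arc $I$. $H^\infty$ is the space of bounded analytic functions. $\mathcal M(X,Y)=\{g\text{ analytic}: fg\in Y\ \forall f\in X\}$, $\mathcal M(X)=\mathcal M(X,X)$; intersections are normed by the sum of the norms. *)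

theory Defs
  imports "HOL-Analysis.Analysis"
begin

definition unit_disc :: "complex set" where
  "unit_disc = ball 0 1"

definition dA_int :: "complex set \<Rightarrow> (complex \<Rightarrow> real) \<Rightarrow> ennreal" where
  "dA_int S w = (\<integral>\<^sup>+ z. ennreal (w z / pi) * indicator S z \<partial>lborel)"

text \<open>Carleson box S(I) of the arc I = { e^{it} : a <= t <= a + l }, |I| = l.\<close>
definition carleson_box :: "real \<Rightarrow> real \<Rightarrow> complex set" where
  "carleson_box a l = {complex_of_real r * cis t | r t.
      a \<le> t \<and> t \<le> a + l \<and> 1 - l / (2 * pi) \<le> r \<and> r < 1}"

definition is_arc_length :: "real \<Rightarrow> bool" where
  "is_arc_length l \<longleftrightarrow> 0 < l \<and> l \<le> 2 * pi"

definition Dp :: "real \<Rightarrow> (complex \<Rightarrow> complex) set" where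
  "Dp p = {f. f holomorphic_on unit_disc \<and>
     dA_int unit_disc (\<lambda>z. (1 - cmod z) powr (p - 1) * cmod (deriv f z) powr p) < \<infinity>}"

definition H1 :: "(complex \<Rightarrow> complex) set" where
  "H1 = {f. f holomorphic_on unit_disc \<and>
     (\<exists>M. \<forall>r. 0 \<le> r \<and> r < 1 \<longrightarrow>
        (LBINT t=0..2*pi. cmod (f (complex_of_real r * cis t))) \<le> M)}"

definition Hinf :: "(complex \<Rightarrow> complex) set" where
  "Hinf = {f. f holomorphic_on unit_disc \<and> bounded (f ` unit_disc)}"

text \<open>BMOA via the Carleson measure characterization of (1-|z|^2)|f'(z)|^2 dA(z).\<close>
definition BMOA :: "(complex \<Rightarrow> complex) set" where
  "BMOA = {f. f holomorphic_on unit_disc \<and>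
     (\<exists>C>0. \<forall>a l. is_arc_length l \<longrightarrow>
        dA_int (carleson_box a l) (\<lambda>z. (1 - (cmod z)\<^sup>2) * (cmod (deriv f z))\<^sup>2)
          \<le> ennreal (C * l))}"

text \<open>BMOA_log: the bound integral <= C |I| (log(2/|I|))^(-2), written multiplicatively
  (so that at |I| = 2, where the right-hand side is +infinity, there is no constraint).\<close>
definition BMOA_log :: "(complex \<Rightarrow> complex) set" where
  "BMOA_log = {g. g \<in> H1 \<and>
     (\<exists>C>0. \<forall>a l. is_arc_length l \<longrightarrow>
        dA_int (carleson_box a l) (\<lambda>z. (1 - (cmod z)\<^sup>2) * (cmod (deriv g z))\<^sup>2)
          * ennreal ((ln (2 / l))\<^sup>2) \<le> ennreal (C * l))}"

definition multipliers :: "(complex \<Rightarrow> complex) set \<Rightarrow> (complex \<Rightarrow> complex) set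
    \<Rightarrow> (complex \<Rightarrow> complex) set" where
  "multipliers X Y = {g. g holomorphic_on unit_disc \<and> (\<forall>f\<in>X. (\<lambda>z. f z * g z) \<in> Y)}"

end

(* Let E(a, f) be the integral of |f'|^2 (1 - |phi_a|^2) over the disc, where phi_a is the Moebius
   involution exchanging a and 0, and let L(a) = log (2 / (1 - |a|)).  Decomposing the disc into dyadic
   neighbourhoods of a shows that f is in BMOA iff E(a, f) is bounded in a, and that a bounded g is in
   BMOA_log iff L(a)^2 E(a, g) is bounded in a.

   Transporting a to 0 and comparing Taylor coefficients gives E(a, (f - f(a)) g) <= 2 |g|_oo^2 E(a, f)
   for bounded g.  Since |f(a)| <= C L(a) for f in BMOA, this gives BMOA_log \<inter> Hinf \<subseteq> M(BMOA), and
   conversely it bounds |f(a)|^2 E(a, g) uniformly in a whenever f and f g are in BMOA.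

   If g multiplies X = Dp p \<inter> BMOA into BMOA, then |g(a)| |f(a)| / L(a) is bounded in a for every f in X.
   A superposition of logarithms lies in X and grows like L along any prescribed sequence, up to
   a summable factor, so |f(a)| can be replaced by L(a) in such bounds: g is bounded, and then
   L(a)^2 E(a, g) is bounded. *)
theory Submission
  imports Defs "HOL-Complex_Analysis.Complex_Analysis"
begin

section \<open>Holomorphic change of variables\<close>

text \<open>The hypothesis on a multiplier yields, for each \<open>f\<close> in \<open>X\<close>, a
  bound whose constant depends on \<open>f\<close>; the work lies in making it uniform. A gliding
  hump does this: the superposed logarithms satisfy estimates that do not depend on where their
  singularities sit on the circle, so these can be placed after the bad points are known, and the
  weights \<open>2^-(n+1)\<close> lose against growth like \<open>4^(n+1)\<close>. The same function
  lies in \<open>Dp p\<close> for every \<open>p > 0\<close>.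

  The two conclusions come in a forced order. The splitting \<open>f g = (f - f a) g + f a g\<close>
  isolates \<open>f a\<close>, but the first summand is controlled through the supremum of
  \<open>g\<close>, so boundedness precedes the logarithmic condition. That summand vanishes at
  \<open>a\<close>, which is the reason for centring energies at points instead of working with
  boxes: once \<open>a\<close> is moved to 0, the energy is comparable to the squared Hardy norm of
  a function vanishing there, and bounded functions act on that norm.

  Energies are extended nonnegative integrals, so that identities hold also when both sides are
  infinite.\<close>

definition complex_of_vec :: "real^2 \<Rightarrow> complex" where
  "complex_of_vec v = Complex (v $ 1) (v $ 2)"

definition vec_of_complex :: "complex \<Rightarrow> real^2" where
  "vec_of_complex z = (\<chi> i. if i = 1 then Re z else Im z)"

lemma complex_of_vec_inverse [simp]: "complex_of_vec (vec_of_complex z) = z"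
  by (simp add: complex_of_vec_def vec_of_complex_def)

lemma vec_of_complex_inverse [simp]: "vec_of_complex (complex_of_vec v) = v"
  by (simp add: complex_of_vec_def vec_of_complex_def vec_eq_iff forall_2)

lemma bounded_linear_complex_of_vec: "bounded_linear complex_of_vec"
  by (intro linear_conv_bounded_linear[THEN iffD1] linearI)
     (auto simp: complex_of_vec_def complex_eq_iff)

lemma bounded_linear_vec_of_complex: "bounded_linear vec_of_complex"
  by (intro linear_conv_bounded_linear[THEN iffD1] linearI)
     (auto simp: vec_of_complex_def vec_eq_iff)

lemma complex_of_vec_measurable [measurable]: "complex_of_vec \<in> borel_measurable borel"
  by (intro borel_measurable_continuous_onI linear_continuous_on bounded_linear_complex_of_vec)

text \<open>Lebesgue measure is determined by its values on boxes, and the coordinate map preserves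
  boxes together with their side lengths.\<close>

lemma lborel_complex_eq_distr: "lborel = distr (lborel :: (real^2) measure) borel complex_of_vec"
proof (rule lborel_eqI)
  fix l u :: complex assume "\<And>b. b \<in> Basis \<Longrightarrow> l \<bullet> b \<le> u \<bullet> b"
  then have lu: "Re l \<le> Re u" "Im l \<le> Im u"
    using \<open>\<And>b. b \<in> Basis \<Longrightarrow> l \<bullet> b \<le> u \<bullet> b\<close>[of 1] \<open>\<And>b. b \<in> Basis \<Longrightarrow> l \<bullet> b \<le> u \<bullet> b\<close>[of \<i>]
    by (auto simp: Basis_complex_def)
  have eq: "complex_of_vec -` box l u = box (vec_of_complex l) (vec_of_complex u)"
    by (auto simp: in_box_complex_iff complex_of_vec_def vec_of_complex_def mem_box_cart forall_2)
  have "emeasure (distr (lborel :: (real^2) measure) borel complex_of_vec) (box l u)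
      = emeasure lborel (box (vec_of_complex l) (vec_of_complex u))"
    by (subst emeasure_distr) (auto simp: eq)
  also have "\<dots> = (\<Prod>b\<in>Basis. (vec_of_complex u - vec_of_complex l) \<bullet> b)"
    using lu by (intro emeasure_lborel_box)
      (auto simp: Basis_vec_def inner_axis vec_of_complex_def)
  also have "(\<Prod>b\<in>Basis. (vec_of_complex u - vec_of_complex l) \<bullet> b) = (Re u - Re l) * (Im u - Im l)"
  proof -
    have "(Basis :: (real^2) set) = {axis 1 1, axis 2 1}"
      by (auto simp: Basis_vec_def UNIV_2)
    then show ?thesis
      unfolding \<open>Basis = _\<close> by (simp add: axis_eq_axis inner_axis vec_of_complex_def)
  qed
  also have "\<dots> = (\<Prod>b\<in>Basis. (u - l) \<bullet> b)"
    by (simp add: Basis_complex_def)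
  finally show "emeasure (distr (lborel :: (real^2) measure) borel complex_of_vec) (box l u)
      = (\<Prod>b\<in>Basis. (u - l) \<bullet> b)" .
qed simp

lemma nn_integral_complex_vec:
  assumes [measurable]: "F \<in> borel_measurable borel"
  shows "(\<integral>\<^sup>+z. F z \<partial>lborel) = (\<integral>\<^sup>+v. F (complex_of_vec v) \<partial>lborel)"
  by (subst lborel_complex_eq_distr, subst nn_integral_distr) auto

text \<open>Bridge between the two integrals: change of variables speaks of absolute integrability,
  the definitions of the spaces speak of extended nonnegative integrals. Recording the divergent
  case as well lets the substitution rule hold without any finiteness assumption.\<close>

lemma nn_integral_eq_integral_or_top:
  fixes u :: "'a::euclidean_space \<Rightarrow> real"
  assumes u: "(\<lambda>x. indicator S x * u x) \<in> borel_measurable lborel" and nn: "\<And>x. x \<in> S \<Longrightarrow> 0 \<le> u x"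
  shows "(\<integral>\<^sup>+x. ennreal (u x) * indicator S x \<partial>lborel)
       = (if u absolutely_integrable_on S then ennreal (integral S u) else \<infinity>)"
proof -
  have m: "(\<lambda>x. indicator S x * u x) \<in> borel_measurable lebesgue"
    using u measurable_completion by blast
  have eq: "(\<integral>\<^sup>+x. ennreal (u x) * indicator S x \<partial>lborel)
      = (\<integral>\<^sup>+x. ennreal (indicator S x * u x) \<partial>lebesgue)"
    unfolding nn_integral_completion by (intro nn_integral_cong) (auto simp: indicator_def)
  have nn': "0 \<le> indicator S x * u x" for x
    using nn by (auto simp: indicator_def)
  show ?thesis
  proof (cases "u absolutely_integrable_on S")
    case True
    then have i: "integrable lebesgue (\<lambda>x. indicator S x * u x)"
      by (simp add: set_integrable_def)
    have "(\<integral>\<^sup>+x. ennreal (indicator S x * u x) \<partial>lebesgue) = ennreal (LINT x|lebesgue. indicator S x * u x)"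
      by (intro nn_integral_eq_integral i) (use nn' in auto)
    also have "(LINT x|lebesgue. indicator S x * u x) = integral S u"
      using set_lebesgue_integral_eq_integral(2)[OF True] by (simp add: set_lebesgue_integral_def)
    finally show ?thesis using eq True by simp
  next
    case False
    then have "\<not> integrable lebesgue (\<lambda>x. indicator S x * u x)"
      by (simp add: set_integrable_def)
    then have "(\<integral>\<^sup>+x. ennreal (indicator S x * u x) \<partial>lebesgue) = \<infinity>"
      using integrableI_nonneg[OF m AE_I2[OF nn']] by (auto simp: less_top[symmetric])
    then show ?thesis using eq False by simp
  qed
qed

text \<open>Multiplication by \<open>c\<close> is a rotation followed by a scaling by
  \<open>|c|\<close>; this is the Jacobian of a holomorphic map in the form given by the
  Cauchy-Riemann equations.\<close>

lemma det_matrix_complex_mult: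
  "det (matrix (vec_of_complex \<circ> (\<lambda>z. c * z) \<circ> complex_of_vec)) = (cmod c)\<^sup>2"
  unfolding cmod_power2 det_2
  by (simp add: matrix_def complex_of_vec_def vec_of_complex_def axis_def) (simp add: power2_eq_square)

text \<open>The change-of-variables theorem for \<open>real^2\<close> is an equivalence between
  integrability with a given value on the two sides. It therefore also transfers divergence, which
  is what an identity in \<open>ennreal\<close> demands.\<close>

theorem nn_integral_holomorphic_substitution:
  fixes g :: "complex \<Rightarrow> complex" and F :: "complex \<Rightarrow> real"
  assumes S: "open S" and g: "g holomorphic_on S" and inj: "inj_on g S"
    and F [measurable]: "F \<in> borel_measurable borel" and nn: "\<And>z. 0 \<le> F z"
  shows "(\<integral>\<^sup>+z. ennreal (F z) * indicator (g ` S) z \<partial>lborel)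
       = (\<integral>\<^sup>+z. ennreal ((cmod (deriv g z))\<^sup>2 * F (g z)) * indicator S z \<partial>lborel)"
proof -
  define G where "G = vec_of_complex \<circ> g \<circ> complex_of_vec"
  define G' where "G' v = vec_of_complex \<circ> (\<lambda>z. deriv g (complex_of_vec v) * z) \<circ> complex_of_vec" for v
  define V where "V = complex_of_vec -` S"
  have oV: "open V"
    unfolding V_def by (intro open_vimage S linear_continuous_on bounded_linear_complex_of_vec)
  have op: "open (g ` S)"
    by (rule open_mapping_thm3[OF g S inj])
  have der: "(G has_derivative G' v) (at v within V)" if "v \<in> V" for v
  proof -
    have "(g has_field_derivative deriv g (complex_of_vec v)) (at (complex_of_vec v))"
      using that g S holomorphic_derivI unfolding V_def by blast
    then have "(g has_derivative (\<lambda>z. deriv g (complex_of_vec v) * z)) (at (complex_of_vec v))"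
      by (simp add: has_field_derivative_def)
    then have "(G has_derivative G' v) (at v)"
      unfolding G_def G'_def
      by (intro diff_chain_at bounded_linear_imp_has_derivative bounded_linear_complex_of_vec
          bounded_linear_vec_of_complex) 
    then show ?thesis by (rule has_derivative_at_withinI)
  qed
  have injG: "inj_on G V"
  proof (rule inj_onI)
    fix x y assume *: "x \<in> V" "y \<in> V" "G x = G y"
    then have "g (complex_of_vec x) = g (complex_of_vec y)"
      unfolding G_def by (metis comp_apply complex_of_vec_inverse)
    with inj * have "complex_of_vec x = complex_of_vec y"
      by (auto simp: V_def dest: inj_onD)
    then show "x = y" by (metis vec_of_complex_inverse)
  qed
  have GV: "G ` V = complex_of_vec -` (g ` S)"
  proof (intro equalityI subsetI)
    fix v assume "v \<in> complex_of_vec -` (g ` S)"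
    then obtain z where z: "z \<in> S" "complex_of_vec v = g z" by auto
    then have "v = G (vec_of_complex z)" "vec_of_complex z \<in> V"
      by (auto simp: G_def V_def) (metis vec_of_complex_inverse)
    then show "v \<in> G ` V" by blast
  qed (auto simp: G_def V_def)
  define f where "f = (\<lambda>v. F (complex_of_vec v))"
  have fm: "f \<in> borel_measurable borel" unfolding f_def by measurable
  define u where "u v = \<bar>det (matrix (G' v))\<bar> * f (G v)" for v
  have u_eq: "u v = (cmod (deriv g (complex_of_vec v)))\<^sup>2 * F (g (complex_of_vec v))" for v
    by (simp add: u_def G'_def det_matrix_complex_mult f_def G_def)
  have lV: "V \<in> sets lebesgue" using oV by auto
  have cov: "(\<lambda>x. \<bar>det (matrix (G' x))\<bar> *\<^sub>R (vec (f (G x)) :: real^1)) absolutely_integrable_on V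
      \<and> integral V (\<lambda>x. \<bar>det (matrix (G' x))\<bar> *\<^sub>R (vec (f (G x)) :: real^1)) = vec b
     \<longleftrightarrow> (\<lambda>x. vec (f x) :: real^1) absolutely_integrable_on (G ` V)
        \<and> integral (G ` V) (\<lambda>x. vec (f x) :: real^1) = vec b" for b
    by (rule has_absolute_integral_change_of_variables[OF lV der injG])
  have sc: "\<bar>det (matrix (G' x))\<bar> *\<^sub>R (vec (f (G x)) :: real^1) = vec (u x)" for x
    by (simp add: u_def vec_eq_iff)
  have cov': "u absolutely_integrable_on V \<and> integral V u = b
     \<longleftrightarrow> f absolutely_integrable_on (G ` V) \<and> integral (G ` V) f = b" for b
    using cov[of b] unfolding sc
    by (simp add: absolutely_integrable_on_1_iff integral_on_1_eq)
  have dg: "continuous_on S (deriv g)" "continuous_on S g"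
    using g S by (auto intro!: holomorphic_on_imp_continuous_on holomorphic_deriv)
  have m1: "(\<lambda>z. (cmod (deriv g z))\<^sup>2 * F (g z) * indicator S z) \<in> borel_measurable borel"
  proof -
    have [measurable]: "S \<in> sets borel" using S by auto
    have a: "(\<lambda>z. (cmod (deriv g z))\<^sup>2 * indicator S z) \<in> borel_measurable borel"
      using borel_measurable_continuous_on_indicator[of S "\<lambda>z. (cmod (deriv g z))\<^sup>2"] dg(1) S
      by (simp add: mult.commute continuous_on_norm continuous_on_power)
    \<comment> \<open>Nothing is known about \<open>g\<close> outside \<open>S\<close>, so it is set
      to 0 there before composing with \<open>F\<close>; the indicator in the other factor makes the
      changed values irrelevant.\<close>
    have "(\<lambda>z. indicator S z *\<^sub>R g z) \<in> borel_measurable borel"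
      using borel_measurable_continuous_on_indicator[of S g] dg(2) by auto
    then have b: "(\<lambda>z. F (indicator S z *\<^sub>R g z)) \<in> borel_measurable borel"
      by measurable
    have "(\<lambda>z. ((cmod (deriv g z))\<^sup>2 * indicator S z) * F (indicator S z *\<^sub>R g z)) \<in> borel_measurable borel"
      using a b by measurable
    also have "(\<lambda>z. ((cmod (deriv g z))\<^sup>2 * indicator S z) * F (indicator S z *\<^sub>R g z))
      = (\<lambda>z. (cmod (deriv g z))\<^sup>2 * F (g z) * indicator S z)"
      by (auto simp: indicator_def fun_eq_iff)
    finally show ?thesis .
  qed
  have m1': "(\<lambda>v. indicator V v * u v) \<in> borel_measurable lborel"
  proof -
    have "(\<lambda>v. indicator V v * u v) = (\<lambda>z. (cmod (deriv g z))\<^sup>2 * F (g z) * indicator S z) \<circ> complex_of_vec"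
      by (auto simp: u_eq V_def indicator_def fun_eq_iff)
    then show ?thesis using measurable_comp[OF complex_of_vec_measurable m1] by simp
  qed
  have mGV: "G ` V \<in> sets borel"
    unfolding GV by (intro borel_open open_vimage op linear_continuous_on bounded_linear_complex_of_vec)
  have [measurable]: "S \<in> sets borel" "g ` S \<in> sets borel" using S op by auto
  have "(\<integral>\<^sup>+z. ennreal (F z) * indicator (g ` S) z \<partial>lborel)
      = (\<integral>\<^sup>+v. ennreal (f v) * indicator (G ` V) v \<partial>lborel)"
    unfolding GV f_def by (subst nn_integral_complex_vec) (auto simp: indicator_def)
  also have "\<dots> = (if f absolutely_integrable_on (G ` V) then ennreal (integral (G ` V) f) else \<infinity>)"
    by (rule nn_integral_eq_integral_or_top) (use fm mGV nn f_def in auto)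
  \<comment> \<open>Taking for \<open>b\<close> the actual integral of either side shows that both
    functions are integrable with the same integral or that neither is.\<close>
  also have "\<dots> = (if u absolutely_integrable_on V then ennreal (integral V u) else \<infinity>)"
    using cov'[of "integral V u"] cov'[of "integral (G ` V) f"] by metis
  also have "\<dots> = (\<integral>\<^sup>+v. ennreal (u v) * indicator V v \<partial>lborel)"
    by (rule nn_integral_eq_integral_or_top[symmetric]) (use m1' nn u_eq in simp_all)
  also have "\<dots> = (\<integral>\<^sup>+v. ennreal ((cmod (deriv g (complex_of_vec v)))\<^sup>2 * F (g (complex_of_vec v))
                       * indicator S (complex_of_vec v)) \<partial>lborel)"
    by (intro nn_integral_cong) (auto simp: u_eq V_def indicator_def)
  also have "\<dots> = (\<integral>\<^sup>+z. ennreal ((cmod (deriv g z))\<^sup>2 * F (g z) * indicator S z) \<partial>lborel)"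
    by (rule nn_integral_complex_vec[symmetric, OF measurable_compose[OF m1 measurable_ennreal]])
  also have "\<dots> = (\<integral>\<^sup>+z. ennreal ((cmod (deriv g z))\<^sup>2 * F (g z)) * indicator S z \<partial>lborel)"
    by (intro nn_integral_cong) (auto simp: indicator_def)
  finally show ?thesis .
qed

section \<open>Radial integrals and the Parseval formula on the disc\<close>

lemma emeasure_lborel_disc: "0 \<le> r \<Longrightarrow> emeasure lborel (ball (c::complex) r) = ennreal (pi * r\<^sup>2)"
  by (simp add: emeasure_ball unit_ball_vol_2 ennreal_mult' power2_eq_square flip: ennreal_power)

lemma emeasure_lborel_cdisc: "0 \<le> r \<Longrightarrow> emeasure lborel (cball (c::complex) r) = ennreal (pi * r\<^sup>2)"
  by (simp add: emeasure_cball unit_ball_vol_2 ennreal_mult' power2_eq_square flip: ennreal_power)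

text \<open>The image of area measure on the disc under \<open>|z|^2\<close> is \<open>pi\<close>
  times length, because a disc of radius \<open>r\<close> has area \<open>pi * r^2\<close>.
  Comparing both measures on the half-lines \<open>{x<..}\<close> suffices, so no angular variable
  appears.\<close>

lemma nn_integral_radial:
  fixes h :: "real \<Rightarrow> ennreal"
  assumes R: "0 < R" and h [measurable]: "h \<in> borel_measurable borel"
  shows "(\<integral>\<^sup>+z. h ((cmod z)\<^sup>2) * indicator (ball 0 R) z \<partial>lborel)
       = ennreal pi * (\<integral>\<^sup>+s. h s * indicator {0<..<R\<^sup>2} s \<partial>lborel)"
proof -
  define M1 where "M1 = distr (density lborel (indicator (ball (0::complex) R))) borel (\<lambda>z. (cmod z)\<^sup>2)"
  define M2 where "M2 = density lborel (\<lambda>s. ennreal pi * indicator {0<..<R\<^sup>2} s)"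
  have e1: "emeasure M1 {x<..} = ennreal (pi * (if x < 0 then R\<^sup>2 else if x < R\<^sup>2 then R\<^sup>2 - x else 0))" for x
  proof -
    have "emeasure M1 {x<..} = emeasure lborel (ball (0::complex) R \<inter> (\<lambda>z. (cmod z)\<^sup>2) -` {x<..})"
      unfolding M1_def
      by (subst emeasure_distr) (auto intro!: emeasure_restricted borel_open open_vimage continuous_intros)
    also have "\<dots> = ennreal (pi * (if x < 0 then R\<^sup>2 else if x < R\<^sup>2 then R\<^sup>2 - x else 0))"
    proof (cases "x < 0")
      case True
      then have "ball (0::complex) R \<inter> (\<lambda>z. (cmod z)\<^sup>2) -` {x<..} = ball 0 R"
        by (auto intro: less_le_trans[of x 0, OF _ zero_le_power2])
      then show ?thesis using True R by (simp add: emeasure_lborel_disc)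
    next
      case False
      show ?thesis
      proof (cases "x < R\<^sup>2")
        case True
        have sx: "sqrt x < R"
          using True False R by (metis abs_of_pos real_sqrt_abs real_sqrt_less_iff)
        have "ball (0::complex) R \<inter> (\<lambda>z. (cmod z)\<^sup>2) -` {x<..} = ball 0 R - cball 0 (sqrt x)"
        proof -
          have "x < (cmod z)\<^sup>2 \<longleftrightarrow> sqrt x < cmod z" for z :: complex
            using real_sqrt_less_iff[of x "(cmod z)\<^sup>2"] by simp
          then show ?thesis by (auto simp: not_le)
        qed
        also have "emeasure lborel \<dots> = ennreal (pi * R\<^sup>2) - ennreal (pi * x)"
          using sx False R
          by (subst emeasure_Diff) (simp_all add: emeasure_lborel_disc emeasure_lborel_cdisc cball_subset_ball_iff)
        also have "\<dots> = ennreal (pi * (R\<^sup>2 - x))"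
          using False by (subst ennreal_minus) (auto simp: right_diff_distrib)
        finally show ?thesis using True False by simp
      next
        case F2: False
        have "ball (0::complex) R \<inter> (\<lambda>z. (cmod z)\<^sup>2) -` {x<..} = {}"
        proof -
          have "(cmod z)\<^sup>2 \<le> x" if "cmod z < R" for z
            using that F2 R by (smt (verit) norm_ge_zero power_mono)
          then show ?thesis by (auto simp: not_less[symmetric])
        qed
        then show ?thesis using False F2 by simp
      qed
    qed
    finally show ?thesis .
  qed
  have e2: "emeasure M2 {x<..} = ennreal (pi * (if x < 0 then R\<^sup>2 else if x < R\<^sup>2 then R\<^sup>2 - x else 0))" for x
  proof -
    have "emeasure M2 {x<..} = ennreal pi * emeasure lborel ({0<..<R\<^sup>2} \<inter> {x<..})"
      unfolding M2_def
      by (subst emeasure_density) (auto simp: mult.assoc nn_integral_cmult simp flip: indicator_inter_arith)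
    also have "{0<..<R\<^sup>2} \<inter> {x<..} = {max 0 x<..<R\<^sup>2}" by auto
    finally show ?thesis
      using R by (cases "x < 0"; cases "x < R\<^sup>2") (simp_all add: max_def ennreal_mult' not_less)
  qed
  have "M1 = M2"
    by (rule measure_eqI_lessThan) (use e1 e2 in \<open>auto simp: M1_def M2_def\<close>)
  have i1: "(\<integral>\<^sup>+s. h s \<partial>M1) = (\<integral>\<^sup>+z. indicator (ball 0 R) z * h ((cmod z)\<^sup>2) \<partial>lborel)"
  proof -
    have "(\<integral>\<^sup>+s. h s \<partial>M1) = (\<integral>\<^sup>+z. h ((cmod z)\<^sup>2) \<partial>density lborel (indicator (ball (0::complex) R)))"
      unfolding M1_def by (rule nn_integral_distr) simp_all
    also have "\<dots> = (\<integral>\<^sup>+z. indicator (ball 0 R) z * h ((cmod z)\<^sup>2) \<partial>lborel)"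
      by (rule nn_integral_density) (simp_all add: borel_measurable_indicator)
    finally show ?thesis .
  qed
  have i2: "(\<integral>\<^sup>+s. h s \<partial>M2) = ennreal pi * (\<integral>\<^sup>+s. h s * indicator {0<..<R\<^sup>2} s \<partial>lborel)"
  proof -
    have "(\<integral>\<^sup>+s. h s \<partial>M2) = (\<integral>\<^sup>+s. ennreal pi * indicator {0<..<R\<^sup>2} s * h s \<partial>lborel)"
      unfolding M2_def by (rule nn_integral_density) simp_all
    also have "\<dots> = (\<integral>\<^sup>+s. ennreal pi * (h s * indicator {0<..<R\<^sup>2} s) \<partial>lborel)"
      by (intro nn_integral_cong) (simp add: mult_ac)
    also have "\<dots> = ennreal pi * (\<integral>\<^sup>+s. h s * indicator {0<..<R\<^sup>2} s \<partial>lborel)"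
      by (rule nn_integral_cmult) simp
    finally show ?thesis .
  qed
  show ?thesis
    using i1 i2 \<open>M1 = M2\<close> by (simp add: mult.commute)
qed

lemma nn_integral_powr_Ioo:
  assumes "0 < c" "-1 < \<alpha>"
  shows "(\<integral>\<^sup>+s. ennreal (s powr \<alpha>) * indicator {0<..<c} s \<partial>lborel) = ennreal (c powr (\<alpha> + 1) / (\<alpha> + 1))"
proof -
  have i: "((\<lambda>s. s powr \<alpha>) has_integral (c powr (\<alpha> + 1) / (\<alpha> + 1))) {0..c}"
    using has_integral_powr_from_0[of \<alpha> c] assms by auto
  have "(\<integral>\<^sup>+s. ennreal (s powr \<alpha>) * indicator {0<..<c} s \<partial>lborel)
     = (\<integral>\<^sup>+s. ennreal (s powr \<alpha> * indicator {0..c} s) \<partial>lborel)"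
    by (intro nn_integral_cong_AE AE_mp[OF AE_lborel_singleton[of 0] AE_mp[OF AE_lborel_singleton[of c] AE_I2]])
       (auto simp: indicator_def)
  also have "\<dots> = ennreal (c powr (\<alpha> + 1) / (\<alpha> + 1))"
    using nn_integral_has_integral_lebesgue[OF _ i] by (simp add: mult.commute)
  finally show ?thesis .
qed

lemma nn_integral_power_Ioo:
  "(\<integral>\<^sup>+s. ennreal (s ^ n) * indicator {0<..<1::real} s \<partial>lborel) = ennreal (1 / (real n + 1))"
proof -
  have "(\<integral>\<^sup>+s. ennreal (s ^ n) * indicator {0<..<1::real} s \<partial>lborel)
    = (\<integral>\<^sup>+s. ennreal (s powr real n) * indicator {0<..<1::real} s \<partial>lborel)"
    by (intro nn_integral_cong) (auto simp: indicator_def powr_realpow)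
  then show ?thesis by (simp add: nn_integral_powr_Ioo)
qed

text \<open>The value is \<open>1/(n+1) - 1/(n+2)\<close>. The second integral is added first and
  cancelled afterwards, since cancellation in \<open>ennreal\<close> requires a finite term.\<close>

lemma nn_integral_power_one_minus_Ioo:
  "(\<integral>\<^sup>+s. ennreal (s ^ n * (1 - s)) * indicator {0<..<1::real} s \<partial>lborel)
     = ennreal (1 / ((real n + 1) * (real n + 2)))"
proof -
  let ?I = "\<integral>\<^sup>+s. ennreal (s ^ n * (1 - s)) * indicator {0<..<1::real} s \<partial>lborel"
  have "?I + ennreal (1 / (real (Suc n) + 1)) = ?I + (\<integral>\<^sup>+s. ennreal (s ^ Suc n) * indicator {0<..<1::real} s \<partial>lborel)"
    by (simp only: nn_integral_power_Ioo)
  also have "\<dots> = (\<integral>\<^sup>+s. ennreal (s ^ n) * indicator {0<..<1::real} s \<partial>lborel)"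
    by (subst nn_integral_add[symmetric])
       (auto intro!: nn_integral_cong simp: indicator_def algebra_simps simp flip: ennreal_plus)
  also have "\<dots> = ennreal (1 / (real n + 1))" by (rule nn_integral_power_Ioo)
  finally have "?I + ennreal (1 / (real (Suc n) + 1)) - ennreal (1 / (real (Suc n) + 1))
      = ennreal (1 / (real n + 1)) - ennreal (1 / (real (Suc n) + 1))" by simp
  then have "?I = ennreal (1 / (real n + 1) - 1 / (real (Suc n) + 1))"
    by (simp add: ennreal_minus)
  also have "1 / (real n + 1) - 1 / (real (Suc n) + 1) = 1 / ((real n + 1) * (real n + 2))"
    by (simp add: divide_simps)
  finally show ?thesis .
qed

section \<open>Rules for normalised area integrals\<close>

lemma open_unit_disc [simp]: "open unit_disc"
  by (simp add: unit_disc_def)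

lemma unit_disc_measurable [measurable]: "unit_disc \<in> sets borel"
  by (simp add: unit_disc_def)

lemma mem_unit_disc: "z \<in> unit_disc \<longleftrightarrow> cmod z < 1"
  by (simp add: unit_disc_def)

lemma dA_int_cong: "(\<And>z. z \<in> S \<Longrightarrow> u z = v z) \<Longrightarrow> dA_int S u = dA_int S v"
  unfolding dA_int_def by (intro nn_integral_cong) (auto simp: indicator_def)

lemma dA_int_mono: "(\<And>z. z \<in> S \<Longrightarrow> u z \<le> v z) \<Longrightarrow> S \<subseteq> T \<Longrightarrow> dA_int S u \<le> dA_int T v"
  unfolding dA_int_def by (intro nn_integral_mono) (auto simp: indicator_def intro!: ennreal_leI divide_right_mono)

lemma dA_int_substitution:
  fixes F :: "complex \<Rightarrow> real"
  assumes S: "open S" and g: "g holomorphic_on S" and inj: "inj_on g S" and T: "g ` S = T"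
    and F: "continuous_on T F" and nn: "\<And>z. z \<in> T \<Longrightarrow> 0 \<le> F z"
  shows "dA_int T F = dA_int S (\<lambda>z. (cmod (deriv g z))\<^sup>2 * F (g z))"
proof -
  have oT: "open T" using open_mapping_thm3[OF g S inj] T by simp
  have m: "(\<lambda>z. indicator T z *\<^sub>R (F z / pi)) \<in> borel_measurable borel"
    using borel_measurable_continuous_on_indicator[of T "\<lambda>z. F z / pi"] oT
      continuous_on_divide[OF F continuous_on_const, of pi] by simp
  have "dA_int T F = (\<integral>\<^sup>+z. ennreal (indicator T z *\<^sub>R (F z / pi)) * indicator (g ` S) z \<partial>lborel)"
    unfolding dA_int_def T by (intro nn_integral_cong) (auto simp: indicator_def)
  also have "\<dots> = (\<integral>\<^sup>+z. ennreal ((cmod (deriv g z))\<^sup>2 * (indicator T (g z) *\<^sub>R (F (g z) / pi))) * indicator S z \<partial>lborel)"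
    by (rule nn_integral_holomorphic_substitution[OF S g inj m]) (use nn in \<open>auto simp: indicator_def\<close>)
  also have "\<dots> = dA_int S (\<lambda>z. (cmod (deriv g z))\<^sup>2 * F (g z))"
    unfolding dA_int_def using T by (intro nn_integral_cong) (auto simp: indicator_def)
  finally show ?thesis .
qed

lemma dA_int_rotate:
  fixes F :: "complex \<Rightarrow> real"
  assumes c: "cmod c = 1" and F [measurable]: "F \<in> borel_measurable borel" and nn: "\<And>z. 0 \<le> F z"
  shows "dA_int unit_disc (\<lambda>z. F (c * z)) = dA_int unit_disc F"
proof -
  have c0: "c \<noteq> 0" using c by auto
  have im: "(\<lambda>z. c * z) ` unit_disc = unit_disc"
  proof (intro equalityI subsetI)
    fix z assume "z \<in> unit_disc"
    then have "z = c * (z / c)" "z / c \<in> unit_disc"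
      using c c0 by (auto simp: mem_unit_disc norm_divide)
    then show "z \<in> (\<lambda>z. c * z) ` unit_disc" by blast
  qed (use c in \<open>auto simp: mem_unit_disc norm_mult\<close>)
  have "dA_int unit_disc F = (\<integral>\<^sup>+z. ennreal ((cmod (deriv (\<lambda>z. c * z) z))\<^sup>2 * (F (c * z) / pi)) * indicator unit_disc z \<partial>lborel)"
    unfolding dA_int_def
    by (subst im[symmetric], rule nn_integral_holomorphic_substitution)
       (use c0 nn in \<open>auto intro!: holomorphic_intros inj_onI\<close>)
  then show ?thesis using c by (simp add: dA_int_def)
qed

section \<open>Roots of unity, Taylor coefficients and Parseval\<close>

lemma sum_root_of_unity_powers:
  fixes e :: complex
  assumes "e ^ N = 1" "e \<noteq> 1"
  shows "(\<Sum>k<N. e ^ k) = 0"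
  using assms geometric_sum[of e N] by simp

text \<open>Discrete Parseval identity: the characters of the cyclic group of order \<open>N\<close>
  are orthogonal.\<close>

lemma mean_norm_power2_roots_of_unity:
  fixes x :: "nat \<Rightarrow> complex"
  assumes N: "N > 0"
  defines "e \<equiv> \<lambda>n. cis (2 * pi * real n / real N)"
  shows "(\<Sum>k<N. (cmod (\<Sum>n<N. x n * e k ^ n))\<^sup>2) = real N * (\<Sum>n<N. (cmod (x n))\<^sup>2)"
proof -
  \<comment> \<open>This symmetry turns the sum over the evaluation points \<open>e k\<close> into a
    geometric sum in \<open>e n * cnj (e m)\<close>.\<close>
  have sw: "e k ^ n = e n ^ k" for k n
    by (simp add: e_def Complex.DeMoivre mult.left_commute mult.commute)
  have inj: "inj_on e {..<N}"
    using Complex.bij_betw_roots_unity[OF N] unfolding e_def bij_betw_def by simp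
  have root: "e n ^ N = 1" for n
    using N by (simp add: e_def Complex.DeMoivre mult.commute flip: cis_multiple_2pi)
       (metis cis_multiple_2pi Ints_of_nat mult.commute of_nat_0_less_iff nonzero_mult_div_cancel_left)
  have ne: "cmod (e n) = 1" for n by (simp add: e_def)
  have orth: "(\<Sum>k<N. (e n * cnj (e m)) ^ k) = (if n = m then of_nat N else 0)"
    if "n < N" "m < N" for n m
  proof (cases "n = m")
    case True
    then have "e n * cnj (e m) = 1"
      by (simp add: complex_norm_square[symmetric] ne)
    then show ?thesis using True by simp
  next
    case False
    have "e n * cnj (e m) \<noteq> 1"
    proof
      assume "e n * cnj (e m) = 1"
      then have "e n * (cnj (e m) * e m) = e m" by (simp add: mult.assoc[symmetric])
      then have "e n = e m"
        by (simp add: mult.commute[of "cnj _"] complex_norm_square[symmetric] ne)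
      with inj that False show False by (auto dest: inj_onD)
    qed
    moreover have "(e n * cnj (e m)) ^ N = 1"
      by (simp add: power_mult_distrib root flip: complex_cnj_power)
    ultimately show ?thesis using False sum_root_of_unity_powers by auto
  qed
  have "of_real (\<Sum>k<N. (cmod (\<Sum>n<N. x n * e k ^ n))\<^sup>2)
     = (\<Sum>k<N. (\<Sum>n<N. x n * e n ^ k) * cnj (\<Sum>m<N. x m * e m ^ k))"
    by (simp add: complex_norm_square sw[of _ _] flip: of_real_power)
  also have "\<dots> = (\<Sum>k<N. \<Sum>n<N. \<Sum>m<N. x n * cnj (x m) * (e n * cnj (e m)) ^ k)"
    by (simp add: sum_product power_mult_distrib mult_ac)
  also have "\<dots> = (\<Sum>n<N. \<Sum>m<N. x n * cnj (x m) * (\<Sum>k<N. (e n * cnj (e m)) ^ k))"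
    by (subst sum.swap, rule sum.cong[OF refl], subst sum.swap) (simp add: sum_distrib_left)
  also have "\<dots> = (\<Sum>n<N. \<Sum>m<N. x n * cnj (x m) * (if n = m then of_nat N else 0))"
    by (intro sum.cong refl) (simp add: orth)
  also have "\<dots> = (\<Sum>n<N. x n * cnj (x n) * of_nat N)"
    by (intro sum.cong refl) (simp add: if_distrib sum.delta' cong: if_cong)
  also have "\<dots> = of_real (real N * (\<Sum>n<N. (cmod (x n))\<^sup>2))"
    by (simp add: complex_norm_square sum_distrib_left mult.commute del: of_real_power)
  finally show ?thesis by (simp only: of_real_eq_iff)
qed

definition taylor_coeff :: "(complex \<Rightarrow> complex) \<Rightarrow> nat \<Rightarrow> complex" where
  "taylor_coeff f n = (deriv ^^ n) f 0 / fact n"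

lemma taylor_sums:
  assumes "f holomorphic_on unit_disc" "z \<in> unit_disc"
  shows "(\<lambda>n. taylor_coeff f n * z ^ n) sums f z"
  using holomorphic_power_series[of f 0 1 z] assms by (simp add: taylor_coeff_def unit_disc_def)

lemma taylor_summable_norm:
  assumes f: "f holomorphic_on unit_disc" and r: "0 \<le> r" "r < 1"
  shows "summable (\<lambda>n. cmod (taylor_coeff f n) * r ^ n)"
proof -
  define s where "s = (1 + r) / 2"
  have s: "r < s" "s < 1" "0 < s" using r by (auto simp: s_def)
  then have "complex_of_real s \<in> unit_disc" by (simp add: mem_unit_disc)
  then have "summable (\<lambda>n. taylor_coeff f n * complex_of_real s ^ n)"
    using taylor_sums[OF f] sums_summable by blast
  then have "summable (\<lambda>n. norm (taylor_coeff f n * complex_of_real r ^ n))"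
    by (rule powser_insidea) (use r s in simp)
  then show ?thesis using r by (simp add: norm_mult norm_power)
qed

lemma dA_int_sum:
  assumes "finite A" and "\<And>i. i \<in> A \<Longrightarrow> u i \<in> borel_measurable borel"
    and "\<And>i z. i \<in> A \<Longrightarrow> 0 \<le> u i z" and "S \<in> sets borel"
  shows "dA_int S (\<lambda>z. \<Sum>i\<in>A. u i z) = (\<Sum>i\<in>A. dA_int S (u i))"
proof -
  have "dA_int S (\<lambda>z. \<Sum>i\<in>A. u i z) = (\<integral>\<^sup>+z. (\<Sum>i\<in>A. ennreal (u i z / pi) * indicator S z) \<partial>lborel)"
    unfolding dA_int_def using assms
    by (intro nn_integral_cong) (simp add: sum_divide_distrib sum_distrib_right[symmetric] sum_nonneg)
  also have "\<dots> = (\<Sum>i\<in>A. dA_int S (u i))"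
    unfolding dA_int_def using assms by (intro nn_integral_sum) auto
  finally show ?thesis .
qed

lemma dA_int_cmult:
  assumes [measurable]: "u \<in> borel_measurable borel" "S \<in> sets borel" and c: "0 \<le> c"
  shows "dA_int S (\<lambda>z. c * u z) = ennreal c * dA_int S u"
proof -
  have "dA_int S (\<lambda>z. c * u z) = (\<integral>\<^sup>+z. ennreal c * (ennreal (u z / pi) * indicator S z) \<partial>lborel)"
    unfolding dA_int_def using c
    by (intro nn_integral_cong) (auto simp: ennreal_mult' mult.assoc simp flip: times_divide_eq_right)
  then show ?thesis by (simp add: nn_integral_cmult dA_int_def)
qed

lemma dA_int_radial:
  assumes [measurable]: "h \<in> borel_measurable borel" and R: "0 < R"
  shows "dA_int (ball 0 R) (\<lambda>z. h ((cmod z)\<^sup>2)) = (\<integral>\<^sup>+s. ennreal (h s) * indicator {0<..<R\<^sup>2} s \<partial>lborel)"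
proof -
  have "dA_int (ball 0 R) (\<lambda>z. h ((cmod z)\<^sup>2))
      = (\<integral>\<^sup>+z. (ennreal (h ((cmod z)\<^sup>2)) * ennreal (1 / pi)) * indicator (ball 0 R) z \<partial>lborel)"
    unfolding dA_int_def
    by (intro nn_integral_cong) (simp flip: ennreal_mult'')
  also have "\<dots> = ennreal pi * (\<integral>\<^sup>+s. ennreal (h s) * ennreal (1 / pi) * indicator {0<..<R\<^sup>2} s \<partial>lborel)"
    by (rule nn_integral_radial[OF R, of "\<lambda>s. ennreal (h s) * ennreal (1 / pi)"]) simp
  also have "\<dots> = ennreal pi * (ennreal (1 / pi) * (\<integral>\<^sup>+s. ennreal (h s) * indicator {0<..<R\<^sup>2} s \<partial>lborel))"
    by (subst nn_integral_cmult[symmetric]) (auto simp: mult_ac)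
  also have "\<dots> = (\<integral>\<^sup>+s. ennreal (h s) * indicator {0<..<R\<^sup>2} s \<partial>lborel)"
    by (simp add: mult.assoc[symmetric] flip: ennreal_mult'')
  finally show ?thesis .
qed

text \<open>Averaging over the \<open>N\<close>-th roots of unity diagonalises the square of a polynomial of degree
  less than \<open>N\<close>, and rotations preserve area.\<close>
lemma disc_Parseval_polynomial:
  fixes b :: "nat \<Rightarrow> complex"
  assumes wm: "w \<in> borel_measurable borel" and w0: "\<And>s. 0 \<le> w s"
  shows "dA_int unit_disc (\<lambda>z. (cmod (\<Sum>n<N. b n * z ^ n))\<^sup>2 * w ((cmod z)\<^sup>2))
       = dA_int unit_disc (\<lambda>z. (\<Sum>n<N. (cmod (b n))\<^sup>2 * ((cmod z)\<^sup>2) ^ n) * w ((cmod z)\<^sup>2))"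
proof (cases "N = 0")
  case False
  define e where "e k = cis (2 * pi * real k / real N)" for k
  define P where "P z = (cmod (\<Sum>n<N. b n * z ^ n))\<^sup>2 * w ((cmod z)\<^sup>2)" for z
  define Q where "Q z = (\<Sum>n<N. (cmod (b n))\<^sup>2 * ((cmod z)\<^sup>2) ^ n) * w ((cmod z)\<^sup>2)" for z :: complex
  have [measurable]: "P \<in> borel_measurable borel" "Q \<in> borel_measurable borel"
    unfolding P_def Q_def using wm by measurable
  have "of_nat N * dA_int unit_disc P = (\<Sum>k<N. dA_int unit_disc (\<lambda>z. P (e k * z)))"
    by (subst dA_int_rotate) (auto simp: e_def P_def w0)
  also have "\<dots> = dA_int unit_disc (\<lambda>z. \<Sum>k<N. P (e k * z))"
  proof (rule dA_int_sum[symmetric])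
    show "(\<lambda>z. P (e k * z)) \<in> borel_measurable borel" for k
      by measurable
  qed (auto simp: P_def w0)
  also have "(\<lambda>z. \<Sum>k<N. P (e k * z)) = (\<lambda>z. real N * Q z)"
  proof
    fix z :: complex
    have "(\<Sum>k<N. P (e k * z)) = (\<Sum>k<N. (cmod (\<Sum>n<N. (b n * z ^ n) * e k ^ n))\<^sup>2) * w ((cmod z)\<^sup>2)"
    proof -
      have "cmod (e k * z) = cmod z" for k by (simp add: norm_mult e_def)
      then show ?thesis
        by (simp add: P_def sum_distrib_right sum_distrib_left power_mult_distrib mult_ac)
    qed
    also have "\<dots> = real N * (\<Sum>n<N. (cmod (b n * z ^ n))\<^sup>2) * w ((cmod z)\<^sup>2)"
      unfolding e_def using False by (subst mean_norm_power2_roots_of_unity) auto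
    also have "\<dots> = real N * Q z"
      by (simp add: Q_def norm_mult norm_power power_mult_distrib mult.assoc mult.commute[of 2] flip: power_mult)
    finally show "(\<Sum>k<N. P (e k * z)) = real N * Q z" .
  qed
  also have "dA_int unit_disc (\<lambda>z. real N * Q z) = of_nat N * dA_int unit_disc Q"
    by (subst dA_int_cmult) (auto simp: ennreal_of_nat_eq_real_of_nat)
  finally have "of_nat N * dA_int unit_disc P = of_nat N * dA_int unit_disc Q" .
  \<comment> \<open>The factor \<open>N\<close> is finite and nonzero, so it cancels even if the
    integrals are infinite.\<close>
  then have "dA_int unit_disc P = dA_int unit_disc Q"
    using False by (simp add: ennreal_mult_cancel_left)
  then show ?thesis unfolding P_def Q_def .
qed simp

text \<open>Monotone convergence, so that an identity on the disc, infinite values included, need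
  only be checked on smaller balls, where Taylor series converge uniformly.\<close>

lemma nn_integral_ball_exhaustion:
  fixes f g :: "complex \<Rightarrow> ennreal"
  assumes [measurable]: "f \<in> borel_measurable borel" "g \<in> borel_measurable borel"
    and eq: "\<And>r. 0 < r \<Longrightarrow> r < 1 \<Longrightarrow>
      (\<integral>\<^sup>+z. f z * indicator (ball 0 r) z \<partial>lborel) = (\<integral>\<^sup>+z. g z * indicator (ball 0 r) z \<partial>lborel)"
  shows "(\<integral>\<^sup>+z. f z * indicator unit_disc z \<partial>lborel) = (\<integral>\<^sup>+z. g z * indicator unit_disc z \<partial>lborel)"
proof -
  define r where "r n = 1 - 1 / (real n + 2)" for n
  have r: "0 < r n" "r n < 1" for n by (auto simp: r_def field_simps)
  have mono: "incseq (\<lambda>n. ball (0::complex) (r n))"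
    by (intro monoI subset_ball) (auto simp: r_def intro!: frac_le)
  have un: "(\<Union>n. ball (0::complex) (r n)) = unit_disc"
  proof (intro equalityI subsetI)
    fix z :: complex assume "z \<in> unit_disc"
    then have "0 < 1 - cmod z" by (simp add: mem_unit_disc)
    then obtain n where "inverse (of_nat (Suc n)) < 1 - cmod z"
      using reals_Archimedean by blast
    moreover have "1 / (real n + 2) \<le> inverse (of_nat (Suc n))" by (simp add: field_simps)
    ultimately have "z \<in> ball 0 (r n)" by (simp add: r_def)
    then show "z \<in> (\<Union>n. ball 0 (r n))" by blast
  next
    fix z assume "z \<in> (\<Union>n. ball (0::complex) (r n))"
    then show "z \<in> unit_disc" using r(2) by (auto simp: mem_unit_disc dest: less_trans)
  qed
  have lim: "(\<integral>\<^sup>+z. h z * indicator unit_disc z \<partial>lborel)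
    = (SUP n. \<integral>\<^sup>+z. h z * indicator (ball 0 (r n)) z \<partial>lborel)"
    if [measurable]: "h \<in> borel_measurable borel" for h :: "complex \<Rightarrow> ennreal"
    using SUP_emeasure_incseq[of "\<lambda>n. ball (0::complex) (r n)" "density lborel h"] mono
    by (simp add: un emeasure_density image_subset_iff)
  show ?thesis unfolding lim[OF assms(1)] lim[OF assms(2)] using eq r by simp
qed

lemma borel_measurable_indicator_holomorphic:
  assumes "f holomorphic_on S" "open S"
  shows "(\<lambda>z. indicator S z *\<^sub>R f z) \<in> borel_measurable borel"
  using assms by (intro borel_measurable_continuous_on_indicator holomorphic_on_imp_continuous_on) auto

text \<open>The polynomial case passes to Taylor series by dominated convergence on each ball of
  radius \<open>r < 1\<close>: there the partial sums are bounded by \<open>B\<close> and the weight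
  by 1. Exhaustion by such balls then gives the disc.\<close>

theorem disc_Parseval:
  assumes f: "f holomorphic_on unit_disc" and wm [measurable]: "w \<in> borel_measurable borel"
    and w0: "\<And>s. 0 \<le> w s" and w1: "\<And>s. 0 \<le> s \<Longrightarrow> s < 1 \<Longrightarrow> w s \<le> 1"
  shows "dA_int unit_disc (\<lambda>z. (cmod (f z))\<^sup>2 * w ((cmod z)\<^sup>2))
       = (\<Sum>n. ennreal ((cmod (taylor_coeff f n))\<^sup>2)
            * (\<integral>\<^sup>+s. ennreal (s ^ n * w s) * indicator {0<..<1} s \<partial>lborel))"
proof -
  define b where "b = taylor_coeff f"
  define W where "W z = w ((cmod z)\<^sup>2) / pi" for z :: complex
  define F where "F z = indicator unit_disc z *\<^sub>R f z" for z
  define \<phi> where "\<phi> n z = ennreal ((cmod (b n))\<^sup>2 * ((cmod z)\<^sup>2) ^ n * W z)" for n z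
  define \<Phi> where "\<Phi> z = (\<Sum>n. \<phi> n z)" for z
  have W0: "0 \<le> W z" for z by (simp add: W_def w0)
  have W1: "W z \<le> 1" if "z \<in> unit_disc" for z
  proof -
    have "w ((cmod z)\<^sup>2) \<le> 1"
      by (rule w1) (use that in \<open>auto simp: mem_unit_disc abs_square_less_1\<close>)
    then show ?thesis using pi_gt3 by (simp add: W_def divide_le_eq)
  qed
  have [measurable]: "W \<in> borel_measurable borel" "F \<in> borel_measurable borel"
    unfolding W_def F_def using f by (simp_all add: borel_measurable_indicator_holomorphic)
  have [measurable]: "\<phi> n \<in> borel_measurable borel" for n unfolding \<phi>_def by measurable
  have [measurable]: "\<Phi> \<in> borel_measurable borel" unfolding \<Phi>_def by measurable
  have step: "(\<integral>\<^sup>+z. ennreal ((cmod (F z))\<^sup>2 * W z) * indicator (ball 0 r) z \<partial>lborel)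
     = (\<integral>\<^sup>+z. \<Phi> z * indicator (ball 0 r) z \<partial>lborel)" if r: "0 < r" "r < 1" for r
  proof -
    define B where "B = (\<Sum>n. cmod (b n) * r ^ n)"
    define u where "u N z = ennreal ((cmod (\<Sum>n<N. b n * z ^ n))\<^sup>2 * W z) * indicator (ball 0 r) z" for N z
    have [measurable]: "ball (0::complex) r \<in> sets borel" by simp
    have sm: "summable (\<lambda>n. cmod (b n) * r ^ n)"
      unfolding b_def using taylor_summable_norm[OF f] r by simp
    have sub: "ball 0 r \<subseteq> unit_disc" using r by (auto simp: mem_unit_disc)
    have bd: "cmod (\<Sum>n<N. b n * z ^ n) \<le> B" if "cmod z < r" for N z
    proof -
      have "cmod (\<Sum>n<N. b n * z ^ n) \<le> (\<Sum>n<N. cmod (b n) * r ^ n)"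
        using that by (intro sum_norm_le) (auto simp: norm_mult norm_power intro!: mult_left_mono power_mono)
      also have "\<dots> \<le> B" unfolding B_def using r by (intro sum_le_suminf sm) auto
      finally show ?thesis .
    qed
    have "(\<lambda>N. \<integral>\<^sup>+z. u N z \<partial>lborel) \<longlonglongrightarrow>
       (\<integral>\<^sup>+z. ennreal ((cmod (F z))\<^sup>2 * W z) * indicator (ball 0 r) z \<partial>lborel)"
    proof (rule nn_integral_dominated_convergence[where w = "\<lambda>z. ennreal (B\<^sup>2) * indicator (ball 0 r) z"])
      show "AE z in lborel. u j z \<le> ennreal (B\<^sup>2) * indicator (ball 0 r) z" for j
      proof (intro AE_I2)
        fix z
        show "u j z \<le> ennreal (B\<^sup>2) * indicator (ball 0 r) z"
        proof (cases "z \<in> ball 0 r")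
          case True
          have "(cmod (\<Sum>n<j. b n * z ^ n))\<^sup>2 * W z \<le> B\<^sup>2 * 1"
            using True sub bd[of z j] W1 W0 by (intro mult_mono power_mono) auto
          then show ?thesis using True by (simp add: u_def ennreal_leI)
        qed (simp add: u_def)
      qed
      show "(\<integral>\<^sup>+z. ennreal (B\<^sup>2) * indicator (ball (0::complex) r) z \<partial>lborel) < \<infinity>"
        using r by (simp add: nn_integral_cmult_indicator emeasure_lborel_disc ennreal_mult_less_top)
      show "AE z in lborel. (\<lambda>N. u N z) \<longlonglongrightarrow> ennreal ((cmod (F z))\<^sup>2 * W z) * indicator (ball 0 r) z"
      proof (intro AE_I2)
        fix z
        show "(\<lambda>N. u N z) \<longlonglongrightarrow> ennreal ((cmod (F z))\<^sup>2 * W z) * indicator (ball 0 r) z"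
        proof (cases "z \<in> ball 0 r")
          case True
          then have "(\<lambda>N. \<Sum>n<N. b n * z ^ n) \<longlonglongrightarrow> F z"
            using taylor_sums[OF f, of z] sub by (auto simp: sums_def F_def b_def)
          then show ?thesis using True by (auto simp: u_def intro!: tendsto_intros)
        qed (simp add: u_def)
      qed
    qed (simp_all add: u_def[abs_def])
    moreover have "(\<integral>\<^sup>+z. u N z \<partial>lborel) = (\<Sum>n<N. \<integral>\<^sup>+z. \<phi> n z * indicator (ball 0 r) z \<partial>lborel)" for N
    proof -
      \<comment> \<open>Truncating the weight turns the integral over the smaller ball into one over
        the disc with a weight that is still radial, to which the polynomial identity
        applies.\<close>
      define w' where "w' s = w s * indicator {..<r\<^sup>2} s" for s
      have ind: "indicator {..<r\<^sup>2} ((cmod z)\<^sup>2) = (indicator (ball 0 r) z :: real)" for z :: complex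
        using r power_mono_iff[of r "cmod z" 2] by (auto simp: indicator_def not_le[symmetric])
      have "(\<integral>\<^sup>+z. u N z \<partial>lborel) = dA_int unit_disc (\<lambda>z. (cmod (\<Sum>n<N. b n * z ^ n))\<^sup>2 * w' ((cmod z)\<^sup>2))"
        unfolding dA_int_def u_def w'_def ind using sub
        by (intro nn_integral_cong) (auto simp: W_def indicator_def)
      also have "\<dots> = dA_int unit_disc (\<lambda>z. (\<Sum>n<N. (cmod (b n))\<^sup>2 * ((cmod z)\<^sup>2) ^ n) * w' ((cmod z)\<^sup>2))"
        by (rule disc_Parseval_polynomial) (auto simp: w'_def w0)
      also have "\<dots> = (\<integral>\<^sup>+z. (\<Sum>n<N. \<phi> n z * indicator (ball 0 r) z) \<partial>lborel)"
        unfolding dA_int_def w'_def ind using sub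
        by (intro nn_integral_cong)
           (auto simp: W_def \<phi>_def indicator_def w0 sum_distrib_right sum_divide_distrib intro!: sum_ennreal[symmetric])
      also have "\<dots> = (\<Sum>n<N. \<integral>\<^sup>+z. \<phi> n z * indicator (ball 0 r) z \<partial>lborel)"
        by (intro nn_integral_sum) auto
      finally show ?thesis .
    qed
    moreover have "(\<lambda>N. \<Sum>n<N. \<integral>\<^sup>+z. \<phi> n z * indicator (ball 0 r) z \<partial>lborel)
        \<longlonglongrightarrow> (\<Sum>n. \<integral>\<^sup>+z. \<phi> n z * indicator (ball 0 r) z \<partial>lborel)"
      by (intro summable_LIMSEQ summableI)
    moreover have "(\<Sum>n. \<integral>\<^sup>+z. \<phi> n z * indicator (ball 0 r) z \<partial>lborel) = (\<integral>\<^sup>+z. \<Phi> z * indicator (ball 0 r) z \<partial>lborel)"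
      by (subst nn_integral_suminf[symmetric]) (auto simp: \<Phi>_def)
    ultimately show ?thesis using LIMSEQ_unique by auto
  qed
  have "dA_int unit_disc (\<lambda>z. (cmod (f z))\<^sup>2 * w ((cmod z)\<^sup>2))
    = (\<integral>\<^sup>+z. ennreal ((cmod (F z))\<^sup>2 * W z) * indicator unit_disc z \<partial>lborel)"
    unfolding dA_int_def by (intro nn_integral_cong) (auto simp: F_def W_def indicator_def)
  also have "\<dots> = (\<integral>\<^sup>+z. \<Phi> z * indicator unit_disc z \<partial>lborel)"
    by (rule nn_integral_ball_exhaustion) (use step in auto)
  also have "\<dots> = (\<Sum>n. \<integral>\<^sup>+z. \<phi> n z * indicator unit_disc z \<partial>lborel)"
    by (subst nn_integral_suminf[symmetric]) (auto simp: \<Phi>_def)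
  also have "\<dots> = (\<Sum>n. ennreal ((cmod (b n))\<^sup>2) * (\<integral>\<^sup>+s. ennreal (s ^ n * w s) * indicator {0<..<1} s \<partial>lborel))"
  proof (intro suminf_cong)
    fix n
    have "(\<integral>\<^sup>+z. \<phi> n z * indicator unit_disc z \<partial>lborel)
        = dA_int unit_disc (\<lambda>z. (cmod (b n))\<^sup>2 * (((cmod z)\<^sup>2) ^ n * w ((cmod z)\<^sup>2)))"
      unfolding dA_int_def \<phi>_def W_def by (simp add: mult.assoc)
    also have "\<dots> = ennreal ((cmod (b n))\<^sup>2) * dA_int unit_disc (\<lambda>z. ((cmod z)\<^sup>2) ^ n * w ((cmod z)\<^sup>2))"
      by (rule dA_int_cmult) auto
    also have "dA_int unit_disc (\<lambda>z. ((cmod z)\<^sup>2) ^ n * w ((cmod z)\<^sup>2))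
        = (\<integral>\<^sup>+s. ennreal (s ^ n * w s) * indicator {0<..<1} s \<partial>lborel)"
      using dA_int_radial[of "\<lambda>s. s ^ n * w s" 1] by (simp add: unit_disc_def)
    finally show "(\<integral>\<^sup>+z. \<phi> n z * indicator unit_disc z \<partial>lborel)
      = ennreal ((cmod (b n))\<^sup>2) * (\<integral>\<^sup>+s. ennreal (s ^ n * w s) * indicator {0<..<1} s \<partial>lborel)" .
  qed
  finally show ?thesis by (simp add: b_def)
qed

section \<open>Moebius-invariant Dirichlet energy\<close>

definition moebius :: "complex \<Rightarrow> complex \<Rightarrow> complex" where
  "moebius a z = (a - z) / (1 - cnj a * z)"

text \<open>The product form of \<open>1 - |moebius a z|^2\<close>: it separates the Carleson weight
  \<open>1 - |z|^2\<close> from a kernel of Poisson type, which is large only for \<open>z\<close>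
  near \<open>a / |a|\<close>.\<close>

definition moebius_weight :: "complex \<Rightarrow> complex \<Rightarrow> real" where
  "moebius_weight a z = (1 - (cmod a)\<^sup>2) * (1 - (cmod z)\<^sup>2) / (cmod (1 - cnj a * z))\<^sup>2"

definition energy :: "complex \<Rightarrow> (complex \<Rightarrow> complex) \<Rightarrow> ennreal" where
  "energy a f = dA_int unit_disc (\<lambda>z. (cmod (deriv f z))\<^sup>2 * moebius_weight a z)"

lemma one_minus_cnj_mult_nonzero:
  assumes "a \<in> unit_disc" "z \<in> unit_disc"
  shows "1 - cnj a * z \<noteq> 0"
proof
  assume "1 - cnj a * z = 0"
  then have "cmod (cnj a * z) = 1" by simp
  moreover have "cmod (cnj a * z) < 1"
    using assms mult_strict_mono'[of "cmod a" 1 "cmod z" 1] by (simp add: norm_mult mem_unit_disc)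
  ultimately show False by simp
qed

lemma one_minus_norm_moebius:
  assumes "a \<in> unit_disc" "z \<in> unit_disc"
  shows "1 - (cmod (moebius a z))\<^sup>2 = moebius_weight a z"
proof -
  have nz: "cmod (1 - cnj a * z) \<noteq> 0" using one_minus_cnj_mult_nonzero[OF assms] by simp
  have "(cmod (1 - cnj a * z))\<^sup>2 - (cmod (a - z))\<^sup>2 = (1 - (cmod a)\<^sup>2) * (1 - (cmod z)\<^sup>2)"
    unfolding cmod_power2 by (simp add: power2_eq_square algebra_simps)
  then show ?thesis
    using nz by (simp add: moebius_def moebius_weight_def norm_divide power_divide field_simps)
qed

lemma moebius_weight_pos:
  assumes "a \<in> unit_disc" "z \<in> unit_disc"
  shows "0 < moebius_weight a z"
  using one_minus_cnj_mult_nonzero[OF assms] assms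
  by (auto simp: moebius_weight_def mem_unit_disc abs_square_less_1 intro!: divide_pos_pos mult_pos_pos)

lemma moebius_in_unit_disc:
  assumes "a \<in> unit_disc" "z \<in> unit_disc"
  shows "moebius a z \<in> unit_disc"
proof -
  have "(cmod (moebius a z))\<^sup>2 < 1"
    using one_minus_norm_moebius[OF assms] moebius_weight_pos[OF assms] by linarith
  then show ?thesis by (simp add: mem_unit_disc abs_square_less_1)
qed

lemma moebius_sub_cancel:
  assumes "a \<in> unit_disc" "z \<in> unit_disc"
  shows "1 - cnj a * moebius a z = (1 - (cmod a)\<^sup>2) / (1 - cnj a * z)"
proof -
  have "1 - cnj a * moebius a z = (1 - a * cnj a) / (1 - cnj a * z)"
    using one_minus_cnj_mult_nonzero[OF assms] by (simp add: moebius_def field_simps)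
  then show ?thesis by (simp add: complex_norm_square del: of_real_power)
qed

lemma one_minus_norm_power2_pos: "a \<in> unit_disc \<Longrightarrow> 0 < 1 - (cmod a)\<^sup>2"
  by (simp add: mem_unit_disc abs_square_less_1)

lemma moebius_moebius:
  assumes "a \<in> unit_disc" "z \<in> unit_disc"
  shows "moebius a (moebius a z) = z"
proof -
  have nz: "1 - cnj a * z \<noteq> 0" by (rule one_minus_cnj_mult_nonzero[OF assms])
  have na: "complex_of_real (1 - (cmod a)\<^sup>2) \<noteq> 0"
    using one_minus_norm_power2_pos[OF assms(1)] by (metis less_irrefl of_real_eq_0_iff)
  have "a - moebius a z = z * (1 - a * cnj a) / (1 - cnj a * z)"
    using nz by (simp add: moebius_def field_simps)
  also have "1 - a * cnj a = complex_of_real (1 - (cmod a)\<^sup>2)"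
    by (simp add: complex_norm_square del: of_real_power)
  finally have "moebius a (moebius a z) = (z * complex_of_real (1 - (cmod a)\<^sup>2) / (1 - cnj a * z)) /
      (complex_of_real (1 - (cmod a)\<^sup>2) / (1 - cnj a * z))"
    using moebius_sub_cancel[OF assms] unfolding moebius_def[of a "moebius a z"] by simp
  then show ?thesis using nz na by (simp del: of_real_diff of_real_power)
qed

lemma moebius_image: "a \<in> unit_disc \<Longrightarrow> moebius a ` unit_disc = unit_disc"
proof (intro equalityI subsetI)
  fix z assume "a \<in> unit_disc" "z \<in> unit_disc"
  then have "z = moebius a (moebius a z)" "moebius a z \<in> unit_disc"
    by (simp_all add: moebius_moebius moebius_in_unit_disc)
  then show "z \<in> moebius a ` unit_disc" by blast
qed (auto simp: moebius_in_unit_disc)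

lemma inj_on_moebius: "a \<in> unit_disc \<Longrightarrow> inj_on (moebius a) unit_disc"
  by (metis inj_on_inverseI moebius_moebius)

lemma holomorphic_moebius: "a \<in> unit_disc \<Longrightarrow> moebius a holomorphic_on unit_disc"
  unfolding moebius_def[abs_def] by (intro holomorphic_intros) (auto dest: one_minus_cnj_mult_nonzero)

lemma deriv_moebius:
  assumes "a \<in> unit_disc" "z \<in> unit_disc"
  shows "deriv (moebius a) z = - (1 - (cmod a)\<^sup>2) / (1 - cnj a * z)\<^sup>2"
proof -
  have nz: "1 - cnj a * z \<noteq> 0" by (rule one_minus_cnj_mult_nonzero[OF assms])
  have "(moebius a has_field_derivative ((0 - 1) * (1 - cnj a * z) - (a - z) * (0 - cnj a * 1)) / ((1 - cnj a * z) * (1 - cnj a * z))) (at z)"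
    unfolding moebius_def[abs_def]
    by (intro DERIV_divide DERIV_diff DERIV_cmult DERIV_const DERIV_ident nz)
  then have "deriv (moebius a) z = ((0 - 1) * (1 - cnj a * z) - (a - z) * (0 - cnj a * 1)) / ((1 - cnj a * z) * (1 - cnj a * z))"
    by (rule DERIV_imp_deriv)
  also have "\<dots> = - (1 - a * cnj a) / (1 - cnj a * z)\<^sup>2"
    by (simp add: power2_eq_square algebra_simps)
  finally show ?thesis by (simp add: complex_norm_square del: of_real_power)
qed

lemma continuous_on_moebius_weight: "a \<in> unit_disc \<Longrightarrow> continuous_on unit_disc (moebius_weight a)"
  unfolding moebius_weight_def[abs_def]
  by (intro continuous_intros) (auto dest: one_minus_cnj_mult_nonzero)

lemma continuous_on_deriv_unit_disc: "f holomorphic_on unit_disc \<Longrightarrow> continuous_on unit_disc (deriv f)"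
  by (intro holomorphic_on_imp_continuous_on holomorphic_deriv) auto

lemma holomorphic_comp_moebius:
  assumes "a \<in> unit_disc" "f holomorphic_on unit_disc"
  shows "(f \<circ> moebius a) holomorphic_on unit_disc"
  using assms by (intro holomorphic_on_compose_gen[OF holomorphic_moebius]) (auto simp: moebius_in_unit_disc)

lemma deriv_comp_moebius:
  assumes "a \<in> unit_disc" "z \<in> unit_disc" "f holomorphic_on unit_disc"
  shows "deriv (f \<circ> moebius a) z = deriv f (moebius a z) * deriv (moebius a) z"
  using assms by (intro deriv_chain holomorphic_on_imp_differentiable_at[OF _ open_unit_disc])
    (auto simp: holomorphic_moebius moebius_in_unit_disc)

lemma zero_in_unit_disc [simp]: "0 \<in> unit_disc"
  by (simp add: mem_unit_disc)

lemma energy_zero: "energy 0 f = dA_int unit_disc (\<lambda>z. (cmod (deriv f z))\<^sup>2 * (1 - (cmod z)\<^sup>2))"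
  by (simp add: energy_def moebius_weight_def)

text \<open>Since \<open>moebius a\<close> is an involution, its weight pulls back to
  \<open>1 - |z|^2\<close>, while the Jacobian \<open>|deriv (moebius a) z|^2\<close> is exactly
  what the chain rule produces. Every energy thus becomes one centred at 0, where Taylor
  coefficients are available.\<close>

lemma energy_comp_moebius:
  assumes a: "a \<in> unit_disc" and f: "f holomorphic_on unit_disc"
  shows "energy 0 (f \<circ> moebius a) = energy a f"
proof -
  have "energy a f = dA_int unit_disc (\<lambda>z. (cmod (deriv (moebius a) z))\<^sup>2 *
      ((cmod (deriv f (moebius a z)))\<^sup>2 * moebius_weight a (moebius a z)))"
    unfolding energy_def
  proof (rule dA_int_substitution[OF open_unit_disc holomorphic_moebius inj_on_moebius moebius_image])
    show "continuous_on unit_disc (\<lambda>z. (cmod (deriv f z))\<^sup>2 * moebius_weight a z)"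
      using a f by (intro continuous_intros continuous_on_moebius_weight continuous_on_deriv_unit_disc)
    show "0 \<le> (cmod (deriv f z))\<^sup>2 * moebius_weight a z" if "z \<in> unit_disc" for z
      using moebius_weight_pos[OF a that] by simp
  qed (use a in auto)
  also have "\<dots> = energy 0 (f \<circ> moebius a)"
    unfolding energy_zero
  proof (rule dA_int_cong)
    fix z assume z: "z \<in> unit_disc"
    have "moebius_weight a (moebius a z) = 1 - (cmod z)\<^sup>2"
      using one_minus_norm_moebius[OF a moebius_in_unit_disc[OF a z]] by (simp add: moebius_moebius a z)
    then show "(cmod (deriv (moebius a) z))\<^sup>2 * ((cmod (deriv f (moebius a z)))\<^sup>2 * moebius_weight a (moebius a z))
        = (cmod (deriv (f \<circ> moebius a) z))\<^sup>2 * (1 - (cmod z)\<^sup>2)"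
      by (simp add: deriv_comp_moebius[OF a z f] norm_mult power_mult_distrib)
  qed
  finally show ?thesis by simp
qed

section \<open>Energies in terms of Taylor coefficients\<close>

lemma taylor_coeff_deriv: "taylor_coeff (deriv f) n = of_nat (Suc n) * taylor_coeff f (Suc n)"
  by (simp add: taylor_coeff_def funpow_Suc_right del: of_nat_Suc funpow.simps)

text \<open>A formula of Littlewood-Paley type: differentiation contributes \<open>(n+1)^2\<close>
  and the weight \<open>1 / ((n+1) * (n+2))\<close>. The quotient lies between 1/2 and 1, so the
  energy is comparable to the squared Hardy norm of \<open>f - f 0\<close>.\<close>

lemma energy_zero_eq_suminf:
  assumes f: "f holomorphic_on unit_disc"
  shows "energy 0 f = (\<Sum>n. ennreal ((cmod (taylor_coeff f (Suc n)))\<^sup>2 * ((real n + 1) / (real n + 2))))"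
proof -
  have f': "deriv f holomorphic_on unit_disc" using f by (intro holomorphic_deriv) auto
  \<comment> \<open>The Parseval formula takes a weight that is nonnegative on the whole line; the
    cut at 0 changes nothing inside the disc.\<close>
  have "energy 0 f = dA_int unit_disc (\<lambda>z. (cmod (deriv f z))\<^sup>2 * max 0 (1 - (cmod z)\<^sup>2))"
    unfolding energy_zero by (intro dA_int_cong) (auto dest: one_minus_norm_power2_pos)
  also have "\<dots> = (\<Sum>n. ennreal ((cmod (taylor_coeff (deriv f) n))\<^sup>2)
            * (\<integral>\<^sup>+s. ennreal (s ^ n * max 0 (1 - s)) * indicator {0<..<1} s \<partial>lborel))"
    by (rule disc_Parseval[OF f', where w = "\<lambda>s. max 0 (1 - s)"]) auto
  also have "\<dots> = (\<Sum>n. ennreal ((cmod (taylor_coeff f (Suc n)))\<^sup>2 * ((real n + 1) / (real n + 2))))"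
  proof (intro suminf_cong)
    fix n
    have "(\<integral>\<^sup>+s. ennreal (s ^ n * max 0 (1 - s)) * indicator {0<..<1::real} s \<partial>lborel)
        = (\<integral>\<^sup>+s. ennreal (s ^ n * (1 - s)) * indicator {0<..<1::real} s \<partial>lborel)"
      by (intro nn_integral_cong) (auto simp: indicator_def max_def)
    also have "\<dots> = ennreal (1 / ((real n + 1) * (real n + 2)))"
      by (rule nn_integral_power_one_minus_Ioo)
    finally have eq: "(\<integral>\<^sup>+s. ennreal (s ^ n * max 0 (1 - s)) * indicator {0<..<1::real} s \<partial>lborel)
        = ennreal (1 / ((real n + 1) * (real n + 2)))" .
    have "ennreal ((cmod (taylor_coeff (deriv f) n))\<^sup>2)
            * (\<integral>\<^sup>+s. ennreal (s ^ n * max 0 (1 - s)) * indicator {0<..<1} s \<partial>lborel)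
        = ennreal ((cmod (taylor_coeff (deriv f) n))\<^sup>2 * (1 / ((real n + 1) * (real n + 2))))"
      unfolding eq by (rule ennreal_mult''[symmetric]) simp
    also have "(cmod (taylor_coeff (deriv f) n))\<^sup>2 * (1 / ((real n + 1) * (real n + 2)))
      = (cmod (taylor_coeff f (Suc n)))\<^sup>2 * ((real n + 1) / (real n + 2))"
      by (simp add: taylor_coeff_deriv norm_mult power_mult_distrib power2_eq_square divide_simps del: of_nat_Suc)
        (simp add: algebra_simps)
    finally show "ennreal ((cmod (taylor_coeff (deriv f) n))\<^sup>2)
            * (\<integral>\<^sup>+s. ennreal (s ^ n * max 0 (1 - s)) * indicator {0<..<1} s \<partial>lborel)
        = ennreal ((cmod (taylor_coeff f (Suc n)))\<^sup>2 * ((real n + 1) / (real n + 2)))" .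
  qed
  finally show ?thesis .
qed

lemma disc_moment_eq_suminf:
  assumes f: "f holomorphic_on unit_disc"
  shows "dA_int unit_disc (\<lambda>z. (cmod (f z))\<^sup>2 * ((cmod z)\<^sup>2) ^ k)
       = (\<Sum>n. ennreal ((cmod (taylor_coeff f n))\<^sup>2 * (1 / (real n + real k + 1))))"
proof -
  have "dA_int unit_disc (\<lambda>z. (cmod (f z))\<^sup>2 * ((cmod z)\<^sup>2) ^ k)
     = dA_int unit_disc (\<lambda>z. (cmod (f z))\<^sup>2 * \<bar>(cmod z)\<^sup>2\<bar> ^ k)"
    by simp
  also have "\<dots> = (\<Sum>n. ennreal ((cmod (taylor_coeff f n))\<^sup>2)
            * (\<integral>\<^sup>+s. ennreal (s ^ n * \<bar>s\<bar> ^ k) * indicator {0<..<1} s \<partial>lborel))"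
    by (rule disc_Parseval[OF f, where w = "\<lambda>s. \<bar>s\<bar> ^ k"]) (auto simp: power_le_one)
  also have "\<dots> = (\<Sum>n. ennreal ((cmod (taylor_coeff f n))\<^sup>2 * (1 / (real n + real k + 1))))"
  proof (intro suminf_cong)
    fix n
    have "(\<integral>\<^sup>+s. ennreal (s ^ n * \<bar>s\<bar> ^ k) * indicator {0<..<1::real} s \<partial>lborel)
      = (\<integral>\<^sup>+s. ennreal (s ^ (n + k)) * indicator {0<..<1::real} s \<partial>lborel)"
      by (intro nn_integral_cong) (auto simp: indicator_def power_add)
    also have "\<dots> = ennreal (1 / (real n + real k + 1))"
      by (simp add: nn_integral_power_Ioo)
    finally have eq: "(\<integral>\<^sup>+s. ennreal (s ^ n * \<bar>s\<bar> ^ k) * indicator {0<..<1::real} s \<partial>lborel)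
      = ennreal (1 / (real n + real k + 1))" .
    show "ennreal ((cmod (taylor_coeff f n))\<^sup>2)
            * (\<integral>\<^sup>+s. ennreal (s ^ n * \<bar>s\<bar> ^ k) * indicator {0<..<1} s \<partial>lborel)
        = ennreal ((cmod (taylor_coeff f n))\<^sup>2 * (1 / (real n + real k + 1)))"
      unfolding eq by (rule ennreal_mult''[symmetric]) simp
  qed
  finally show ?thesis .
qed

text \<open>The moments against \<open>(k + 1) |z|\<^bsup>2k\<^esup>\<close> increase to the square of the Hardy space norm, and multiplication
  by a bounded function acts pointwise on each of them.\<close>
lemma taylor_norm_mult_bounded:
  assumes f: "f holomorphic_on unit_disc" and g: "g holomorphic_on unit_disc"
    and M: "\<And>z. z \<in> unit_disc \<Longrightarrow> cmod (g z) \<le> M"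
  shows "(\<Sum>n. ennreal ((cmod (taylor_coeff (\<lambda>z. f z * g z) n))\<^sup>2))
       \<le> ennreal (M\<^sup>2) * (\<Sum>n. ennreal ((cmod (taylor_coeff f n))\<^sup>2))"
proof -
  define c where "c = taylor_coeff (\<lambda>z. f z * g z)"
  define b where "b = taylor_coeff f"
  define R where "R = ennreal (M\<^sup>2) * (\<Sum>n. ennreal ((cmod (b n))\<^sup>2))"
  have fg: "(\<lambda>z. f z * g z) holomorphic_on unit_disc" using f g by (intro holomorphic_intros)
  have M0: "0 \<le> M" using M[of 0] by (meson norm_ge_zero order_trans zero_in_unit_disc)
  have part: "ennreal (\<Sum>n<N. (cmod (c n))\<^sup>2 * ((real k + 1) / (real n + real k + 1))) \<le> R" for N k
  proof -
    have "ennreal (\<Sum>n<N. (cmod (c n))\<^sup>2 * (1 / (real n + real k + 1)))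
        = (\<Sum>n<N. ennreal ((cmod (c n))\<^sup>2 * (1 / (real n + real k + 1))))"
      by (intro sum_ennreal[symmetric]) auto
    also have "\<dots> \<le> (\<Sum>n. ennreal ((cmod (c n))\<^sup>2 * (1 / (real n + real k + 1))))"
      by (intro sum_le_suminf) auto
    also have "\<dots> = dA_int unit_disc (\<lambda>z. (cmod (f z * g z))\<^sup>2 * ((cmod z)\<^sup>2) ^ k)"
      unfolding c_def by (rule disc_moment_eq_suminf[OF fg, symmetric])
    also have "\<dots> \<le> dA_int unit_disc (\<lambda>z. (cmod (M * f z))\<^sup>2 * ((cmod z)\<^sup>2) ^ k)"
      using M M0 by (intro dA_int_mono) (auto simp: norm_mult mult.commute[of M] intro!: mult_right_mono power_mono mult_left_mono)
    also have "\<dots> = (\<Sum>n. ennreal ((cmod (taylor_coeff (\<lambda>z. M * f z) n))\<^sup>2 * (1 / (real n + real k + 1))))"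
      using f by (intro disc_moment_eq_suminf holomorphic_intros)
    also have "\<dots> = (\<Sum>n. ennreal (M\<^sup>2 * (cmod (b n))\<^sup>2 * (1 / (real n + real k + 1))))"
    proof -
      have "taylor_coeff (\<lambda>z. M * f z) n = M * b n" for n
        unfolding taylor_coeff_def b_def using f
        by (subst higher_deriv_cmult[where A = unit_disc]) auto
      then show ?thesis by (simp add: norm_mult power_mult_distrib)
    qed
    also have "\<dots> \<le> (\<Sum>n. ennreal (M\<^sup>2 / (real k + 1)) * ennreal ((cmod (b n))\<^sup>2))"
    proof (intro suminf_le summableI)
      fix n
      have "M\<^sup>2 * (cmod (b n))\<^sup>2 * (1 / (real n + real k + 1)) \<le> M\<^sup>2 * (cmod (b n))\<^sup>2 * (1 / (real k + 1))"
        by (intro mult_left_mono frac_le) auto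
      also have "\<dots> = (M\<^sup>2 / (real k + 1)) * (cmod (b n))\<^sup>2" by simp
      finally show "ennreal (M\<^sup>2 * (cmod (b n))\<^sup>2 * (1 / (real n + real k + 1)))
          \<le> ennreal (M\<^sup>2 / (real k + 1)) * ennreal ((cmod (b n))\<^sup>2)"
        by (subst ennreal_mult''[symmetric]) (auto intro: ennreal_leI)
    qed
    also have "\<dots> = ennreal (M\<^sup>2 / (real k + 1)) * (\<Sum>n. ennreal ((cmod (b n))\<^sup>2))" by simp
    finally have "ennreal (real k + 1) * ennreal (\<Sum>n<N. (cmod (c n))\<^sup>2 * (1 / (real n + real k + 1)))
       \<le> ennreal (real k + 1) * (ennreal (M\<^sup>2 / (real k + 1)) * (\<Sum>n. ennreal ((cmod (b n))\<^sup>2)))"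
      by (rule mult_left_mono) simp
    also have "ennreal (real k + 1) * (ennreal (M\<^sup>2 / (real k + 1)) * (\<Sum>n. ennreal ((cmod (b n))\<^sup>2))) = R"
      unfolding R_def mult.assoc[symmetric] by (subst ennreal_mult''[symmetric]) simp_all
    also have "ennreal (real k + 1) * ennreal (\<Sum>n<N. (cmod (c n))\<^sup>2 * (1 / (real n + real k + 1)))
        = ennreal ((real k + 1) * (\<Sum>n<N. (cmod (c n))\<^sup>2 * (1 / (real n + real k + 1))))"
      by (rule ennreal_mult''[symmetric]) (auto intro!: sum_nonneg)
    also have "(real k + 1) * (\<Sum>n<N. (cmod (c n))\<^sup>2 * (1 / (real n + real k + 1)))
        = (\<Sum>n<N. (cmod (c n))\<^sup>2 * ((real k + 1) / (real n + real k + 1)))"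
      by (simp add: sum_distrib_left mult.commute)
    finally show ?thesis .
  qed
  \<comment> \<open>Only finitely many coefficients are kept, so the limit in \<open>k\<close> can
    be taken term by term; the bound \<open>R\<close> depends neither on \<open>k\<close> nor on
    \<open>N\<close>.\<close>
  have fin: "ennreal (\<Sum>n<N. (cmod (c n))\<^sup>2) \<le> R" for N
  proof (rule LIMSEQ_le_const2)
    have "(\<lambda>k. (real k + 1) / (real n + real k + 1)) \<longlonglongrightarrow> 1" for n :: nat
      by real_asymp
    then have "(\<lambda>k. \<Sum>n<N. (cmod (c n))\<^sup>2 * ((real k + 1) / (real n + real k + 1))) \<longlonglongrightarrow> (\<Sum>n<N. (cmod (c n))\<^sup>2 * 1)"
      by (intro tendsto_intros)
    then show "(\<lambda>k. ennreal (\<Sum>n<N. (cmod (c n))\<^sup>2 * ((real k + 1) / (real n + real k + 1)))) \<longlonglongrightarrow> ennreal (\<Sum>n<N. (cmod (c n))\<^sup>2)"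
      by (intro tendsto_ennrealI) simp
  qed (use part in auto)
  show ?thesis
    unfolding c_def[symmetric] b_def[symmetric] R_def[symmetric]
    by (intro suminf_le_const summableI) (use fin in \<open>simp add: sum_ennreal\<close>)
qed

text \<open>Passing from energy to Hardy norm and back costs a factor 2, from
  \<open>1/2 \<le> (n+1)/(n+2) \<le> 1\<close>. The Hardy norm sees the constant term and the energy
  does not; the condition \<open>f 0 = 0\<close> reconciles them.\<close>

lemma energy_zero_mult_bounded:
  assumes f: "f holomorphic_on unit_disc" and g: "g holomorphic_on unit_disc"
    and M: "\<And>z. z \<in> unit_disc \<Longrightarrow> cmod (g z) \<le> M" and f0: "f 0 = 0"
  shows "energy 0 (\<lambda>z. f z * g z) \<le> ennreal (2 * M\<^sup>2) * energy 0 f"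
proof -
  define c where "c = taylor_coeff (\<lambda>z. f z * g z)"
  define b where "b = taylor_coeff f"
  have fg: "(\<lambda>z. f z * g z) holomorphic_on unit_disc" using f g by (intro holomorphic_intros)
  have b0: "b 0 = 0" by (simp add: b_def taylor_coeff_def f0)
  have shift: "(\<Sum>n. u n) = (\<Sum>n. u (Suc n)) + u 0" for u :: "nat \<Rightarrow> ennreal"
    using suminf_offset[of u 1] by simp
  have "energy 0 (\<lambda>z. f z * g z) = (\<Sum>n. ennreal ((cmod (c (Suc n)))\<^sup>2 * ((real n + 1) / (real n + 2))))"
    unfolding c_def by (rule energy_zero_eq_suminf[OF fg])
  also have "\<dots> \<le> (\<Sum>n. ennreal ((cmod (c (Suc n)))\<^sup>2))"
    by (intro suminf_le summableI ennreal_leI mult_left_le) (auto simp: divide_simps)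
  also have "\<dots> \<le> (\<Sum>n. ennreal ((cmod (c n))\<^sup>2))"
    unfolding shift[of "\<lambda>n. ennreal ((cmod (c n))\<^sup>2)"] by simp
  also have "\<dots> \<le> ennreal (M\<^sup>2) * (\<Sum>n. ennreal ((cmod (b n))\<^sup>2))"
    unfolding c_def b_def by (rule taylor_norm_mult_bounded[OF f g M])
  also have "(\<Sum>n. ennreal ((cmod (b n))\<^sup>2)) = (\<Sum>n. ennreal ((cmod (b (Suc n)))\<^sup>2))"
    unfolding shift[of "\<lambda>n. ennreal ((cmod (b n))\<^sup>2)"] by (simp add: b0)
  also have "\<dots> \<le> (\<Sum>n. 2 * ennreal ((cmod (b (Suc n)))\<^sup>2 * ((real n + 1) / (real n + 2))))"
  proof (intro suminf_le summableI)
    fix n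
    have "(cmod (b (Suc n)))\<^sup>2 * 1 \<le> (cmod (b (Suc n)))\<^sup>2 * (2 * ((real n + 1) / (real n + 2)))"
      by (intro mult_left_mono) (auto simp: divide_simps)
    then have "ennreal ((cmod (b (Suc n)))\<^sup>2) \<le> ennreal (2 * ((cmod (b (Suc n)))\<^sup>2 * ((real n + 1) / (real n + 2))))"
      by (intro ennreal_leI) (simp only: mult_1_right mult.left_commute)
    then show "ennreal ((cmod (b (Suc n)))\<^sup>2) \<le> 2 * ennreal ((cmod (b (Suc n)))\<^sup>2 * ((real n + 1) / (real n + 2)))"
      by (subst (asm) ennreal_mult') simp_all
  qed
  also have "\<dots> = 2 * energy 0 f"
    unfolding energy_zero_eq_suminf[OF f] b_def by simp
  also have "ennreal (M\<^sup>2) * (2 * energy 0 f) = ennreal (2 * M\<^sup>2) * energy 0 f"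
    by (simp add: ennreal_mult' mult_ac)
  finally show ?thesis by (simp add: mult_left_mono)
qed

section \<open>Energies of sums and products\<close>

lemma dA_int_add:
  assumes S: "S \<in> sets borel" and u: "(\<lambda>z. indicator S z * u z) \<in> borel_measurable borel" 
    and v: "(\<lambda>z. indicator S z * v z) \<in> borel_measurable borel"
    and nn: "\<And>z. z \<in> S \<Longrightarrow> 0 \<le> u z" "\<And>z. z \<in> S \<Longrightarrow> 0 \<le> v z"
  shows "dA_int S (\<lambda>z. u z + v z) = dA_int S u + dA_int S v"
proof -
  have "dA_int S (\<lambda>z. u z + v z)
     = (\<integral>\<^sup>+z. ennreal (indicator S z * u z / pi) + ennreal (indicator S z * v z / pi) \<partial>lborel)"
    unfolding dA_int_def
    by (intro nn_integral_cong) (auto simp: indicator_def nn add_divide_distrib simp flip: ennreal_plus)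
  also have "\<dots> = (\<integral>\<^sup>+z. ennreal (indicator S z * u z / pi) \<partial>lborel) + (\<integral>\<^sup>+z. ennreal (indicator S z * v z / pi) \<partial>lborel)"
    using u v by (intro nn_integral_add) auto
  also have "(\<integral>\<^sup>+z. ennreal (indicator S z * u z / pi) \<partial>lborel) = dA_int S u"
    unfolding dA_int_def by (intro nn_integral_cong) (auto simp: indicator_def)
  also have "(\<integral>\<^sup>+z. ennreal (indicator S z * v z / pi) \<partial>lborel) = dA_int S v"
    unfolding dA_int_def by (intro nn_integral_cong) (auto simp: indicator_def)
  finally show ?thesis .
qed

lemma dA_int_cmult_indicator:
  assumes S: "S \<in> sets borel" and u: "(\<lambda>z. indicator S z * u z) \<in> borel_measurable borel" and c: "0 \<le> c"
  shows "dA_int S (\<lambda>z. c * u z) = ennreal c * dA_int S u"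
proof -
  have "dA_int S (\<lambda>z. c * u z) = dA_int S (\<lambda>z. c * (indicator S z * u z))"
    by (intro dA_int_cong) auto
  also have "\<dots> = ennreal c * dA_int S (\<lambda>z. indicator S z * u z)"
    by (rule dA_int_cmult[OF u S c])
  also have "dA_int S (\<lambda>z. indicator S z * u z) = dA_int S u"
    by (intro dA_int_cong) auto
  finally show ?thesis .
qed

lemma energy_integrand_measurable:
  assumes "a \<in> unit_disc" "f holomorphic_on unit_disc"
  shows "(\<lambda>z. indicator unit_disc z * ((cmod (deriv f z))\<^sup>2 * moebius_weight a z)) \<in> borel_measurable borel"
proof -
  have "(\<lambda>z. indicator unit_disc z *\<^sub>R ((cmod (deriv f z))\<^sup>2 * moebius_weight a z)) \<in> borel_measurable borel"
    using assms
    by (intro borel_measurable_continuous_on_indicator continuous_intros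
        continuous_on_moebius_weight continuous_on_deriv_unit_disc) auto
  then show ?thesis by simp
qed

lemma energy_add_le:
  assumes a: "a \<in> unit_disc" and u: "u holomorphic_on unit_disc" and v: "v holomorphic_on unit_disc"
  shows "energy a (\<lambda>z. u z + v z) \<le> 2 * energy a u + 2 * energy a v"
proof -
  have "energy a (\<lambda>z. u z + v z) \<le> dA_int unit_disc (\<lambda>z. 2 * ((cmod (deriv u z))\<^sup>2 * moebius_weight a z)
      + 2 * ((cmod (deriv v z))\<^sup>2 * moebius_weight a z))"
    unfolding energy_def
  proof (rule dA_int_mono)
    fix z assume z: "z \<in> unit_disc"
    have "deriv (\<lambda>z. u z + v z) z = deriv u z + deriv v z"
      using u v z by (intro deriv_add holomorphic_on_imp_differentiable_at[OF _ open_unit_disc])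
    moreover have "(cmod (deriv u z + deriv v z))\<^sup>2 \<le> 2 * (cmod (deriv u z))\<^sup>2 + 2 * (cmod (deriv v z))\<^sup>2"
    proof -
      have "(cmod (deriv u z + deriv v z))\<^sup>2 \<le> (cmod (deriv u z) + cmod (deriv v z))\<^sup>2"
        by (intro power_mono norm_triangle_ineq) auto
      also have "\<dots> \<le> 2 * (cmod (deriv u z))\<^sup>2 + 2 * (cmod (deriv v z))\<^sup>2"
        using zero_le_power2[of "cmod (deriv u z) - cmod (deriv v z)"] by (simp add: power2_eq_square algebra_simps)
      finally show ?thesis .
    qed
    ultimately have "(cmod (deriv (\<lambda>z. u z + v z) z))\<^sup>2 * moebius_weight a z
        \<le> (2 * (cmod (deriv u z))\<^sup>2 + 2 * (cmod (deriv v z))\<^sup>2) * moebius_weight a z"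
      using moebius_weight_pos[OF a z] by (intro mult_right_mono) auto
    then show "(cmod (deriv (\<lambda>z. u z + v z) z))\<^sup>2 * moebius_weight a z
        \<le> 2 * ((cmod (deriv u z))\<^sup>2 * moebius_weight a z) + 2 * ((cmod (deriv v z))\<^sup>2 * moebius_weight a z)"
      by (simp add: algebra_simps)
  qed simp
  also have "\<dots> = dA_int unit_disc (\<lambda>z. 2 * ((cmod (deriv u z))\<^sup>2 * moebius_weight a z))
      + dA_int unit_disc (\<lambda>z. 2 * ((cmod (deriv v z))\<^sup>2 * moebius_weight a z))"
    using energy_integrand_measurable[OF a u] energy_integrand_measurable[OF a v] moebius_weight_pos[OF a]
    by (intro dA_int_add) (auto simp: mult.left_commute[of "indicator _ _" 2] less_imp_le)
  also have "\<dots> = 2 * energy a u + 2 * energy a v"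
    using dA_int_cmult_indicator[OF unit_disc_measurable energy_integrand_measurable[OF a u], of 2]
      dA_int_cmult_indicator[OF unit_disc_measurable energy_integrand_measurable[OF a v], of 2]
    by (simp add: energy_def)
  finally show ?thesis .
qed

lemma energy_cmult:
  assumes a: "a \<in> unit_disc" and f: "f holomorphic_on unit_disc"
  shows "energy a (\<lambda>z. c * f z) = ennreal ((cmod c)\<^sup>2) * energy a f"
proof -
  have "energy a (\<lambda>z. c * f z) = dA_int unit_disc (\<lambda>z. (cmod c)\<^sup>2 * ((cmod (deriv f z))\<^sup>2 * moebius_weight a z))"
    unfolding energy_def
  proof (rule dA_int_cong)
    fix z assume z: "z \<in> unit_disc"
    have "deriv (\<lambda>z. c * f z) z = c * deriv f z"
      using f z by (intro deriv_cmult holomorphic_on_imp_differentiable_at[OF _ open_unit_disc])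
    then show "(cmod (deriv (\<lambda>z. c * f z) z))\<^sup>2 * moebius_weight a z
        = (cmod c)\<^sup>2 * ((cmod (deriv f z))\<^sup>2 * moebius_weight a z)"
      by (simp add: norm_mult power_mult_distrib)
  qed
  then show ?thesis
    using dA_int_cmult_indicator[OF unit_disc_measurable energy_integrand_measurable[OF a f], of "(cmod c)\<^sup>2"]
    by (simp add: energy_def)
qed

lemma energy_diff_const:
  assumes "f holomorphic_on unit_disc"
  shows "energy a (\<lambda>z. f z - c) = energy a f"
  unfolding energy_def
proof (rule dA_int_cong)
  fix z assume "z \<in> unit_disc"
  then have "deriv (\<lambda>z. f z - c) z = deriv f z - deriv (\<lambda>_. c) z"
    using assms by (intro deriv_diff holomorphic_on_imp_differentiable_at[OF _ open_unit_disc]) auto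
  then show "(cmod (deriv (\<lambda>z. f z - c) z))\<^sup>2 * moebius_weight a z = (cmod (deriv f z))\<^sup>2 * moebius_weight a z"
    by simp
qed

lemma energy_diff_mult_bounded:
  assumes a: "a \<in> unit_disc" and f: "f holomorphic_on unit_disc" and g: "g holomorphic_on unit_disc"
    and M: "\<And>z. z \<in> unit_disc \<Longrightarrow> cmod (g z) \<le> M"
  shows "energy a (\<lambda>z. (f z - f a) * g z) \<le> ennreal (2 * M\<^sup>2) * energy a f"
proof -
  define F where "F z = f z - f a" for z
  have F: "F holomorphic_on unit_disc" using f unfolding F_def by (intro holomorphic_intros)
  have Fg: "(\<lambda>z. F z * g z) holomorphic_on unit_disc" using F g by (intro holomorphic_intros)
  have "energy a (\<lambda>z. F z * g z) = energy 0 (\<lambda>z. (F \<circ> moebius a) z * (g \<circ> moebius a) z)"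
    using energy_comp_moebius[OF a Fg] by (simp add: comp_def)
  also have "\<dots> \<le> ennreal (2 * M\<^sup>2) * energy 0 (F \<circ> moebius a)"
    using a F g M
    by (intro energy_zero_mult_bounded holomorphic_comp_moebius) (auto simp: moebius_in_unit_disc F_def moebius_def[of a 0])
  also have "energy 0 (F \<circ> moebius a) = energy a f"
    using energy_comp_moebius[OF a F] energy_diff_const[OF f] by (simp add: F_def[abs_def])
  finally show ?thesis by (simp add: F_def)
qed

lemma energy_mult_le:
  assumes a: "a \<in> unit_disc" and f: "f holomorphic_on unit_disc" and g: "g holomorphic_on unit_disc"
    and M: "\<And>z. z \<in> unit_disc \<Longrightarrow> cmod (g z) \<le> M"
  shows "energy a (\<lambda>z. f z * g z) \<le> ennreal (4 * M\<^sup>2) * energy a f + 2 * (ennreal ((cmod (f a))\<^sup>2) * energy a g)"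
proof -
  have "energy a (\<lambda>z. f z * g z) = energy a (\<lambda>z. (f z - f a) * g z + f a * g z)"
    by (simp add: algebra_simps)
  also have "\<dots> \<le> 2 * energy a (\<lambda>z. (f z - f a) * g z) + 2 * energy a (\<lambda>z. f a * g z)"
    using f g by (intro energy_add_le a holomorphic_intros)
  also have "\<dots> \<le> 2 * (ennreal (2 * M\<^sup>2) * energy a f) + 2 * (ennreal ((cmod (f a))\<^sup>2) * energy a g)"
    using energy_diff_mult_bounded[OF a f g M] energy_cmult[OF a g]
    by (intro add_mono mult_left_mono) auto
  also have "2 * (ennreal (2 * M\<^sup>2) * energy a f) = ennreal (4 * M\<^sup>2) * energy a f"
    by (simp add: ennreal_mult' mult.assoc[symmetric])
  finally show ?thesis .
qed

text \<open>The splitting behind the previous bound, solved for the other term: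
  \<open>f a * g = f * g - (f - f a) * g\<close>. This extracts information on \<open>g\<close> from
  the membership of \<open>f\<close> and \<open>f * g\<close> in BMOA.\<close>

lemma energy_value_mult_le:
  assumes a: "a \<in> unit_disc" and f: "f holomorphic_on unit_disc" and g: "g holomorphic_on unit_disc"
    and M: "\<And>z. z \<in> unit_disc \<Longrightarrow> cmod (g z) \<le> M"
  shows "ennreal ((cmod (f a))\<^sup>2) * energy a g \<le> 2 * energy a (\<lambda>z. f z * g z) + ennreal (4 * M\<^sup>2) * energy a f"
proof -
  have fg: "(\<lambda>z. f z * g z) holomorphic_on unit_disc" using f g by (intro holomorphic_intros)
  have h: "(\<lambda>z. (f z - f a) * g z) holomorphic_on unit_disc" using f g by (intro holomorphic_intros)
  have "ennreal ((cmod (f a))\<^sup>2) * energy a g = energy a (\<lambda>z. f z * g z + (- 1) * ((f z - f a) * g z))"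
    using energy_cmult[OF a g, of "f a"] by (simp add: algebra_simps)
  also have "\<dots> \<le> 2 * energy a (\<lambda>z. f z * g z) + 2 * energy a (\<lambda>z. (- 1) * ((f z - f a) * g z))"
    using f g by (intro energy_add_le a holomorphic_intros)
  also have "energy a (\<lambda>z. (- 1) * ((f z - f a) * g z)) = energy a (\<lambda>z. (f z - f a) * g z)"
    using energy_cmult[OF a h, of "-1"] by simp
  also have "2 * energy a (\<lambda>z. f z * g z) + 2 * energy a (\<lambda>z. (f z - f a) * g z)
     \<le> 2 * energy a (\<lambda>z. f z * g z) + 2 * (ennreal (2 * M\<^sup>2) * energy a f)"
    using energy_diff_mult_bounded[OF a f g M] by (intro add_mono mult_left_mono) auto
  also have "2 * (ennreal (2 * M\<^sup>2) * energy a f) = ennreal (4 * M\<^sup>2) * energy a f"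
    by (simp add: ennreal_mult' mult.assoc[symmetric])
  finally show ?thesis .
qed

section \<open>Pointwise bounds from energies\<close>

lemma deriv_zero_le_energy:
  assumes f: "f holomorphic_on unit_disc"
  shows "ennreal ((cmod (deriv f 0))\<^sup>2) \<le> 2 * energy 0 f"
proof -
  define u where "u n = ennreal ((cmod (taylor_coeff f (Suc n)))\<^sup>2 * ((real n + 1) / (real n + 2)))" for n
  have "sum u {0} \<le> suminf u"
    by (rule sum_le_suminf) auto
  then have "u 0 \<le> energy 0 f"
    by (simp add: energy_zero_eq_suminf[OF f] u_def[abs_def])
  moreover have "u 0 = ennreal ((cmod (deriv f 0))\<^sup>2 * (1 / 2))"
    by (simp add: u_def taylor_coeff_def)
  ultimately have "ennreal ((cmod (deriv f 0))\<^sup>2 * (1 / 2)) \<le> energy 0 f"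
    by (simp only:)
  then have "2 * ennreal ((cmod (deriv f 0))\<^sup>2 * (1 / 2)) \<le> 2 * energy 0 f"
    by (rule mult_left_mono) simp
  also have "2 * ennreal ((cmod (deriv f 0))\<^sup>2 * (1 / 2)) = ennreal (2 * ((cmod (deriv f 0))\<^sup>2 * (1 / 2)))"
    by (subst ennreal_mult') simp_all
  finally show ?thesis by simp
qed

text \<open>BMOA functions are Bloch functions: the energy at 0 dominates the first Taylor
  coefficient, and the derivative of \<open>f \<circ> moebius a\<close> at 0 has modulus
  \<open>(1 - |a|^2) * |f' a|\<close>.\<close>

lemma deriv_le_energy:
  assumes a: "a \<in> unit_disc" and f: "f holomorphic_on unit_disc" and E: "energy a f \<le> ennreal E" and E0: "0 \<le> E"
  shows "(1 - cmod a) * cmod (deriv f a) \<le> sqrt (2 * E)"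
proof -
  have "ennreal ((cmod (deriv (f \<circ> moebius a) 0))\<^sup>2) \<le> 2 * energy 0 (f \<circ> moebius a)"
    by (intro deriv_zero_le_energy holomorphic_comp_moebius a f)
  also have "\<dots> \<le> 2 * ennreal E"
    using E by (simp add: energy_comp_moebius[OF a f] mult_left_mono)
  also have "\<dots> = ennreal (2 * E)" by (simp add: ennreal_mult')
  finally have 1: "ennreal ((cmod (deriv (f \<circ> moebius a) 0))\<^sup>2) \<le> ennreal (2 * E)" .
  have d: "cmod (deriv (f \<circ> moebius a) 0) = cmod (deriv f a) * (1 - (cmod a)\<^sup>2)"
  proof -
    have "cmod (of_real (1 - (cmod a)\<^sup>2)) = 1 - (cmod a)\<^sup>2"
      using one_minus_norm_power2_pos[OF a] by (simp del: of_real_diff of_real_power)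
    then show ?thesis
      by (simp add: deriv_comp_moebius[OF a _ f] deriv_moebius[OF a] norm_mult norm_minus_commute moebius_def)
  qed
  have "(cmod (deriv f a) * (1 - (cmod a)\<^sup>2))\<^sup>2 \<le> 2 * E"
    using 1 d E0 by (simp add: ennreal_le_iff)
  then have *: "cmod (deriv f a) * (1 - (cmod a)\<^sup>2) \<le> sqrt (2 * E)"
    by (rule real_le_rsqrt)
  have "(cmod a)\<^sup>2 \<le> cmod a" using a by (simp add: mem_unit_disc power2_eq_square mult_left_le)
  then have "(1 - cmod a) * cmod (deriv f a) \<le> (1 - (cmod a)\<^sup>2) * cmod (deriv f a)"
    by (intro mult_right_mono) auto
  then show ?thesis using * by (simp add: mult.commute)
qed

text \<open>Integrate along the radius ending at \<open>a\<close>: the majorant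
  \<open>C / (1 - t)\<close> has the logarithm as primitive.\<close>

lemma growth_from_deriv_bound:
  assumes f: "f holomorphic_on unit_disc" and C: "0 \<le> C"
    and d: "\<And>z. z \<in> unit_disc \<Longrightarrow> (1 - cmod z) * cmod (deriv f z) \<le> C"
    and a: "a \<in> unit_disc"
  shows "cmod (f a) \<le> cmod (f 0) + C * ln (1 / (1 - cmod a))"
proof (cases "a = 0")
  case False
  define \<zeta> where "\<zeta> = a / of_real (cmod a)"
  have \<zeta>: "cmod \<zeta> = 1" using False by (simp add: \<zeta>_def norm_divide)
  have a1: "cmod a < 1" using a by (simp add: mem_unit_disc)
  have tin: "of_real t * \<zeta> \<in> unit_disc" if "0 \<le> t" "t \<le> cmod a" for t
    using that \<zeta> a1 by (simp add: mem_unit_disc norm_mult)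
  have "norm (f (of_real (cmod a) * \<zeta>) - f (of_real 0 * \<zeta>)) \<le> C * (- ln (1 - cmod a)) - C * (- ln (1 - 0))"
  proof (rule differentiable_bound_general[where f' = "\<lambda>t. deriv f (of_real t * \<zeta>) * \<zeta>" and \<phi>' = "\<lambda>t. C * (1 / (1 - t))"])
    show "0 < cmod a" using False by simp
    show "continuous_on {0..cmod a} (\<lambda>t. f (of_real t * \<zeta>))"
      using f tin by (intro continuous_on_compose2[OF holomorphic_on_imp_continuous_on[OF f]] continuous_intros) auto
    show "continuous_on {0..cmod a} (\<lambda>t. C * (- ln (1 - t)))"
      using a1 by (intro continuous_intros) auto
    fix t assume t: "0 < t" "t < cmod a"
    have "(f has_field_derivative deriv f (of_real t * \<zeta>)) (at (of_real t * \<zeta>))"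
      using f tin t by (intro holomorphic_derivI[OF _ open_unit_disc]) auto
    moreover have "((\<lambda>t. of_real t * \<zeta>) has_vector_derivative \<zeta>) (at t)"
      by (auto intro!: derivative_eq_intros simp: has_vector_derivative_def scaleR_conv_of_real)
    ultimately show "((\<lambda>t. f (of_real t * \<zeta>)) has_vector_derivative deriv f (of_real t * \<zeta>) * \<zeta>) (at t)"
      using field_vector_diff_chain_at[of "\<lambda>t. of_real t * \<zeta>" \<zeta> t f "deriv f (of_real t * \<zeta>)"]
      by (simp add: comp_def mult.commute)
    show "((\<lambda>t. C * (- ln (1 - t))) has_vector_derivative C * (1 / (1 - t))) (at t)"
      using t a1 unfolding has_real_derivative_iff_has_vector_derivative[symmetric]
      by (auto intro!: derivative_eq_intros)
    have ct: "cmod (of_real t * \<zeta>) = t" using t \<zeta> by (simp add: norm_mult)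
    have "(1 - t) * cmod (deriv f (of_real t * \<zeta>)) \<le> C"
      using d[OF tin, of t] t unfolding ct by simp
    then show "norm (deriv f (of_real t * \<zeta>) * \<zeta>) \<le> C * (1 / (1 - t))"
      using t a1 \<zeta> by (simp add: norm_mult field_simps)
  qed
  moreover have "of_real (cmod a) * \<zeta> = a" using False by (simp add: \<zeta>_def)
  ultimately have "cmod (f a - f 0) \<le> C * ln (1 / (1 - cmod a))"
    using a1 by (simp add: ln_div)
  then show ?thesis
    using norm_triangle_ineq2[of "f a" "f 0"] by linarith
qed simp

section \<open>Carleson boxes and energies\<close>

text \<open>Jordan's inequality: by concavity, sine lies above its chord between 0 and
  \<open>pi / 2\<close>.\<close>

lemma sin_ge_linear:
  assumes "0 \<le> x" "x \<le> pi / 2"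
  shows "2 * x / pi \<le> sin x"
proof -
  have cv: "convex_on {0..pi/2} (\<lambda>x::real. - sin x)"
    by (rule f''_ge0_imp_convex[where f' = "\<lambda>x. - cos x" and f'' = sin])
       (auto intro!: derivative_eq_intros sin_ge_zero)
  have "- sin ((1 - 2 * x / pi) *\<^sub>R 0 + (2 * x / pi) *\<^sub>R (pi / 2)) \<le> (1 - 2 * x / pi) * - sin 0 + (2 * x / pi) * - sin (pi / 2)"
    by (rule convex_onD[OF cv]) (use assms in \<open>auto simp: field_simps\<close>)
  then show ?thesis by simp
qed

lemma norm_cis_minus_one: "cmod (cis \<phi> - 1) = 2 * \<bar>sin (\<phi> / 2)\<bar>"
  using dist_exp_i_1[of \<phi>] by (simp add: cis_conv_exp)

lemma abs_le_norm_cis_minus_one: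
  assumes "\<bar>\<phi>\<bar> \<le> pi"
  shows "\<bar>\<phi>\<bar> \<le> pi / 2 * cmod (cis \<phi> - 1)"
proof -
  have "2 * (\<bar>\<phi>\<bar> / 2) / pi \<le> sin (\<bar>\<phi>\<bar> / 2)"
    by (rule sin_ge_linear) (use assms in auto)
  also have "sin (\<bar>\<phi>\<bar> / 2) \<le> \<bar>sin (\<phi> / 2)\<bar>"
    by (cases "0 \<le> \<phi>") auto
  finally have "\<bar>\<phi>\<bar> / pi \<le> \<bar>sin (\<phi> / 2)\<bar>" by simp
  then show ?thesis by (simp add: norm_cis_minus_one divide_le_eq mult.commute)
qed

lemma norm_cis_minus_one_le: "cmod (cis \<phi> - 1) \<le> \<bar>\<phi>\<bar>"
proof -
  have "\<bar>sin (\<phi> / 2)\<bar> \<le> \<bar>\<phi> / 2\<bar>" by (rule abs_sin_x_le_abs_x)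
  then show ?thesis by (simp add: norm_cis_minus_one)
qed

lemma carleson_box_subset_disc: "is_arc_length l \<Longrightarrow> carleson_box t l \<subseteq> unit_disc"
proof
  fix z assume l: "is_arc_length l" and z: "z \<in> carleson_box t l"
  then obtain r \<theta> where "z = of_real r * cis \<theta>" "1 - l / (2 * pi) \<le> r" "r < 1"
    by (auto simp: carleson_box_def)
  moreover have "l / (2 * pi) \<le> 1" using l by (simp add: is_arc_length_def)
  then have "0 \<le> r" using \<open>1 - l / (2 * pi) \<le> r\<close> by linarith
  ultimately show "z \<in> unit_disc" by (auto simp: mem_unit_disc norm_mult)
qed

lemma unit_disc_subset_carleson_box: "unit_disc \<subseteq> carleson_box (- pi) (2 * pi)"
proof
  fix z assume "z \<in> unit_disc"
  then have "z = of_real (cmod z) * cis (Arg z)" "cmod z < 1"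
    by (simp_all add: mem_unit_disc rcis_cmod_Arg flip: rcis_def)
  then show "z \<in> carleson_box (- pi) (2 * pi)"
    unfolding carleson_box_def using Arg_bounded[of z] by fastforce
qed

text \<open>Smallness of \<open>1 - cnj a * z\<close> forces both \<open>1 - |z| < s\<close> and, as
  the chord controls the angle up to \<open>pi / 2\<close>, an angle of at most
  \<open>pi * s\<close> between \<open>a\<close> and \<open>z\<close>. An arc of length
  \<open>2 * pi * s\<close> has a box of depth exactly \<open>s\<close>. For
  \<open>s \<ge> 1\<close> the box of the full circle is taken.\<close>

lemma disc_neighbourhood_subset_box:
  assumes a: "a \<in> unit_disc" and s: "0 < s"
  shows "\<exists>t. {z \<in> unit_disc. cmod (1 - cnj a * z) < s} \<subseteq> carleson_box t (2 * pi * min 1 s)"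
proof (cases "s < 1")
  case False
  then show ?thesis using unit_disc_subset_carleson_box by (intro exI[of _ "- pi"]) auto
next
  case True
  have "z \<in> carleson_box (Arg a - pi * s) (2 * pi * s)"
    if z: "z \<in> unit_disc" and zs: "cmod (1 - cnj a * z) < s" for z
  proof -
    define w where "w = cnj a * z"
    define \<phi> where "\<phi> = Arg w"
    have w: "cmod (1 - w) < s" using zs by (simp add: w_def)
    have "w \<noteq> 0" using w True by auto
    then have nz: "a \<noteq> 0" "z \<noteq> 0" by (auto simp: w_def)
    have ge: "1 - cmod w \<le> cmod (1 - w)" using norm_triangle_ineq2[of 1 w] by simp
    have cw: "cmod w = cmod a * cmod z" by (simp add: w_def norm_mult)
    have wz: "cmod w \<le> cmod z" using a unfolding cw by (simp add: mem_unit_disc mult_left_le_one_le)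
    have w1: "cmod w \<le> 1" using wz z by (simp add: mem_unit_disc)
    have weq: "w = of_real (cmod w) * cis \<phi>"
      by (simp add: \<phi>_def rcis_cmod_Arg flip: rcis_def)
    have aeq: "a = of_real (cmod a) * cis (Arg a)"
      by (simp add: rcis_cmod_Arg flip: rcis_def)
    have "cmod (cis \<phi> - 1) \<le> cmod (cis \<phi> - w) + cmod (w - 1)"
      using norm_triangle_ineq[of "cis \<phi> - w" "w - 1"] by simp
    also have "cmod (cis \<phi> - w) = 1 - cmod w"
    proof -
      have "cis \<phi> - w = of_real (1 - cmod w) * cis \<phi>" by (subst weq) (simp add: algebra_simps)
      then have "cmod (cis \<phi> - w) = \<bar>1 - cmod w\<bar>" by (simp add: norm_mult del: of_real_diff)
      then show ?thesis using w1 by simp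
    qed
    finally have "cmod (cis \<phi> - 1) \<le> 2 * s"
      using ge w by (simp add: norm_minus_commute)
    then have "pi / 2 * cmod (cis \<phi> - 1) \<le> pi / 2 * (2 * s)"
      by (intro mult_left_mono) auto
    then have \<phi>: "\<bar>\<phi>\<bar> \<le> pi * s"
      using abs_le_norm_cis_minus_one[of \<phi>] Arg_bounded[of w] unfolding \<phi>_def[symmetric]
      by linarith
    have "of_real ((cmod a)\<^sup>2) * z = a * w"
      by (simp add: w_def mult.assoc[symmetric] complex_norm_square del: of_real_power)
    also have "\<dots> = of_real ((cmod a)\<^sup>2) * (of_real (cmod z) * cis (Arg a + \<phi>))"
      by (subst aeq, subst weq) (simp add: cw power2_eq_square cis_mult[symmetric] mult_ac)
    finally have zeq: "z = of_real (cmod z) * cis (Arg a + \<phi>)"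
      using nz by simp
    have "1 - (2 * pi * s) / (2 * pi) \<le> cmod z" using ge w wz by simp
    then show ?thesis
      unfolding carleson_box_def using zeq \<phi> z
      by (intro CollectI exI[of _ "cmod z"] exI[of _ "Arg a + \<phi>"]) (auto simp: mem_unit_disc abs_le_iff)
  qed
  then show ?thesis using True by (intro exI[of _ "Arg a - pi * s"]) auto
qed

definition carleson_mass :: "(complex \<Rightarrow> complex) \<Rightarrow> complex set \<Rightarrow> ennreal" where
  "carleson_mass f S = dA_int S (\<lambda>z. (1 - (cmod z)\<^sup>2) * (cmod (deriv f z))\<^sup>2)"

lemma carleson_mass_mono: "S \<subseteq> T \<Longrightarrow> carleson_mass f S \<le> carleson_mass f T"
  unfolding carleson_mass_def by (intro dA_int_mono) auto

text \<open>The Moebius weight at the point with \<open>1 - |a| = l / 2\<pi>\<close> over the midpoint of the arc is at least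
  \<open>(1 - |z|\<^sup>2) / (2 \<pi> l)\<close> on the box.\<close>
lemma carleson_mass_box_le_energy:
  assumes l: "is_arc_length l" and f: "f holomorphic_on unit_disc"
  shows "\<exists>a\<in>unit_disc. 1 - cmod a = l / (2 * pi) \<and>
     carleson_mass f (carleson_box t l) \<le> ennreal (2 * pi * l) * energy a f"
proof -
  define \<rho> where "\<rho> = 1 - l / (2 * pi)"
  define a where "a = of_real \<rho> * cis (t + l / 2)"
  have l0: "0 < l" and \<rho>: "0 \<le> \<rho>" "\<rho> < 1" and l\<rho>: "l = 2 * pi * (1 - \<rho>)"
    using l by (auto simp: \<rho>_def is_arc_length_def field_simps)
  have ca: "cmod a = \<rho>" using \<rho> by (simp add: a_def norm_mult)
  have a: "a \<in> unit_disc" using \<rho> by (simp add: mem_unit_disc ca)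
  have key: "(1 - (cmod z)\<^sup>2) * (cmod (deriv f z))\<^sup>2 \<le> 2 * pi * l * ((cmod (deriv f z))\<^sup>2 * moebius_weight a z)"
    if z: "z \<in> carleson_box t l" for z
  proof -
    obtain r \<theta> where z_eq: "z = of_real r * cis \<theta>" and \<theta>: "t \<le> \<theta>" "\<theta> \<le> t + l" and r: "\<rho> \<le> r" "r < 1"
      using z by (auto simp: carleson_box_def \<rho>_def)
    have zd: "z \<in> unit_disc" using carleson_box_subset_disc[OF l] z by blast
    define \<psi> where "\<psi> = \<theta> - (t + l / 2)"
    have \<psi>: "\<bar>\<psi>\<bar> \<le> l / 2" using \<theta> by (auto simp: \<psi>_def abs_le_iff field_simps)
    have "cnj a * z = of_real (\<rho> * r) * cis \<psi>"
      by (simp add: a_def z_eq \<psi>_def cis_cnj cis_mult mult_ac) (simp add: algebra_simps)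
    then have "1 - cnj a * z = of_real (1 - \<rho> * r) - of_real (\<rho> * r) * (cis \<psi> - 1)"
      by (simp add: algebra_simps)
    then have "cmod (1 - cnj a * z) \<le> \<bar>1 - \<rho> * r\<bar> + cmod (of_real (\<rho> * r) * (cis \<psi> - 1))"
      by (metis norm_of_real norm_triangle_ineq4)
    also have "cmod (of_real (\<rho> * r) * (cis \<psi> - 1)) \<le> 1 * (l / 2)"
      unfolding norm_mult
      using \<rho> r \<psi> norm_cis_minus_one_le[of \<psi>] by (intro mult_mono) (auto simp: mult_le_one norm_mult)
    also have "\<bar>1 - \<rho> * r\<bar> = 1 - \<rho> * r" using \<rho> r by (simp add: mult_le_one)
    also have "1 - \<rho> * r \<le> 1 - \<rho> * \<rho>" using \<rho> r by (intro diff_left_mono mult_left_mono) auto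
    also have "1 - \<rho> * \<rho> \<le> 2 * (1 - \<rho>)"
      using zero_le_square[of "1 - \<rho>"] by (simp add: algebra_simps)
    \<comment> \<open>The half length of the arc is \<open>pi * (1 - \<rho>)\<close>, so the radial
      term is absorbed by the other half of \<open>l\<close> because
      \<open>2 \<le> pi\<close>.\<close>
    also have "2 * (1 - \<rho>) + 1 * (l / 2) \<le> l"
    proof -
      have "2 * (1 - \<rho>) \<le> pi * (1 - \<rho>)" using pi_gt3 \<rho> by (intro mult_right_mono) auto
      moreover have "l / 2 = pi * (1 - \<rho>)" by (simp add: l\<rho>)
      ultimately show ?thesis by linarith
    qed
    finally have le: "cmod (1 - cnj a * z) \<le> l" by simp
    have nz: "0 < cmod (1 - cnj a * z)" using one_minus_cnj_mult_nonzero[OF a zd] by simp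
    have sq: "(cmod (1 - cnj a * z))\<^sup>2 \<le> l\<^sup>2" using le by (intro power_mono) auto
    have "l / (2 * pi) \<le> 1 - (cmod a)\<^sup>2"
      using \<rho> mult_left_mono[of \<rho> 1 \<rho>] unfolding ca by (simp add: l\<rho> power2_eq_square)
    then have "2 * pi * l * (l / (2 * pi)) \<le> 2 * pi * l * (1 - (cmod a)\<^sup>2)"
      using l0 by (intro mult_left_mono) auto
    then have "l\<^sup>2 \<le> 2 * pi * l * (1 - (cmod a)\<^sup>2)"
      by (simp add: power2_eq_square)
    with sq have "(cmod (1 - cnj a * z))\<^sup>2 \<le> 2 * pi * l * (1 - (cmod a)\<^sup>2)" by linarith
    then have "1 \<le> 2 * pi * l * (1 - (cmod a)\<^sup>2) / (cmod (1 - cnj a * z))\<^sup>2"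
      using nz by simp
    then have "1 * ((1 - (cmod z)\<^sup>2) * (cmod (deriv f z))\<^sup>2) \<le>
        2 * pi * l * (1 - (cmod a)\<^sup>2) / (cmod (1 - cnj a * z))\<^sup>2 * ((1 - (cmod z)\<^sup>2) * (cmod (deriv f z))\<^sup>2)"
      using one_minus_norm_power2_pos[OF zd] by (intro mult_right_mono) auto
    moreover have "x * A / N * (Z * D) = x * (D * (A * Z / N))" for x A N Z D :: real by simp
    ultimately show ?thesis unfolding moebius_weight_def by (simp only: mult_1)
  qed
  have "carleson_mass f (carleson_box t l) \<le> dA_int unit_disc (\<lambda>z. 2 * pi * l * ((cmod (deriv f z))\<^sup>2 * moebius_weight a z))"
    unfolding carleson_mass_def by (intro dA_int_mono key carleson_box_subset_disc l)
  also have "\<dots> = ennreal (2 * pi * l) * energy a f"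
    using dA_int_cmult_indicator[OF unit_disc_measurable energy_integrand_measurable[OF a f], of "2 * pi * l"] l0
    by (simp add: energy_def)
  finally show ?thesis using a ca l\<rho> by (intro bexI[of _ a]) auto
qed

lemma dyadic_shell:
  fixes x d :: real
  assumes "0 < d" "d \<le> x"
  shows "\<exists>k. 2 ^ k * d \<le> x \<and> x < 2 ^ Suc k * d"
proof -
  obtain n where n: "x / d < 2 ^ n" using real_arch_pow[of 2 "x / d"] by auto
  define m where "m = (LEAST n. x / d < 2 ^ n)"
  have m: "x / d < 2 ^ m" unfolding m_def by (rule LeastI[where P = "\<lambda>n. x / d < 2 ^ n", OF n])
  have "m \<noteq> 0" using m assms by (intro notI) (simp add: field_simps)
  then obtain k where k: "m = Suc k" using not0_implies_Suc by blast
  have "\<not> x / d < 2 ^ k" using not_less_Least[of k "\<lambda>n. x / d < 2 ^ n"] k m_def by simp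
  with m k assms show ?thesis by (intro exI[of _ k]) (simp add: field_simps)
qed

text \<open>From \<open>k = 2\<close> on, \<open>(k+3)/(k+2) \<le> 5/4\<close>, so successive terms
  have ratio at most \<open>(25/16)/2 = 25/32\<close>.\<close>

lemma summable_dyadic: "summable (\<lambda>k. (real k + 2)\<^sup>2 / 2 ^ k)"
proof -
  have "(real (Suc k) + 2)\<^sup>2 / 2 ^ Suc k \<le> 25 / 32 * ((real k + 2)\<^sup>2 / 2 ^ k)" if "2 \<le> k" for k
  proof -
    have "(4 * (real k + 3))\<^sup>2 \<le> (5 * (real k + 2))\<^sup>2"
      using that by (intro power_mono) auto
    then have "16 * (real k + 3)\<^sup>2 \<le> 25 * (real k + 2)\<^sup>2"
      by (simp only: power_mult_distrib) simp
    then show ?thesis by (simp add: field_simps)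
  qed
  then show ?thesis
    by (intro summable_ratio_test[of "25 / 32" 2]) auto
qed

text \<open>At distance about \<open>2^k * (1 - |a|)\<close> the kernel is of size
  \<open>1 / (4^k * (1 - |a|))\<close>, while the mass of the neighbourhood grows only like
  \<open>2^k * (1 - |a|)\<close>. The geometric gain leaves room for a factor
  \<open>(k+1)^2\<close>, which pays for comparing logarithms at scales that differ by
  \<open>2^k\<close>. The factor \<open>w\<close> is 1 for BMOA and \<open>(log_weight a)^2\<close>
  for the logarithmic space.\<close>

lemma energy_le_dyadic:
  assumes a: "a \<in> unit_disc" and f: "f holomorphic_on unit_disc" and B: "0 \<le> B" and w: "0 \<le> w"
    and mass: "\<And>k. carleson_mass f {z \<in> unit_disc. cmod (1 - cnj a * z) < 2 ^ k * (1 - cmod a)} * ennreal w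
        \<le> ennreal (B * (real k + 1)\<^sup>2 * 2 ^ k * (1 - cmod a))"
  shows "energy a f * ennreal w \<le> ennreal (4 * (\<Sum>k. (real k + 2)\<^sup>2 / 2 ^ k) * B)"
proof -
  define d where "d = 1 - cmod a"
  have d: "0 < d" using a by (simp add: d_def mem_unit_disc)
  define E where "E k = {z \<in> unit_disc. cmod (1 - cnj a * z) < 2 ^ k * d}" for k
  have E[measurable]: "E k \<in> sets borel" for k
  proof -
    have "E k = unit_disc \<inter> {z. cmod (1 - cnj a * z) < 2 ^ k * d}" by (auto simp: E_def)
    moreover have "open {z. cmod (1 - cnj a * z) < 2 ^ k * d}"
      by (intro open_Collect_less continuous_intros)
    ultimately show ?thesis by auto
  qed
  define h where "h z = (1 - (cmod z)\<^sup>2) * (cmod (deriv f z))\<^sup>2" for z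
  define h' where "h' z = indicator unit_disc z * h z" for z
  have h'm [measurable]: "h' \<in> borel_measurable borel"
  proof -
    have "(\<lambda>z. indicator unit_disc z *\<^sub>R h z) \<in> borel_measurable borel"
      unfolding h_def
      by (intro borel_measurable_continuous_on_indicator continuous_intros continuous_on_deriv_unit_disc f) auto
    then show ?thesis by (simp add: h'_def[abs_def])
  qed
  have h0: "0 \<le> h' z" for z
    using one_minus_norm_power2_pos[of z] by (auto simp: h'_def h_def indicator_def)
  \<comment> \<open>Each point lies in one dyadic shell, which is enlarged to the full neighbourhood
    \<open>E (Suc k)\<close>; the remaining summands are nonnegative and may be added.\<close>
  have pw: "ennreal ((cmod (deriv f z))\<^sup>2 * moebius_weight a z / pi) * indicator unit_disc z
      \<le> (\<Sum>k. ennreal (2 / (4 ^ k * d)) * (ennreal (h' z / pi) * indicator (E (Suc k)) z))" for z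
  proof (cases "z \<in> unit_disc")
    case True
    have "d \<le> cmod (1 - cnj a * z)"
    proof -
      have "cmod (cnj a * z) \<le> cmod a * 1"
        unfolding norm_mult using True by (intro mult_mono) (auto simp: mem_unit_disc)
      then show ?thesis using norm_triangle_ineq2[of 1 "cnj a * z"] by (simp add: d_def)
    qed
    from dyadic_shell[OF d this] obtain k where k: "2 ^ k * d \<le> cmod (1 - cnj a * z)" "cmod (1 - cnj a * z) < 2 ^ Suc k * d"
      by blast
    have inE: "z \<in> E (Suc k)" using k True by (simp add: E_def)
    have nz: "0 < cmod (1 - cnj a * z)" using k(1) d by (smt (verit) mult_pos_pos zero_less_power)
    have "(2 ^ k * d)\<^sup>2 \<le> (cmod (1 - cnj a * z))\<^sup>2" using k(1) d by (intro power_mono) auto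
    moreover have "(2 ^ k * d)\<^sup>2 = 4 ^ k * d\<^sup>2"
      using power_mult[of "2::real" k 2] power_mult[of "2::real" 2 k] by (simp add: power_mult_distrib mult.commute)
    ultimately have sq: "4 ^ k * d\<^sup>2 \<le> (cmod (1 - cnj a * z))\<^sup>2" by simp
    have a1: "1 - (cmod a)\<^sup>2 \<le> 2 * d"
      using zero_le_power2[of "1 - cmod a"] by (simp add: d_def power2_eq_square algebra_simps)
    have "(1 - (cmod a)\<^sup>2) / (cmod (1 - cnj a * z))\<^sup>2 \<le> 2 * d / (4 ^ k * d\<^sup>2)"
      using sq a1 d by (intro frac_le) auto
    also have "\<dots> = 2 / (4 ^ k * d)" using d by (simp add: power2_eq_square field_simps)
    finally have "(1 - (cmod a)\<^sup>2) / (cmod (1 - cnj a * z))\<^sup>2 * h' z \<le> 2 / (4 ^ k * d) * h' z"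
      using h0 by (intro mult_right_mono)
    then have "(cmod (deriv f z))\<^sup>2 * moebius_weight a z \<le> 2 / (4 ^ k * d) * h' z"
      using True by (simp add: moebius_weight_def h'_def h_def mult_ac)
    then have "(cmod (deriv f z))\<^sup>2 * moebius_weight a z / pi \<le> 2 / (4 ^ k * d) * h' z / pi"
      by (rule divide_right_mono) simp
    then have "ennreal ((cmod (deriv f z))\<^sup>2 * moebius_weight a z / pi) \<le> ennreal (2 / (4 ^ k * d) * (h' z / pi))"
      by (intro ennreal_leI) simp
    also have "\<dots> = ennreal (2 / (4 ^ k * d)) * ennreal (h' z / pi)"
      using d by (intro ennreal_mult') simp
    also have "\<dots> = ennreal (2 / (4 ^ k * d)) * (ennreal (h' z / pi) * indicator (E (Suc k)) z)"
      using inE by simp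
    also have "\<dots> \<le> (\<Sum>k. ennreal (2 / (4 ^ k * d)) * (ennreal (h' z / pi) * indicator (E (Suc k)) z))"
      using sum_le_suminf[OF summableI, of "{k}" "\<lambda>k. ennreal (2 / (4 ^ k * d)) * (ennreal (h' z / pi) * indicator (E (Suc k)) z)"]
      by simp
    finally show ?thesis using True by simp
  qed simp
  have "energy a f \<le> (\<integral>\<^sup>+z. (\<Sum>k. ennreal (2 / (4 ^ k * d)) * (ennreal (h' z / pi) * indicator (E (Suc k)) z)) \<partial>lborel)"
    unfolding energy_def dA_int_def by (intro nn_integral_mono pw)
  also have "\<dots> = (\<Sum>k. ennreal (2 / (4 ^ k * d)) * (\<integral>\<^sup>+z. ennreal (h' z / pi) * indicator (E (Suc k)) z \<partial>lborel))"
    by (subst nn_integral_suminf) (auto simp: nn_integral_cmult)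
  also have "\<dots> = (\<Sum>k. ennreal (2 / (4 ^ k * d)) * carleson_mass f (E (Suc k)))"
  proof -
    have "(\<integral>\<^sup>+z. ennreal (h' z / pi) * indicator (E k) z \<partial>lborel) = carleson_mass f (E k)" for k
      unfolding carleson_mass_def dA_int_def
      by (intro nn_integral_cong) (auto simp: h'_def h_def E_def indicator_def)
    then show ?thesis by simp
  qed
  finally have "energy a f * ennreal w \<le> (\<Sum>k. ennreal (2 / (4 ^ k * d)) * carleson_mass f (E (Suc k))) * ennreal w"
    by (rule mult_right_mono) simp
  also have "\<dots> = (\<Sum>k. ennreal (2 / (4 ^ k * d)) * (carleson_mass f (E (Suc k)) * ennreal w))"
    by (simp add: mult.assoc flip: ennreal_suminf_multc)
  also have "\<dots> \<le> (\<Sum>k. ennreal (4 * B * ((real k + 2)\<^sup>2 / 2 ^ k)))"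
  proof (intro suminf_le summableI)
    fix k
    have "ennreal (2 / (4 ^ k * d)) * (carleson_mass f (E (Suc k)) * ennreal w)
        \<le> ennreal (2 / (4 ^ k * d)) * ennreal (B * (real (Suc k) + 1)\<^sup>2 * 2 ^ Suc k * d)"
      using mass[of "Suc k"] unfolding E_def d_def by (intro mult_left_mono) auto
    also have "\<dots> = ennreal (2 / (4 ^ k * d) * (B * (real (Suc k) + 1)\<^sup>2 * 2 ^ Suc k * d))"
      using d by (intro ennreal_mult'[symmetric]) simp
    also have "2 / (4 ^ k * d) * (B * (real (Suc k) + 1)\<^sup>2 * 2 ^ Suc k * d) = 4 * B * ((real k + 2)\<^sup>2 / 2 ^ k)"
    proof -
      have "(4::real) ^ k = 2 ^ k * 2 ^ k" by (simp flip: power_mult_distrib)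
      then show ?thesis using d by (simp add: field_simps)
    qed
    finally show "ennreal (2 / (4 ^ k * d)) * (carleson_mass f (E (Suc k)) * ennreal w)
        \<le> ennreal (4 * B * ((real k + 2)\<^sup>2 / 2 ^ k))" .
  qed
  also have "\<dots> = ennreal (\<Sum>k. 4 * B * ((real k + 2)\<^sup>2 / 2 ^ k))"
    using B summable_dyadic by (intro suminf_ennreal2 summable_mult) auto
  also have "(\<Sum>k. 4 * B * ((real k + 2)\<^sup>2 / 2 ^ k)) = 4 * (\<Sum>k. (real k + 2)\<^sup>2 / 2 ^ k) * B"
    by (subst suminf_mult[OF summable_dyadic]) simp
  finally show ?thesis .
qed

section \<open>BMOA and logarithmic BMOA in terms of energies\<close>

text \<open>The numerator 2 keeps the weight at least \<open>ln 2\<close>, also at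
  \<open>a = 0\<close>, so that it can be divided by and additive constants can be absorbed into
  it.\<close>

definition log_weight :: "complex \<Rightarrow> real" where
  "log_weight a = ln (2 / (1 - cmod a))"

lemma log_weight_ge: "a \<in> unit_disc \<Longrightarrow> ln 2 \<le> log_weight a"
  by (auto simp: log_weight_def mem_unit_disc field_simps)

lemma log_weight_pos: "a \<in> unit_disc \<Longrightarrow> 0 < log_weight a"
  using log_weight_ge[of a] ln_gt_zero[of "2::real"] by linarith

lemma ln_le_log_weight: "a \<in> unit_disc \<Longrightarrow> ln (1 / (1 - cmod a)) \<le> log_weight a"
  by (auto simp: log_weight_def mem_unit_disc divide_right_mono)

lemma mem_BMOA_iff:
  "f \<in> BMOA \<longleftrightarrow> f holomorphic_on unit_disc \<and>
     (\<exists>C>0. \<forall>t l. is_arc_length l \<longrightarrow> carleson_mass f (carleson_box t l) \<le> ennreal (C * l))"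
  by (simp add: BMOA_def carleson_mass_def)

lemma mem_BMOA_log_iff:
  "g \<in> BMOA_log \<longleftrightarrow> g \<in> H1 \<and>
     (\<exists>C>0. \<forall>t l. is_arc_length l \<longrightarrow>
        carleson_mass g (carleson_box t l) * ennreal ((ln (2 / l))\<^sup>2) \<le> ennreal (C * l))"
  by (simp add: BMOA_log_def carleson_mass_def)

lemma carleson_mass_neighbourhood_le:
  assumes a: "a \<in> unit_disc" and s: "0 < s"
    and box: "\<And>t l. is_arc_length l \<Longrightarrow> carleson_mass f (carleson_box t l) \<le> ennreal (C * l)" and C: "0 \<le> C"
  shows "carleson_mass f {z \<in> unit_disc. cmod (1 - cnj a * z) < s} \<le> ennreal (C * (2 * pi * min 1 s))"
proof -
  obtain t where "{z \<in> unit_disc. cmod (1 - cnj a * z) < s} \<subseteq> carleson_box t (2 * pi * min 1 s)"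
    using disc_neighbourhood_subset_box[OF a s] by blast
  then have "carleson_mass f {z \<in> unit_disc. cmod (1 - cnj a * z) < s} \<le> carleson_mass f (carleson_box t (2 * pi * min 1 s))"
    by (rule carleson_mass_mono)
  also have "\<dots> \<le> ennreal (C * (2 * pi * min 1 s))"
    by (rule box) (use s in \<open>auto simp: is_arc_length_def min_def\<close>)
  finally show ?thesis .
qed

lemma BMOA_iff_energy:
  "f \<in> BMOA \<longleftrightarrow> f holomorphic_on unit_disc \<and> (\<exists>C\<ge>0. \<forall>a\<in>unit_disc. energy a f \<le> ennreal C)"
proof (intro iffI conjI; (elim conjE)?)
  assume "f \<in> BMOA"
  then obtain C where f: "f holomorphic_on unit_disc" and C: "0 < C"
    and box: "\<And>t l. is_arc_length l \<Longrightarrow> carleson_mass f (carleson_box t l) \<le> ennreal (C * l)"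
    unfolding mem_BMOA_iff by blast
  define K where "K = (\<Sum>k. (real k + 2)\<^sup>2 / 2 ^ k)"
  have K: "0 \<le> K" unfolding K_def by (intro suminf_nonneg summable_dyadic) auto
  have "energy a f \<le> ennreal (4 * K * (C * (2 * pi)))" if a: "a \<in> unit_disc" for a
  proof -
    have "energy a f * ennreal 1 \<le> ennreal (4 * K * (C * (2 * pi)))"
      unfolding K_def
    proof (rule energy_le_dyadic[OF a f])
      fix k
      have d: "0 < 1 - cmod a" using a by (simp add: mem_unit_disc)
      have "carleson_mass f {z \<in> unit_disc. cmod (1 - cnj a * z) < 2 ^ k * (1 - cmod a)}
          \<le> ennreal (C * (2 * pi * min 1 (2 ^ k * (1 - cmod a))))"
        using d C by (intro carleson_mass_neighbourhood_le[OF a _ box]) auto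
      also have "\<dots> \<le> ennreal (C * (2 * pi) * (real k + 1)\<^sup>2 * 2 ^ k * (1 - cmod a))"
      proof (rule ennreal_leI)
        have "1 * (2 ^ k * (1 - cmod a)) \<le> (real k + 1)\<^sup>2 * (2 ^ k * (1 - cmod a))"
          using d by (intro mult_right_mono) (auto intro!: one_le_power)
        then have "min 1 (2 ^ k * (1 - cmod a)) \<le> (real k + 1)\<^sup>2 * (2 ^ k * (1 - cmod a))" by linarith
        then have "C * (2 * pi) * min 1 (2 ^ k * (1 - cmod a)) \<le> C * (2 * pi) * ((real k + 1)\<^sup>2 * (2 ^ k * (1 - cmod a)))"
          using C by (intro mult_left_mono) auto
        then show "C * (2 * pi * min 1 (2 ^ k * (1 - cmod a))) \<le> C * (2 * pi) * (real k + 1)\<^sup>2 * 2 ^ k * (1 - cmod a)"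
          by (simp only: mult.assoc)
      qed
      finally show "carleson_mass f {z \<in> unit_disc. cmod (1 - cnj a * z) < 2 ^ k * (1 - cmod a)} * ennreal 1
          \<le> ennreal (C * (2 * pi) * (real k + 1)\<^sup>2 * 2 ^ k * (1 - cmod a))" by simp
    qed (use C in auto)
    then show ?thesis by simp
  qed
  moreover have "0 \<le> 4 * K * (C * (2 * pi))" using K C by simp
  ultimately show "\<exists>C\<ge>0. \<forall>a\<in>unit_disc. energy a f \<le> ennreal C" by blast
next
  assume "f \<in> BMOA" then show "f holomorphic_on unit_disc" by (simp add: BMOA_def)
next
  assume f: "f holomorphic_on unit_disc" and "\<exists>C\<ge>0. \<forall>a\<in>unit_disc. energy a f \<le> ennreal C"
  then obtain C where C: "0 \<le> C" and E: "\<And>a. a \<in> unit_disc \<Longrightarrow> energy a f \<le> ennreal C" by blast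
  \<comment> \<open>The energy bound may be \<open>C = 0\<close>, whereas the definition of BMOA
    asks for a positive constant; hence the \<open>+ 1\<close>.\<close>
  have "carleson_mass f (carleson_box t l) \<le> ennreal ((2 * pi * C + 1) * l)" if l: "is_arc_length l" for t l
  proof -
    have l0: "0 < l" using l by (simp add: is_arc_length_def)
    obtain a where a: "a \<in> unit_disc" and m: "carleson_mass f (carleson_box t l) \<le> ennreal (2 * pi * l) * energy a f"
      using carleson_mass_box_le_energy[OF l f] by blast
    note m
    also have "ennreal (2 * pi * l) * energy a f \<le> ennreal (2 * pi * l) * ennreal C"
      by (intro mult_left_mono E a) simp
    also have "\<dots> = ennreal (2 * pi * l * C)" using l0 by (intro ennreal_mult'[symmetric]) simp
    also have "\<dots> \<le> ennreal ((2 * pi * C + 1) * l)" using l0 by (intro ennreal_leI) (simp add: algebra_simps)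
    finally show ?thesis .
  qed
  moreover have "0 < 2 * pi * C + 1" using C by (intro add_nonneg_pos) auto
  ultimately show "f \<in> BMOA" unfolding mem_BMOA_iff using f by blast
qed

text \<open>Energies control only the box condition in \<open>BMOA_log\<close>; its Hardy space
  condition is supplied by boundedness.\<close>

lemma Hinf_subset_H1: "Hinf \<subseteq> H1"
proof
  fix g assume "g \<in> Hinf"
  then have g: "g holomorphic_on unit_disc" and "bounded (g ` unit_disc)" by (auto simp: Hinf_def)
  then obtain M where M: "\<And>z. z \<in> unit_disc \<Longrightarrow> cmod (g z) \<le> M"
    unfolding bounded_iff by auto
  have "(LBINT t=0..2*pi. cmod (g (complex_of_real r * cis t))) \<le> M * (2 * pi)" if r: "0 \<le> r" "r < 1" for r
  proof -
    have in_disc: "complex_of_real r * cis t \<in> unit_disc" for t using r by (simp add: mem_unit_disc norm_mult)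
    have cont: "continuous_on {0..2*pi} (\<lambda>t. cmod (g (complex_of_real r * cis t)))"
      by (intro continuous_on_norm continuous_on_compose2[OF holomorphic_on_imp_continuous_on[OF g]] continuous_intros)
         (auto simp: in_disc)
    have "(LBINT t=ereal 0..ereal (2*pi). cmod (g (complex_of_real r * cis t)))
        = integral {0..2*pi} (\<lambda>t. cmod (g (complex_of_real r * cis t)))"
      using cont by (intro interval_integral_eq_integral borel_integrable_atLeastAtMost') auto
    also have "\<dots> \<le> integral {0..2*pi} (\<lambda>t. M)"
      by (intro integral_le integrable_continuous_real cont M in_disc) auto
    also have "\<dots> = M * (2 * pi)" by simp
    finally show ?thesis by (simp add: zero_ereal_def)
  qed
  then show "g \<in> H1" unfolding H1_def using g by blast
qed

lemma ennreal_mult_le_imp_le_divide: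
  assumes "x * ennreal w \<le> ennreal y" "0 < w" "0 \<le> y"
  shows "x \<le> ennreal (y / w)"
proof (cases x)
  case (real r)
  then have "r * w \<le> y" using assms by (simp add: ennreal_mult''[symmetric])
  then show ?thesis using real assms by (simp add: ennreal_leI pos_le_divide_eq)
next
  case top
  then show ?thesis using assms by (simp add: ennreal_top_mult top_unique)
qed

text \<open>Replacing \<open>1 - |a|\<close> by the arc length
  \<open>2 * pi * 2^k * (1 - |a|)\<close> shifts the logarithm by
  \<open>ln (2 * pi) + k * ln 2\<close>. Once the arc is the full circle,
  \<open>2 / (1 - |a|)\<close> is at most \<open>2^(k+1)\<close> and the second summand alone
  suffices. The absolute value is there because the logarithm is negative for arcs longer than
  2.\<close>

lemma log_weight_dyadic_le:
  assumes a: "a \<in> unit_disc"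
  shows "log_weight a \<le> \<bar>ln (2 / (2 * pi * min 1 (2 ^ k * (1 - cmod a))))\<bar> + 3 * (real k + 1)"
proof -
  define d where "d = 1 - cmod a"
  have d: "0 < d" using a by (simp add: d_def mem_unit_disc)
  have l2: "ln (2::real) \<le> 1" using ln_le_minus_one[of "2::real"] by simp
  have kl2: "real k * ln 2 \<le> real k" using l2 by (simp add: mult_left_le)
  show ?thesis
  proof (cases "2 ^ k * d < 1")
    case True
    have "ln (2 * pi) \<le> ln (2 ^ 3)" using pi_less_4 by (intro ln_mono) auto
    also have "\<dots> = 3 * ln 2" by (subst ln_realpow) auto
    finally have p: "ln (2 * pi) \<le> 3" using l2 by linarith
    have "log_weight a = ln (2 / (2 * pi * (2 ^ k * d)) * (2 * pi * 2 ^ k))"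
      using d by (simp add: log_weight_def d_def[symmetric])
    also have "\<dots> = ln (2 / (2 * pi * (2 ^ k * d))) + (ln (2 * pi) + real k * ln 2)"
      using d by (subst ln_mult) (simp_all add: ln_mult ln_realpow)
    also have "\<dots> \<le> \<bar>ln (2 / (2 * pi * (2 ^ k * d)))\<bar> + 3 * (real k + 1)"
      using p kl2 by simp
    finally show ?thesis using True by (simp add: d_def[symmetric] min_def)
  next
    case False
    then have "2 / d \<le> 2 ^ Suc k" using d by (simp add: divide_le_eq mult.commute)
    then have "log_weight a \<le> ln (2 ^ Suc k)"
      unfolding log_weight_def d_def[symmetric] using d by (intro ln_mono) auto
    also have "\<dots> = real (Suc k) * ln 2" by (subst ln_realpow) auto
    also have "\<dots> \<le> 3 * (real k + 1)" using kl2 l2 by (simp add: algebra_simps)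
    finally show ?thesis by (smt (verit) abs_ge_zero)
  qed
qed

text \<open>The logarithmic factor vanishes at \<open>l = 2\<close>, so the condition says nothing
  directly about arcs of that length. For \<open>l \<le> 1\<close> the factor is at least
  \<open>(ln 2)^2\<close>; longer arcs are compared with the full circle, where it is
  \<open>(ln (1 / pi))^2 > 0\<close>.\<close>

lemma carleson_mass_box_of_BMOA_log:
  assumes C: "0 < C"
    and box: "\<And>t l. is_arc_length l \<Longrightarrow>
        carleson_mass g (carleson_box t l) * ennreal ((ln (2 / l))\<^sup>2) \<le> ennreal (C * l)"
  shows "\<exists>C'>0. \<forall>t l. is_arc_length l \<longrightarrow> carleson_mass g (carleson_box t l) \<le> ennreal (C' * l)"
proof -
  define C' where "C' = C / (ln 2)\<^sup>2 + C * (2 * pi) / (ln (1 / pi))\<^sup>2"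
  have l2: "0 < (ln (2::real))\<^sup>2" by simp
  have lp: "0 < (ln (1 / pi))\<^sup>2" using pi_gt3 by (simp add: ln_div)
  have C': "0 < C'" unfolding C'_def using C l2 lp by (intro add_pos_pos divide_pos_pos mult_pos_pos) auto
  have "carleson_mass g (carleson_box t l) \<le> ennreal (C' * l)" if l: "is_arc_length l" for t l
  proof (cases "l \<le> 1")
    case True
    have l0: "0 < l" using l by (simp add: is_arc_length_def)
    have "ln 2 \<le> ln (2 / l)" using True l0 by (intro ln_mono) (auto simp: field_simps)
    then have "(ln 2)\<^sup>2 \<le> (ln (2 / l))\<^sup>2" by (intro power_mono) auto
    then have "carleson_mass g (carleson_box t l) * ennreal ((ln 2)\<^sup>2) \<le> carleson_mass g (carleson_box t l) * ennreal ((ln (2 / l))\<^sup>2)"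
      by (intro mult_left_mono ennreal_leI) auto
    also have "\<dots> \<le> ennreal (C * l)" by (rule box[OF l])
    finally have "carleson_mass g (carleson_box t l) \<le> ennreal (C * l / (ln 2)\<^sup>2)"
      by (rule ennreal_mult_le_imp_le_divide) (use l2 C l0 in auto)
    also have "\<dots> \<le> ennreal (C' * l)"
      using l0 lp C by (intro ennreal_leI) (simp add: C'_def algebra_simps)
    finally show ?thesis .
  next
    case False
    have full: "is_arc_length (2 * pi)" by (simp add: is_arc_length_def)
    have "carleson_mass g (carleson_box t l) \<le> carleson_mass g (carleson_box (- pi) (2 * pi))"
      using carleson_box_subset_disc[OF l] unit_disc_subset_carleson_box by (intro carleson_mass_mono) blast
    also have "\<dots> \<le> ennreal (C * (2 * pi) / (ln (1 / pi))\<^sup>2)"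
      using box[OF full, of "- pi"] lp C by (intro ennreal_mult_le_imp_le_divide) simp_all
    also have "\<dots> \<le> ennreal (C' * l)"
    proof (rule ennreal_leI)
      have "C * (2 * pi) / (ln (1 / pi))\<^sup>2 \<le> C' * 1" using C l2 by (simp add: C'_def)
      also have "\<dots> \<le> C' * l" using False C' by (intro mult_left_mono) auto
      finally show "C * (2 * pi) / (ln (1 / pi))\<^sup>2 \<le> C' * l" .
    qed
    finally show ?thesis .
  qed
  with C' show ?thesis by blast
qed

lemma BMOA_log_iff_energy:
  assumes g: "g \<in> Hinf"
  shows "g \<in> BMOA_log \<longleftrightarrow> (\<exists>C\<ge>0. \<forall>a\<in>unit_disc. energy a g * ennreal ((log_weight a)\<^sup>2) \<le> ennreal C)"
proof
  have hol: "g holomorphic_on unit_disc" using g by (simp add: Hinf_def)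
  assume "g \<in> BMOA_log"
  then obtain C where C: "0 < C" and box: "\<And>t l. is_arc_length l \<Longrightarrow>
        carleson_mass g (carleson_box t l) * ennreal ((ln (2 / l))\<^sup>2) \<le> ennreal (C * l)"
    unfolding mem_BMOA_log_iff by blast
  obtain C' where C': "0 < C'" and box': "\<And>t l. is_arc_length l \<Longrightarrow> carleson_mass g (carleson_box t l) \<le> ennreal (C' * l)"
    using carleson_mass_box_of_BMOA_log[OF C box] by blast
  define K where "K = (\<Sum>k. (real k + 2)\<^sup>2 / 2 ^ k)"
  \<comment> \<open>From \<open>(x + y)^2 \<le> 2 * x^2 + 2 * y^2\<close> with
    \<open>y = 3 * (k + 1)\<close>: the constant \<open>C\<close> handles the logarithm of the arc,
    \<open>C'\<close> the remainder \<open>18 * (k + 1)^2\<close>, and \<open>2 * pi\<close> comes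
    from \<open>l \<le> 2 * pi * s\<close>.\<close>
  define B where "B = (2 * C + 18 * C') * (2 * pi)"
  have K: "0 \<le> K" unfolding K_def by (intro suminf_nonneg summable_dyadic) auto
  have B: "0 \<le> B" using C C' by (simp add: B_def)
  have "energy a g * ennreal ((log_weight a)\<^sup>2) \<le> ennreal (4 * K * B)" if a: "a \<in> unit_disc" for a
    unfolding K_def
  proof (rule energy_le_dyadic[OF a hol B])
    fix k
    define s where "s = 2 ^ k * (1 - cmod a)"
    define l where "l = 2 * pi * min 1 s"
    define S where "S = {z \<in> unit_disc. cmod (1 - cnj a * z) < s}"
    have s: "0 < s" using a by (simp add: s_def mem_unit_disc)
    have l: "is_arc_length l" using s by (auto simp: l_def is_arc_length_def min_def)
    then have l0: "0 < l" by (simp add: is_arc_length_def)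
    obtain t where t: "S \<subseteq> carleson_box t l"
      using disc_neighbourhood_subset_box[OF a s] unfolding S_def l_def by blast
    have m1: "carleson_mass g S \<le> ennreal (C' * l)"
      using order_trans[OF carleson_mass_mono[OF t] box'[OF l]] .
    have m2: "carleson_mass g S * ennreal ((ln (2 / l))\<^sup>2) \<le> ennreal (C * l)"
      using order_trans[OF mult_right_mono[OF carleson_mass_mono[OF t]] box[OF l]] by simp
    obtain m where m: "carleson_mass g S = ennreal m" "0 \<le> m"
      using m1 by (cases "carleson_mass g S") (auto simp: top_unique)
    have m1': "m \<le> C' * l" using m1 m C' l0 by simp
    have m2': "m * (ln (2 / l))\<^sup>2 \<le> C * l"
      using m2 m C l0 by (simp add: ennreal_mult''[symmetric])
    have "(log_weight a)\<^sup>2 \<le> (\<bar>ln (2 / l)\<bar> + 3 * (real k + 1))\<^sup>2"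
      using log_weight_dyadic_le[OF a, of k] log_weight_pos[OF a]
      by (intro power_mono) (simp_all add: l_def s_def)
    also have "\<dots> \<le> 2 * (ln (2 / l))\<^sup>2 + 18 * (real k + 1)\<^sup>2"
      using zero_le_power2[of "\<bar>ln (2 / l)\<bar> - 3 * (real k + 1)"] by (simp add: power2_eq_square algebra_simps)
    finally have "m * (log_weight a)\<^sup>2 \<le> m * (2 * (ln (2 / l))\<^sup>2 + 18 * (real k + 1)\<^sup>2)"
      using m by (intro mult_left_mono)
    also have "\<dots> = 2 * (m * (ln (2 / l))\<^sup>2) + 18 * (real k + 1)\<^sup>2 * m" by (simp add: algebra_simps)
    also have "\<dots> \<le> 2 * (C * l) + 18 * (real k + 1)\<^sup>2 * (C' * l)"
      using m1' m2' by (intro add_mono mult_left_mono) auto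
    also have "\<dots> \<le> (real k + 1)\<^sup>2 * (2 * (C * l)) + 18 * (real k + 1)\<^sup>2 * (C' * l)"
    proof -
      have "1 * (2 * (C * l)) \<le> (real k + 1)\<^sup>2 * (2 * (C * l))"
        using C l0 by (intro mult_right_mono) (auto intro!: one_le_power)
      then show ?thesis by simp
    qed
    also have "\<dots> = (2 * C + 18 * C') * (real k + 1)\<^sup>2 * l" by (simp add: algebra_simps)
    also have "\<dots> \<le> (2 * C + 18 * C') * (real k + 1)\<^sup>2 * (2 * pi * s)"
      using C C' by (intro mult_left_mono) (auto simp: l_def)
    also have "\<dots> = B * (real k + 1)\<^sup>2 * 2 ^ k * (1 - cmod a)" by (simp add: B_def s_def mult_ac)
    finally show "carleson_mass g {z \<in> unit_disc. cmod (1 - cnj a * z) < 2 ^ k * (1 - cmod a)} * ennreal ((log_weight a)\<^sup>2)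
        \<le> ennreal (B * (real k + 1)\<^sup>2 * 2 ^ k * (1 - cmod a))"
      unfolding s_def[symmetric] S_def[symmetric] m(1) using m by (subst ennreal_mult''[symmetric]) (auto intro: ennreal_leI simp: s_def)
  qed simp
  moreover have "0 \<le> 4 * K * B" using K B by simp
  ultimately show "\<exists>C\<ge>0. \<forall>a\<in>unit_disc. energy a g * ennreal ((log_weight a)\<^sup>2) \<le> ennreal C" by blast
next
  have hol: "g holomorphic_on unit_disc" using g by (simp add: Hinf_def)
  assume "\<exists>C\<ge>0. \<forall>a\<in>unit_disc. energy a g * ennreal ((log_weight a)\<^sup>2) \<le> ennreal C"
  then obtain C where C: "0 \<le> C"
    and E: "\<And>a. a \<in> unit_disc \<Longrightarrow> energy a g * ennreal ((log_weight a)\<^sup>2) \<le> ennreal C" by blast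
  have "carleson_mass g (carleson_box t l) * ennreal ((ln (2 / l))\<^sup>2) \<le> ennreal ((8 * pi * C + 1) * l)"
    if l: "is_arc_length l" for t l
  proof -
    have l0: "0 < l" "l \<le> 2 * pi" using l by (auto simp: is_arc_length_def)
    obtain a where a: "a \<in> unit_disc" and al: "1 - cmod a = l / (2 * pi)"
      and m: "carleson_mass g (carleson_box t l) \<le> ennreal (2 * pi * l) * energy a g"
      using carleson_mass_box_le_energy[OF l hol] by blast
    have "ln (2 / l) \<le> log_weight a"
      unfolding log_weight_def al using l0 pi_gt3 by (intro ln_mono) (auto simp: field_simps)
    \<comment> \<open>For arcs longer than 2 the logarithm is negative, but its modulus is at most
      \<open>ln pi < 2 * ln 2\<close>, which the lower bound of \<open>log_weight\<close>
      absorbs.\<close>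
    moreover have "- ln (2 / l) \<le> 2 * log_weight a"
    proof -
      have "- ln (2 / l) = ln (l / 2)" using l0 by (simp add: ln_div)
      also have "\<dots> \<le> ln (2 ^ 2)" using l0 pi_less_4 by (intro ln_mono) auto
      also have "\<dots> = 2 * ln 2" by (subst ln_realpow) auto
      finally show ?thesis using log_weight_ge[OF a] by linarith
    qed
    ultimately have "\<bar>ln (2 / l)\<bar> \<le> 2 * log_weight a" using log_weight_pos[OF a] by linarith
    then have "\<bar>ln (2 / l)\<bar>\<^sup>2 \<le> (2 * log_weight a)\<^sup>2" by (intro power_mono) auto
    then have "(ln (2 / l))\<^sup>2 \<le> 4 * (log_weight a)\<^sup>2" by (simp add: power_mult_distrib)
    then have "carleson_mass g (carleson_box t l) * ennreal ((ln (2 / l))\<^sup>2)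
        \<le> (ennreal (2 * pi * l) * energy a g) * ennreal (4 * (log_weight a)\<^sup>2)"
      by (intro mult_mono m ennreal_leI) auto
    also have "\<dots> = ennreal (2 * pi * l) * (4 * (energy a g * ennreal ((log_weight a)\<^sup>2)))"
      by (simp add: ennreal_mult' mult_ac)
    also have "\<dots> \<le> ennreal (2 * pi * l) * (4 * ennreal C)"
      by (intro mult_left_mono E a) auto
    also have "\<dots> = ennreal (8 * pi * l * C)"
    proof -
      have "8 * pi * l * C = 2 * pi * l * (4 * C)" by simp
      then have "ennreal (8 * pi * l * C) = ennreal (2 * pi * l * (4 * C))" by (simp only:)
      also have "\<dots> = ennreal (2 * pi * l) * ennreal (4 * C)" using l0 by (intro ennreal_mult') simp
      also have "ennreal (4 * C) = 4 * ennreal C" by (simp add: ennreal_mult')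
      finally show ?thesis by simp
    qed
    also have "\<dots> \<le> ennreal ((8 * pi * C + 1) * l)" using l0 by (intro ennreal_leI) (simp add: algebra_simps)
    finally show ?thesis .
  qed
  moreover have "0 < 8 * pi * C + 1" using C by (intro add_nonneg_pos) auto
  ultimately show "g \<in> BMOA_log" unfolding mem_BMOA_log_iff using g Hinf_subset_H1 by blast
qed

lemma BMOA_growth:
  assumes "f \<in> BMOA"
  shows "\<exists>K>0. \<forall>a\<in>unit_disc. cmod (f a) \<le> K * log_weight a"
proof -
  obtain C where f: "f holomorphic_on unit_disc" and C: "0 \<le> C" and E: "\<And>a. a \<in> unit_disc \<Longrightarrow> energy a f \<le> ennreal C"
    using assms unfolding BMOA_iff_energy by blast
  \<comment> \<open>The value at 0 is absorbed through \<open>ln 2 \<le> log_weight a\<close>; the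
    last summand makes \<open>K\<close> positive.\<close>
  define K where "K = cmod (f 0) / ln 2 + sqrt (2 * C) + 1"
  have l2: "0 < ln (2::real)" by simp
  have "cmod (f a) \<le> K * log_weight a" if a: "a \<in> unit_disc" for a
  proof -
    have "cmod (f a) \<le> cmod (f 0) + sqrt (2 * C) * ln (1 / (1 - cmod a))"
      using C by (intro growth_from_deriv_bound[OF f _ _ a] deriv_le_energy[OF _ f E]) auto
    also have "\<dots> \<le> cmod (f 0) / ln 2 * log_weight a + sqrt (2 * C) * log_weight a"
    proof (intro add_mono mult_left_mono ln_le_log_weight a)
      have "cmod (f 0) / ln 2 * ln 2 \<le> cmod (f 0) / ln 2 * log_weight a"
        using log_weight_ge[OF a] l2 by (intro mult_left_mono) auto
      then show "cmod (f 0) \<le> cmod (f 0) / ln 2 * log_weight a" using l2 by simp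
    qed (use C in auto)
    also have "\<dots> \<le> K * log_weight a" using log_weight_pos[OF a] by (simp add: K_def algebra_simps)
    finally show ?thesis .
  qed
  moreover have "0 < K" unfolding K_def using l2 C by (intro add_nonneg_pos add_nonneg_nonneg) auto
  ultimately show ?thesis by blast
qed

lemma Hinf_bound:
  assumes "g \<in> Hinf"
  obtains M where "\<And>z. z \<in> unit_disc \<Longrightarrow> cmod (g z) \<le> M"
  using assms unfolding Hinf_def bounded_iff by auto

lemma BMOA_log_Hinf_subset_multipliers: "BMOA_log \<inter> Hinf \<subseteq> multipliers BMOA BMOA"
proof
  fix g assume g: "g \<in> BMOA_log \<inter> Hinf"
  then have hol: "g holomorphic_on unit_disc" by (simp add: Hinf_def)
  obtain M where M: "\<And>z. z \<in> unit_disc \<Longrightarrow> cmod (g z) \<le> M" using g Hinf_bound by blast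
  obtain C where C: "0 \<le> C" and E: "\<And>a. a \<in> unit_disc \<Longrightarrow> energy a g * ennreal ((log_weight a)\<^sup>2) \<le> ennreal C"
    using g BMOA_log_iff_energy[of g] by auto
  have "(\<lambda>z. f z * g z) \<in> BMOA" if fB: "f \<in> BMOA" for f
  proof -
    obtain C1 where f: "f holomorphic_on unit_disc" and C1: "0 \<le> C1" and E1: "\<And>a. a \<in> unit_disc \<Longrightarrow> energy a f \<le> ennreal C1"
      using fB unfolding BMOA_iff_energy by blast
    obtain K where K: "0 < K" "\<And>a. a \<in> unit_disc \<Longrightarrow> cmod (f a) \<le> K * log_weight a"
      using BMOA_growth[OF fB] by blast
    have "energy a (\<lambda>z. f z * g z) \<le> ennreal (4 * M\<^sup>2 * C1 + 2 * (K\<^sup>2 * C))" if a: "a \<in> unit_disc" for a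
    proof -
      have "energy a (\<lambda>z. f z * g z) \<le> ennreal (4 * M\<^sup>2) * energy a f + 2 * (ennreal ((cmod (f a))\<^sup>2) * energy a g)"
        by (rule energy_mult_le[OF a f hol M])
      also have "\<dots> \<le> ennreal (4 * M\<^sup>2) * ennreal C1 + 2 * (ennreal (K\<^sup>2) * ennreal C)"
      proof (intro add_mono mult_left_mono E1 a)
        have "(cmod (f a))\<^sup>2 \<le> (K * log_weight a)\<^sup>2" using K(2)[OF a] by (intro power_mono) auto
        then have "ennreal ((cmod (f a))\<^sup>2) * energy a g \<le> ennreal (K\<^sup>2 * (log_weight a)\<^sup>2) * energy a g"
          by (intro mult_right_mono ennreal_leI) (simp_all add: power_mult_distrib)
        also have "\<dots> = ennreal (K\<^sup>2) * (energy a g * ennreal ((log_weight a)\<^sup>2))"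
          by (simp add: ennreal_mult' mult_ac)
        also have "\<dots> \<le> ennreal (K\<^sup>2) * ennreal C" by (intro mult_left_mono E a) simp
        finally show "ennreal ((cmod (f a))\<^sup>2) * energy a g \<le> ennreal (K\<^sup>2) * ennreal C" .
      qed auto
      also have "\<dots> = ennreal (4 * M\<^sup>2 * C1 + 2 * (K\<^sup>2 * C))"
        using C C1 by (simp add: ennreal_mult' ennreal_plus)
      finally show ?thesis .
    qed
    moreover have "(\<lambda>z. f z * g z) holomorphic_on unit_disc" using f hol by (intro holomorphic_intros)
    moreover have "0 \<le> 4 * M\<^sup>2 * C1 + 2 * (K\<^sup>2 * C)" using C C1 by simp
    ultimately show ?thesis unfolding BMOA_iff_energy by blast
  qed
  then show "g \<in> multipliers BMOA BMOA" using hol by (simp add: multipliers_def)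
qed

section \<open>Superpositions of logarithms\<close>

lemma norm_one_minus_cnj_mult_unimodular:
  assumes "cmod \<zeta> = 1"
  shows "cmod (1 - cnj \<zeta> * z) = cmod (z - \<zeta>)"
proof -
  have "\<zeta> * (1 - cnj \<zeta> * z) = \<zeta> - (\<zeta> * cnj \<zeta>) * z" by (simp add: algebra_simps)
  also have "\<zeta> * cnj \<zeta> = 1" using assms by (simp add: complex_norm_square[symmetric])
  finally have "cmod \<zeta> * cmod (1 - cnj \<zeta> * z) = cmod (\<zeta> - z)"
    by (metis mult_1 norm_mult)
  then show ?thesis using assms by (simp add: norm_minus_commute)
qed

lemma one_minus_norm_le_norm_diff:
  assumes "cmod \<zeta> = 1"
  shows "1 - cmod z \<le> cmod (z - \<zeta>)"
  using assms norm_triangle_ineq2[of \<zeta> z] by (simp add: norm_minus_commute)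

lemma suminf_half_powers: "(\<Sum>n. (1/2::real) ^ Suc n) = 1"
  using power_half_series sums_unique by metis

text \<open>Cauchy-Schwarz for weights of total mass at most 1, each weight being split into two
  square roots. It replaces the square of a superposition by a superposition of squares, which can
  be integrated term by term.\<close>

lemma power2_norm_weighted_sum_le:
  fixes c :: "nat \<Rightarrow> complex"
  shows "(cmod (\<Sum>n<N. (1/2) ^ Suc n * c n))\<^sup>2 \<le> (\<Sum>n<N. (1/2) ^ Suc n * (cmod (c n))\<^sup>2)"
proof -
  have p1: "(\<Sum>n<N. (1/2::real) ^ Suc n) \<le> 1"
    using sum_le_suminf[OF sums_summable[OF power_half_series], of "{..<N}"] suminf_half_powers by simp
  have "cmod (\<Sum>n<N. (1/2) ^ Suc n * c n) \<le> (\<Sum>n<N. (1/2) ^ Suc n * cmod (c n))"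
    by (rule order_trans[OF norm_sum]) (simp add: norm_mult norm_power norm_divide)
  then have "(cmod (\<Sum>n<N. (1/2) ^ Suc n * c n))\<^sup>2 \<le> (\<Sum>n<N. (1/2) ^ Suc n * cmod (c n))\<^sup>2"
    by (intro power_mono) auto
  also have "\<dots> = (\<Sum>n<N. sqrt ((1/2) ^ Suc n) * (sqrt ((1/2) ^ Suc n) * cmod (c n)))\<^sup>2"
    by (simp only: mult.assoc[symmetric] real_sqrt_mult_self) simp
  also have "\<dots> \<le> (\<Sum>n<N. (sqrt ((1/2) ^ Suc n))\<^sup>2) * (\<Sum>n<N. (sqrt ((1/2) ^ Suc n) * cmod (c n))\<^sup>2)"
    by (rule Cauchy_Schwarz_ineq_sum)
  also have "\<dots> = (\<Sum>n<N. (1/2) ^ Suc n) * (\<Sum>n<N. (1/2) ^ Suc n * (cmod (c n))\<^sup>2)"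
    by (simp add: power_mult_distrib del: power_Suc)
  also have "\<dots> \<le> (\<Sum>n<N. (1/2) ^ Suc n * (cmod (c n))\<^sup>2)"
    using p1 by (intro mult_left_le_one_le sum_nonneg) auto
  finally show ?thesis .
qed

text \<open>A superposition of logarithms with nonnegative real parts that is as large as BMOA permits,
  up to the factor \<open>2\<^bsup>-(n+1)\<^esup>\<close>, on the radius towards every \<open>\<zeta> n\<close>.\<close>
lemma log_superposition_exists:
  fixes \<zeta> :: "nat \<Rightarrow> complex"
  assumes \<zeta>: "\<And>n. cmod (\<zeta> n) = 1"
  obtains g where "g holomorphic_on unit_disc"
    and "\<And>z. z \<in> unit_disc \<Longrightarrow>
      ennreal ((cmod (deriv g z))\<^sup>2) \<le> (\<Sum>n. ennreal ((1/2) ^ Suc n / (cmod (z - \<zeta> n))\<^sup>2))"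
    and "\<And>n r. 0 \<le> r \<Longrightarrow> r < 1 \<Longrightarrow> (1/2) ^ Suc n * ln (2 / (1 - r)) \<le> cmod (g (of_real r * \<zeta> n))"
proof -
  \<comment> \<open>This is \<open>log (2 / (1 - cnj (\<zeta> n) * z))\<close>, scaled. The
    numerator 2 matches \<open>log_weight\<close> and makes every real part nonnegative, since the
    denominator has modulus at most 2 in the disc.\<close>
  define f where "f n z = (1/2) ^ Suc n * (of_real (ln 2) - Ln (1 - cnj (\<zeta> n) * z))" for n z
  define f' where "f' n z = (1/2) ^ Suc n * (cnj (\<zeta> n) / (1 - cnj (\<zeta> n) * z))" for n z
  have lt1: "cmod (cnj (\<zeta> n) * z) < 1" if "z \<in> unit_disc" for n z
    using that \<zeta>[of n] by (simp add: norm_mult mem_unit_disc)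
  have Re_pos: "0 < Re (1 - cnj (\<zeta> n) * z)" if "z \<in> unit_disc" for n z
    using lt1[OF that, of n] abs_Re_le_cmod[of "cnj (\<zeta> n) * z"] by simp
  have nonpos: "1 - cnj (\<zeta> n) * z \<notin> \<real>\<^sub>\<le>\<^sub>0" if "z \<in> unit_disc" for n z
    using Re_pos[OF that, of n] by (auto simp: complex_nonpos_Reals_iff)
  have der: "(f n has_field_derivative f' n z) (at z)" if "z \<in> unit_disc" for n z
    unfolding f_def f'_def using nonpos[OF that, of n]
    by (auto intro!: derivative_eq_intros simp: divide_simps)
  have loc: "\<exists>d h. 0 < d \<and> summable h \<and> (\<forall>\<^sub>F n in sequentially. \<forall>y\<in>ball x d \<inter> unit_disc. norm (f n y) \<le> h n)"
    if x: "x \<in> unit_disc" for x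
  proof -
    define \<rho> where "\<rho> = (1 + cmod x) / 2"
    have \<rho>: "cmod x < \<rho>" "\<rho> < 1" using x by (auto simp: \<rho>_def mem_unit_disc)
    \<comment> \<open>As \<open>|cnj (\<zeta> n) * y| = |y|\<close>, the bound for a single function
      on one compact disc serves all \<open>n\<close> at once.\<close>
    have "continuous_on (cball 0 \<rho>) (\<lambda>u. of_real (ln 2) - Ln (1 - u))"
    proof (intro continuous_intros)
      fix u :: complex assume "u \<in> cball 0 \<rho>"
      then have "Re u < 1" using \<rho> complex_Re_le_cmod[of u] by simp
      then show "1 - u \<notin> \<real>\<^sub>\<le>\<^sub>0" by (auto simp: complex_nonpos_Reals_iff)
    qed
    then have "bounded ((\<lambda>u. of_real (ln 2) - Ln (1 - u)) ` cball 0 \<rho>)"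
      by (intro compact_imp_bounded compact_continuous_image compact_cball)
    then obtain K where "\<forall>v\<in>(\<lambda>u. of_real (ln 2) - Ln (1 - u)) ` cball 0 \<rho>. cmod v \<le> K"
      unfolding bounded_iff by blast
    then have K: "cmod (of_real (ln 2) - Ln (1 - u)) \<le> K" if "cmod u \<le> \<rho>" for u
      using that by auto
    have "norm (f n y) \<le> (1/2) ^ Suc n * K" if "y \<in> ball x (\<rho> - cmod x)" for n y
    proof -
      have "cmod y \<le> cmod x + cmod (y - x)" using norm_triangle_ineq[of x "y - x"] by simp
      then have "cmod (cnj (\<zeta> n) * y) \<le> \<rho>" using that \<zeta>[of n] by (simp add: norm_mult dist_norm norm_minus_commute)
      from K[OF this] show ?thesis
        unfolding f_def norm_mult by (intro mult_mono) (auto simp: norm_power norm_mult norm_divide)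
    qed
    moreover have "summable (\<lambda>n. (1/2) ^ Suc n * K)"
      using sums_summable[OF power_half_series] by (rule summable_mult2)
    ultimately show ?thesis using \<rho>
      by (intro exI[of _ "\<rho> - cmod x"] exI[of _ "\<lambda>n. (1/2) ^ Suc n * K"]) auto
  qed
  obtain g g' where g: "\<And>z. z \<in> unit_disc \<Longrightarrow> (\<lambda>n. f n z) sums g z"
    and g': "\<And>z. z \<in> unit_disc \<Longrightarrow> (\<lambda>n. f' n z) sums g' z"
    and gd: "\<And>z. z \<in> unit_disc \<Longrightarrow> (g has_field_derivative g' z) (at z)"
    using series_and_derivative_comparison_local[OF open_unit_disc der loc] by blast
  show thesis
  proof
    show "g holomorphic_on unit_disc"
      using gd by (auto simp: holomorphic_on_open)
  next
    fix z assume z: "z \<in> unit_disc"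
    have dg: "deriv g z = g' z" using gd[OF z] by (rule DERIV_imp_deriv)
    have "(\<lambda>N. \<Sum>n<N. f' n z) \<longlonglongrightarrow> g' z" using g'[OF z] by (simp add: sums_def)
    then have lim: "(\<lambda>N. ennreal ((cmod (\<Sum>n<N. f' n z))\<^sup>2)) \<longlonglongrightarrow> ennreal ((cmod (g' z))\<^sup>2)"
      by (intro tendsto_ennrealI tendsto_intros)
    have "ennreal ((cmod (\<Sum>n<N. f' n z))\<^sup>2) \<le> (\<Sum>n. ennreal ((1/2) ^ Suc n / (cmod (z - \<zeta> n))\<^sup>2))" for N
    proof -
      have "(cmod (\<Sum>n<N. f' n z))\<^sup>2 \<le> (\<Sum>n<N. (1/2) ^ Suc n * (cmod (cnj (\<zeta> n) / (1 - cnj (\<zeta> n) * z)))\<^sup>2)"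
        unfolding f'_def by (rule power2_norm_weighted_sum_le)
      also have "\<dots> = (\<Sum>n<N. (1/2) ^ Suc n / (cmod (z - \<zeta> n))\<^sup>2)"
        using \<zeta> by (simp add: norm_divide power_divide norm_one_minus_cnj_mult_unimodular)
      finally have "ennreal ((cmod (\<Sum>n<N. f' n z))\<^sup>2) \<le> ennreal (\<Sum>n<N. (1/2) ^ Suc n / (cmod (z - \<zeta> n))\<^sup>2)"
        by (rule ennreal_leI)
      also have "\<dots> = (\<Sum>n<N. ennreal ((1/2) ^ Suc n / (cmod (z - \<zeta> n))\<^sup>2))"
        by (intro sum_ennreal[symmetric]) auto
      also have "\<dots> \<le> (\<Sum>n. ennreal ((1/2) ^ Suc n / (cmod (z - \<zeta> n))\<^sup>2))"
        by (intro sum_le_suminf) auto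
      finally show ?thesis .
    qed
    then show "ennreal ((cmod (deriv g z))\<^sup>2) \<le> (\<Sum>n. ennreal ((1/2) ^ Suc n / (cmod (z - \<zeta> n))\<^sup>2))"
      unfolding dg by (intro LIMSEQ_le_const2[OF lim]) auto
  next
    fix n :: nat and r :: real assume r: "0 \<le> r" "r < 1"
    define z where "z = of_real r * \<zeta> n"
    have z: "z \<in> unit_disc" using r \<zeta>[of n] by (simp add: z_def mem_unit_disc norm_mult)
    have Re_f: "Re (f k z) = (1/2) ^ Suc k * (ln 2 - ln (cmod (1 - cnj (\<zeta> k) * z)))" for k
    proof -
      have "1 - cnj (\<zeta> k) * z \<noteq> 0" using Re_pos[OF z, of k] by (metis less_irrefl zero_complex.sel(1))
      then have "Re (of_real (ln 2) - Ln (1 - cnj (\<zeta> k) * z)) = ln 2 - ln (cmod (1 - cnj (\<zeta> k) * z))"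
        using Re_Ln[of "1 - cnj (\<zeta> k) * z"] by (simp only: minus_complex.sel Re_complex_of_real not_False_eq_True simp_thms)
      moreover have "f k z = ((1/2) ^ Suc k) *\<^sub>R (of_real (ln 2) - Ln (1 - cnj (\<zeta> k) * z))"
        by (simp add: f_def scaleR_conv_of_real)
      ultimately show ?thesis by (simp only: scaleR_complex.sel)
    qed
    have Re_nn: "0 \<le> Re (f k z)" for k
    proof -
      have "cmod (1 - cnj (\<zeta> k) * z) \<le> 2"
        using norm_triangle_ineq4[of 1 "cnj (\<zeta> k) * z"] lt1[OF z, of k] by simp
      moreover have "0 < cmod (1 - cnj (\<zeta> k) * z)"
        using Re_pos[OF z, of k] complex_Re_le_cmod by (rule less_le_trans)
      ultimately have "ln (cmod (1 - cnj (\<zeta> k) * z)) \<le> ln 2" by (intro ln_mono) auto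
      then show ?thesis unfolding Re_f by simp
    qed
    have "(\<lambda>k. Re (f k z)) sums Re (g z)" using g[OF z] by (rule sums_Re)
    \<comment> \<open>Nonnegative real parts exclude cancellation, so the sum dominates its
      \<open>n\<close>-th term, whose argument is real on the radius towards
      \<open>\<zeta> n\<close>.\<close>
    then have "Re (f n z) \<le> Re (g z)"
      using sum_le_suminf[of "\<lambda>k. Re (f k z)" "{n}"] Re_nn by (simp add: sums_iff)
    moreover have "1 - cnj (\<zeta> n) * z = of_real (1 - r)"
    proof -
      have "cnj (\<zeta> n) * z = of_real r * (\<zeta> n * cnj (\<zeta> n))" by (simp add: z_def mult_ac)
      also have "\<zeta> n * cnj (\<zeta> n) = 1" using \<zeta>[of n] by (simp add: complex_norm_square[symmetric])
      finally show ?thesis by simp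
    qed
    then have "Re (f n z) = (1/2) ^ Suc n * ln (2 / (1 - r))"
      unfolding Re_f using r by (simp add: ln_div del: of_real_diff)
    ultimately show "(1/2) ^ Suc n * ln (2 / (1 - r)) \<le> cmod (g (of_real r * \<zeta> n))"
      using complex_Re_le_cmod[of "g z"] by (simp add: z_def)
  qed
qed

section \<open>Integrals of boundary singularities and membership of superpositions\<close>

lemma dA_int_translate:
  assumes [measurable]: "h \<in> borel_measurable borel"
  shows "dA_int (ball c \<rho>) (\<lambda>z. h (z - c)) = dA_int (ball 0 \<rho>) h"
proof -
  have [measurable]: "ball (0::complex) \<rho> \<in> sets borel" by simp
  have "dA_int (ball c \<rho>) (\<lambda>z. h (z - c)) = (\<integral>\<^sup>+z. ennreal (h (z - c) / pi) * indicator (ball 0 \<rho>) (z - c) \<partial>lborel)"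
    unfolding dA_int_def by (intro nn_integral_cong) (auto simp: indicator_def dist_norm norm_minus_commute)
  also have "\<dots> = (\<integral>\<^sup>+z. ennreal (h z / pi) * indicator (ball 0 \<rho>) z \<partial>distr lborel borel (\<lambda>z. - c + z))"
    by (subst nn_integral_distr) (auto simp: add.commute)
  also have "\<dots> = dA_int (ball 0 \<rho>) h"
    unfolding dA_int_def lborel_distr_plus ..
  finally show ?thesis .
qed

text \<open>The exponent is what remains of \<open>|z - \<zeta>|^-2\<close> when half a power is
  gained from the weight. It is locally integrable in the plane: in the variable
  \<open>s = |z - c|^2\<close> it becomes \<open>s^(-3/4)\<close>.\<close>

lemma dA_int_ball_powr:
  assumes \<rho>: "0 < \<rho>"
  shows "dA_int (ball c \<rho>) (\<lambda>z. cmod (z - c) powr (- 3 / 2)) = ennreal (4 * sqrt \<rho>)"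
proof -
  have e: "cmod z powr (- 3 / 2) = ((cmod z)\<^sup>2) powr (- 3 / 4)" for z :: complex
    by (cases "z = 0") (simp_all add: powr_powr flip: powr_numeral)
  have "dA_int (ball c \<rho>) (\<lambda>z. cmod (z - c) powr (- 3 / 2)) = dA_int (ball 0 \<rho>) (\<lambda>z. cmod z powr (- 3 / 2))"
    by (rule dA_int_translate[of "\<lambda>z. cmod z powr (- 3 / 2)"]) simp
  also have "\<dots> = (\<integral>\<^sup>+s. ennreal (s powr (- 3 / 4)) * indicator {0<..<\<rho>\<^sup>2} s \<partial>lborel)"
    unfolding e by (rule dA_int_radial[of "\<lambda>s. s powr (- 3 / 4)", OF _ \<rho>]) simp
  also have "\<dots> = ennreal ((\<rho>\<^sup>2) powr (1 / 4) / (1 / 4))"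
    using nn_integral_powr_Ioo[of "\<rho>\<^sup>2" "- 3 / 4"] \<rho> by simp
  also have "(\<rho>\<^sup>2) powr (1 / 4) = sqrt \<rho>"
    using \<rho> by (simp add: powr_powr powr_half_sqrt[symmetric] flip: powr_numeral)
  finally show ?thesis by (simp add: mult.commute)
qed

lemma dA_int_const_ball:
  assumes "0 \<le> k" "0 \<le> \<rho>"
  shows "dA_int (ball c \<rho>) (\<lambda>_. k) = ennreal (k * \<rho>\<^sup>2)"
proof -
  have "dA_int (ball c \<rho>) (\<lambda>_. k) = ennreal (k / pi) * ennreal (pi * \<rho>\<^sup>2)"
    unfolding dA_int_def using assms by (simp add: nn_integral_cmult_indicator emeasure_lborel_disc)
  also have "\<dots> = ennreal (k * \<rho>\<^sup>2)" using assms by (subst ennreal_mult'[symmetric]) simp_all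
  finally show ?thesis .
qed

text \<open>The singularity may lie outside the ball, so the integral is split at distance \<open>\<rho>\<close> from \<open>\<zeta>\<close>.\<close>
lemma dA_int_ball_singularity_le:
  assumes \<rho>: "0 < \<rho>"
  shows "dA_int (ball c \<rho>) (\<lambda>z. cmod (z - \<zeta>) powr (- 3 / 2)) \<le> ennreal (5 * sqrt \<rho>)"
proof -
  let ?u = "\<lambda>z. ennreal (cmod (z - \<zeta>) powr (- 3 / 2) / pi)"
  have "dA_int (ball c \<rho>) (\<lambda>z. cmod (z - \<zeta>) powr (- 3 / 2))
     \<le> (\<integral>\<^sup>+z. ?u z * indicator (ball \<zeta> \<rho>) z + ennreal (\<rho> powr (- 3 / 2) / pi) * indicator (ball c \<rho>) z \<partial>lborel)"
    unfolding dA_int_def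
  proof (rule nn_integral_mono)
    fix z
    show "?u z * indicator (ball c \<rho>) z
       \<le> ?u z * indicator (ball \<zeta> \<rho>) z + ennreal (\<rho> powr (- 3 / 2) / pi) * indicator (ball c \<rho>) z"
    proof (cases "z \<in> ball \<zeta> \<rho>")
      case False
      then have "\<rho> \<le> cmod (z - \<zeta>)" by (simp add: dist_norm norm_minus_commute)
      then have "cmod (z - \<zeta>) powr (- 3 / 2) \<le> \<rho> powr (- 3 / 2)" using \<rho> by (intro powr_mono2') auto
      then show ?thesis using False by (auto simp: indicator_def intro!: ennreal_leI divide_right_mono)
    qed (auto simp: indicator_def)
  qed
  also have "\<dots> = dA_int (ball \<zeta> \<rho>) (\<lambda>z. cmod (z - \<zeta>) powr (- 3 / 2)) + dA_int (ball c \<rho>) (\<lambda>_. \<rho> powr (- 3 / 2))"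
  proof -
    have [measurable]: "ball \<zeta> \<rho> \<in> sets borel" "ball c \<rho> \<in> sets borel" by auto
    show ?thesis unfolding dA_int_def by (intro nn_integral_add) simp_all
  qed
  also have "\<dots> = ennreal (4 * sqrt \<rho>) + ennreal (sqrt \<rho>)"
  proof -
    have "\<rho> powr (- 3 / 2) * \<rho>\<^sup>2 = sqrt \<rho>"
      using \<rho> by (simp add: powr_half_sqrt[symmetric] powr_add[symmetric] flip: powr_numeral)
    then show ?thesis unfolding dA_int_ball_powr[OF \<rho>] using \<rho> by (subst dA_int_const_ball) simp_all
  qed
  also have "\<dots> = ennreal (5 * sqrt \<rho>)" using \<rho> by (simp flip: ennreal_plus)
  finally show ?thesis .
qed

text \<open>Since \<open>1 - |z| \<le> |z - \<zeta> n|\<close>, the weight lowers each singularity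
  to order \<open>3/2\<close>. Its integral over a ball is bounded independently of
  \<open>\<zeta> n\<close>, and the coefficients sum to 1. The same estimate serves BMOA, on balls
  of radius \<open>l\<close>, and \<open>Dp p\<close>, on the whole disc.\<close>

lemma sqrt_weighted_energy_le:
  fixes \<zeta> :: "nat \<Rightarrow> complex"
  assumes \<zeta>: "\<And>n. cmod (\<zeta> n) = 1" and \<rho>: "0 < \<rho>" and S: "S \<subseteq> ball c \<rho>" "S \<subseteq> unit_disc"
    and g: "\<And>z. z \<in> unit_disc \<Longrightarrow>
      ennreal ((cmod (deriv g z))\<^sup>2) \<le> (\<Sum>n. ennreal ((1/2) ^ Suc n / (cmod (z - \<zeta> n))\<^sup>2))"
  shows "dA_int S (\<lambda>z. sqrt (1 - cmod z) * (cmod (deriv g z))\<^sup>2) \<le> ennreal (5 * sqrt \<rho>)"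
proof -
  let ?v = "\<lambda>n z. ennreal ((1/2) ^ Suc n) * (ennreal (cmod (z - \<zeta> n) powr (- 3 / 2) / pi) * indicator (ball c \<rho>) z)"
  have pw: "ennreal (sqrt (1 - cmod z) * (cmod (deriv g z))\<^sup>2 / pi) * indicator S z \<le> (\<Sum>n. ?v n z)" for z
  proof (cases "z \<in> S")
    case True
    then have z: "z \<in> unit_disc" "z \<in> ball c \<rho>" using S by auto
    define t where "t = 1 - cmod z"
    have t: "0 < t" using z by (simp add: t_def mem_unit_disc)
    have "ennreal (sqrt t * (cmod (deriv g z))\<^sup>2 / pi) = ennreal (sqrt t / pi) * ennreal ((cmod (deriv g z))\<^sup>2)"
      using t by (subst ennreal_mult'[symmetric]) simp_all
    also have "\<dots> \<le> ennreal (sqrt t / pi) * (\<Sum>n. ennreal ((1/2) ^ Suc n / (cmod (z - \<zeta> n))\<^sup>2))"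
      by (intro mult_left_mono g z) simp
    also have "\<dots> = (\<Sum>n. ennreal (sqrt t / pi) * ennreal ((1/2) ^ Suc n / (cmod (z - \<zeta> n))\<^sup>2))"
      by simp
    also have "\<dots> \<le> (\<Sum>n. ?v n z)"
    proof (intro suminf_le summableI)
      fix n
      define x where "x = cmod (z - \<zeta> n)"
      have x: "t \<le> x" unfolding x_def t_def by (rule one_minus_norm_le_norm_diff[OF \<zeta>])
      then have x0: "0 < x" using t by simp
      have "sqrt t / x\<^sup>2 \<le> sqrt x / x\<^sup>2" using x by (intro divide_right_mono) auto
      also have "\<dots> = x powr (- 3 / 2)"
        using x0 by (simp add: powr_half_sqrt[symmetric] powr_diff[symmetric] flip: powr_numeral)
      finally have "sqrt t / x\<^sup>2 * ((1/2) ^ Suc n / pi) \<le> x powr (- 3 / 2) * ((1/2) ^ Suc n / pi)"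
        by (rule mult_right_mono) simp
      then have le: "sqrt t / pi * ((1/2) ^ Suc n / x\<^sup>2) \<le> (1/2) ^ Suc n * (x powr (- 3 / 2) / pi)"
        by (simp add: mult_ac)
      have "ennreal (sqrt t / pi) * ennreal ((1/2) ^ Suc n / x\<^sup>2) = ennreal (sqrt t / pi * ((1/2) ^ Suc n / x\<^sup>2))"
        using t by (intro ennreal_mult'[symmetric]) simp
      also have "\<dots> \<le> ennreal ((1/2) ^ Suc n * (x powr (- 3 / 2) / pi))" by (rule ennreal_leI[OF le])
      also have "\<dots> = ennreal ((1/2) ^ Suc n) * ennreal (x powr (- 3 / 2) / pi)" by (intro ennreal_mult') simp
      finally show "ennreal (sqrt t / pi) * ennreal ((1/2) ^ Suc n / (cmod (z - \<zeta> n))\<^sup>2) \<le> ?v n z"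
        using z by (simp add: x_def)
    qed
    finally show ?thesis using True by (simp add: t_def)
  qed simp
  have [measurable]: "ball c \<rho> \<in> sets borel" by simp
  have "dA_int S (\<lambda>z. sqrt (1 - cmod z) * (cmod (deriv g z))\<^sup>2) \<le> (\<integral>\<^sup>+z. (\<Sum>n. ?v n z) \<partial>lborel)"
    unfolding dA_int_def by (intro nn_integral_mono pw)
  also have "\<dots> = (\<Sum>n. \<integral>\<^sup>+z. ?v n z \<partial>lborel)"
    by (intro nn_integral_suminf) simp
  also have "\<dots> = (\<Sum>n. ennreal ((1/2) ^ Suc n) * dA_int (ball c \<rho>) (\<lambda>z. cmod (z - \<zeta> n) powr (- 3 / 2)))"
    unfolding dA_int_def by (subst nn_integral_cmult) simp_all
  also have "\<dots> \<le> (\<Sum>n. ennreal ((1/2) ^ Suc n) * ennreal (5 * sqrt \<rho>))"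
    by (intro suminf_le summableI mult_left_mono dA_int_ball_singularity_le \<rho>) simp
  also have "\<dots> = (\<Sum>n. ennreal ((1/2) ^ Suc n)) * ennreal (5 * sqrt \<rho>)" by simp
  also have "(\<Sum>n. ennreal ((1/2) ^ Suc n)) = 1"
  proof -
    have "(\<Sum>n. ennreal ((1/2) ^ Suc n)) = ennreal (\<Sum>n. (1/2) ^ Suc n)"
      by (rule suminf_ennreal2) (simp, rule sums_summable[OF power_half_series])
    then show ?thesis unfolding suminf_half_powers by simp
  qed
  finally show ?thesis by simp
qed

text \<open>Every point of the circle is at distance at least \<open>1 - |z|\<close> from
  \<open>z\<close>, and the weights sum to 1. This Bloch bound allows powers of the derivative above
  2 to be reduced to the square.\<close>

lemma deriv_bound_of_superposition:
  fixes \<zeta> :: "nat \<Rightarrow> complex"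
  assumes \<zeta>: "\<And>n. cmod (\<zeta> n) = 1" and z: "z \<in> unit_disc"
    and g: "ennreal ((cmod d)\<^sup>2) \<le> (\<Sum>n. ennreal ((1/2) ^ Suc n / (cmod (z - \<zeta> n))\<^sup>2))"
  shows "(1 - cmod z) * cmod d \<le> 1"
proof -
  define t where "t = 1 - cmod z"
  have t: "0 < t" using z by (simp add: t_def mem_unit_disc)
  have sm: "summable (\<lambda>n. (1/2) ^ Suc n / t\<^sup>2)"
    by (rule summable_divide[OF sums_summable[OF power_half_series]])
  have "(\<Sum>n. ennreal ((1/2) ^ Suc n / (cmod (z - \<zeta> n))\<^sup>2)) \<le> (\<Sum>n. ennreal ((1/2) ^ Suc n / t\<^sup>2))"
    using t one_minus_norm_le_norm_diff[OF \<zeta>]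
    by (intro suminf_le summableI ennreal_leI frac_le power_mono) (auto simp: t_def)
  also have "\<dots> = ennreal (\<Sum>n. (1/2) ^ Suc n / t\<^sup>2)"
    by (rule suminf_ennreal2[OF _ sm]) simp
  also have "(\<Sum>n. (1/2) ^ Suc n / t\<^sup>2) = 1 / t\<^sup>2"
    using suminf_divide[OF sums_summable[OF power_half_series], of "t\<^sup>2"] suminf_half_powers by metis
  finally have "ennreal ((cmod d)\<^sup>2) \<le> ennreal (1 / t\<^sup>2)" using g by (rule order_trans[rotated])
  then have "(cmod d)\<^sup>2 \<le> 1 / t\<^sup>2" by simp
  then have "(t * cmod d)\<^sup>2 \<le> 1" using t by (simp add: power_mult_distrib field_simps)
  then have "t * cmod d \<le> 1" using t by (simp add: power_le_one_iff abs_square_le_1)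
  then show ?thesis by (simp add: t_def)
qed

lemma carleson_box_subset_ball:
  assumes l: "is_arc_length l"
  shows "carleson_box t l \<subseteq> ball (cis (t + l / 2)) l"
proof
  fix z assume "z \<in> carleson_box t l"
  then obtain r \<theta> where z: "z = of_real r * cis \<theta>" and \<theta>: "t \<le> \<theta>" "\<theta> \<le> t + l"
    and r: "1 - l / (2 * pi) \<le> r" "r < 1"
    by (auto simp: carleson_box_def)
  have l0: "0 < l" using l by (simp add: is_arc_length_def)
  define \<psi> where "\<psi> = \<theta> - (t + l / 2)"
  have \<psi>: "\<bar>\<psi>\<bar> \<le> l / 2" using \<theta> by (auto simp: \<psi>_def abs_le_iff field_simps)
  have "z - cis (t + l / 2) = of_real (r - 1) * cis \<theta> + cis (t + l / 2) * (cis \<psi> - 1)"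
    by (simp add: z \<psi>_def cis_mult algebra_simps)
  then have "cmod (z - cis (t + l / 2)) \<le> cmod (of_real (r - 1) * cis \<theta>) + cmod (cis (t + l / 2) * (cis \<psi> - 1))"
    by (metis norm_triangle_ineq)
  also have "cmod (of_real (r - 1) * cis \<theta>) = 1 - r" using r by (simp add: norm_mult del: of_real_diff)
  also have "cmod (cis (t + l / 2) * (cis \<psi> - 1)) \<le> l / 2"
    using norm_cis_minus_one_le[of \<psi>] \<psi> by (simp add: norm_mult)
  also have "1 - r + l / 2 \<le> l / (2 * pi) + l / 2" using r by simp
  also have "\<dots> < l" using l0 pi_gt3 by (simp add: field_simps)
  finally show "z \<in> ball (cis (t + l / 2)) l" by (simp add: dist_norm norm_minus_commute)
qed

lemma superposition_in_BMOA:
  fixes \<zeta> :: "nat \<Rightarrow> complex"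
  assumes \<zeta>: "\<And>n. cmod (\<zeta> n) = 1" and hol: "g holomorphic_on unit_disc"
    and g: "\<And>z. z \<in> unit_disc \<Longrightarrow>
      ennreal ((cmod (deriv g z))\<^sup>2) \<le> (\<Sum>n. ennreal ((1/2) ^ Suc n / (cmod (z - \<zeta> n))\<^sup>2))"
  shows "g \<in> BMOA"
proof -
  have "carleson_mass g (carleson_box t l) \<le> ennreal (10 * l)" if l: "is_arc_length l" for t l
  proof -
    define c where "c = cis (t + l / 2)"
    \<comment> \<open>Enlarging the box to an open set makes the integrand measurable by continuity,
      and being inside the ball keeps \<open>1 - |z| < l\<close>.\<close>
    define T where "T = ball c l \<inter> unit_disc"
    define u where "u z = sqrt (1 - cmod z) * (cmod (deriv g z))\<^sup>2" for z
    have l0: "0 < l" using l by (simp add: is_arc_length_def)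
    have oT: "open T" by (simp add: T_def open_Int)
    have um: "(\<lambda>z. indicator T z * u z) \<in> borel_measurable borel"
    proof -
      have "continuous_on T (deriv g)"
        using continuous_on_deriv_unit_disc[OF hol] by (rule continuous_on_subset) (auto simp: T_def)
      then have "(\<lambda>z. indicator T z *\<^sub>R u z) \<in> borel_measurable borel"
        unfolding u_def using oT by (intro borel_measurable_continuous_on_indicator continuous_intros) auto
      then show ?thesis by simp
    qed
    have "carleson_mass g (carleson_box t l) \<le> carleson_mass g T"
      using carleson_box_subset_ball[OF l] carleson_box_subset_disc[OF l]
      by (intro carleson_mass_mono) (auto simp: T_def c_def)
    \<comment> \<open>One half power of \<open>1 - |z|\<close> is traded for \<open>sqrt l\<close>;
      the other tames the singularities, and the resulting integral supplies the second factor
      \<open>sqrt l\<close>.\<close>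
    also have "\<dots> \<le> dA_int T (\<lambda>z. 2 * sqrt l * u z)"
      unfolding carleson_mass_def
    proof (rule dA_int_mono)
      fix z assume z: "z \<in> T"
      define s where "s = 1 - cmod z"
      have s: "0 < s" using z by (simp add: s_def T_def mem_unit_disc)
      have "s \<le> cmod (z - c)" unfolding s_def by (rule one_minus_norm_le_norm_diff) (simp add: c_def)
      also have "\<dots> < l" using z by (simp add: T_def dist_norm norm_minus_commute)
      finally have sl: "sqrt s \<le> sqrt l" by simp
      have "1 - (cmod z)\<^sup>2 \<le> 2 * s" using zero_le_power2[of "1 - cmod z"] by (simp add: s_def power2_eq_square algebra_simps)
      also have "\<dots> = 2 * (sqrt s * sqrt s)" using s by simp
      also have "\<dots> \<le> 2 * (sqrt l * sqrt s)" using sl s by (intro mult_left_mono mult_right_mono) auto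
      finally have "(1 - (cmod z)\<^sup>2) * (cmod (deriv g z))\<^sup>2 \<le> 2 * (sqrt l * sqrt s) * (cmod (deriv g z))\<^sup>2"
        by (rule mult_right_mono) simp
      then show "(1 - (cmod z)\<^sup>2) * (cmod (deriv g z))\<^sup>2 \<le> 2 * sqrt l * u z"
        by (simp add: u_def s_def mult_ac)
    qed simp
    also have "\<dots> = ennreal (2 * sqrt l) * dA_int T u"
      using oT um l0 by (intro dA_int_cmult_indicator) auto
    also have "\<dots> \<le> ennreal (2 * sqrt l) * ennreal (5 * sqrt l)"
      unfolding u_def
      by (intro mult_left_mono sqrt_weighted_energy_le[OF \<zeta> l0 _ _ g, of T c]) (auto simp: T_def)
    also have "\<dots> = ennreal (10 * l)"
      using l0 by (subst ennreal_mult'[symmetric]) simp_all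
    finally show ?thesis .
  qed
  then show ?thesis unfolding mem_BMOA_iff using hol by (intro conjI exI[of _ 10]) auto
qed

text \<open>One bound for all \<open>p\<close>. If \<open>p \<ge> 2\<close>, the surplus
  \<open>(t * u)^(p - 2)\<close> is at most 1. If \<open>p < 2\<close>, the two cases are separated
  at \<open>u = t^(-3/4)\<close>: below it the left side is at most \<open>t^(p/4 - 1)\<close>,
  which is integrable because \<open>p > 0\<close>; above it, trading \<open>u^(p - 2)\<close> for a
  power of \<open>t\<close> leaves \<open>t^(p/4 + 1/2) * u^2\<close>, hence at most
  \<open>sqrt t * u^2\<close>.\<close>

lemma powr_weight_le:
  fixes t u p :: real
  assumes t: "0 < t" "t \<le> 1" and u: "0 \<le> u" and tu: "t * u \<le> 1" and p: "0 < p"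
  shows "t powr (p - 1) * u powr p \<le> sqrt t * u\<^sup>2 + t powr (p / 4 - 1)"
proof (cases "u = 0")
  case True then show ?thesis by simp
next
  case False
  then have u0: "0 < u" using u by simp
  have u2: "u powr p = u powr (p - 2) * u\<^sup>2"
    using u0 by (simp add: powr_diff)
  show ?thesis
  proof (cases "2 \<le> p")
    case True
    have "t powr (p - 1) * u powr p = (t powr (p - 2) * t) * (u powr (p - 2) * u\<^sup>2)"
      using t u2 powr_add[of t "p - 2" 1] by simp
    also have "\<dots> = (t * u) powr (p - 2) * (t * u\<^sup>2)" using t u0 by (simp add: powr_mult)
    also have "\<dots> \<le> 1 * (sqrt t * u\<^sup>2)"
    proof (intro mult_mono mult_right_mono)
      show "(t * u) powr (p - 2) \<le> 1" using tu t u0 True by (intro powr_le1) auto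
      show "t \<le> sqrt t" using t by (intro real_le_rsqrt) (auto simp: power2_eq_square mult_left_le)
    qed (use t u0 in auto)
    finally show ?thesis using powr_ge_zero[of t "p / 4 - 1"] by linarith
  next
    case p2: False
    show ?thesis
    proof (cases "u \<le> t powr (- 3 / 4)")
      case True
      have "t powr (p - 1) * u powr p \<le> t powr (p - 1) * (t powr (- 3 / 4)) powr p"
        using True u0 p by (intro mult_left_mono powr_mono2) auto
      also have "\<dots> = t powr (p / 4 - 1)"
        using t by (simp add: powr_powr powr_add[symmetric])
      finally show ?thesis using t by (smt (verit) mult_nonneg_nonneg real_sqrt_ge_zero zero_le_power2)
    next
      case False
      have "u powr (p - 2) \<le> (t powr (- 3 / 4)) powr (p - 2)"
        using False p2 t by (intro powr_mono2') auto
      also have "\<dots> = t powr (- 3 / 4 * (p - 2))" by (simp add: powr_powr)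
      finally have "t powr (p - 1) * u powr p \<le> t powr (p - 1) * (t powr (- 3 / 4 * (p - 2)) * u\<^sup>2)"
        unfolding u2 by (intro mult_left_mono mult_right_mono) auto
      also have "\<dots> = t powr (p / 4 + 1 / 2) * u\<^sup>2"
      proof -
        have "t powr (p - 1) * t powr (- 3 / 4 * (p - 2)) = t powr ((p - 1) + (- 3 / 4 * (p - 2)))"
          by (rule powr_add[symmetric])
        also have "(p - 1) + (- 3 / 4 * (p - 2)) = p / 4 + 1 / 2" by (simp add: field_simps)
        finally show ?thesis by (simp only: mult.assoc[symmetric])
      qed
      also have "\<dots> \<le> t powr (1 / 2) * u\<^sup>2"
        using t p by (intro mult_right_mono powr_mono') auto
      finally have "t powr (p - 1) * u powr p \<le> sqrt t * u\<^sup>2" using t by (simp add: powr_half_sqrt)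
      then show ?thesis using powr_ge_zero[of t "p / 4 - 1"] by linarith
    qed
  qed
qed

text \<open>Radial integration uses the variable \<open>|z|^2\<close>, so the weight is rewritten in
  terms of \<open>1 - |z|^2\<close>. An exponent \<open>\<beta> \<le> 1\<close> makes the power
  decreasing, so that \<open>(1 - |z|^2) / 2 \<le> 1 - |z|\<close> points the right way; the factor
  2 bounds \<open>2^(1 - \<beta>)\<close>.\<close>

lemma powr_one_minus_norm_le:
  assumes z: "z \<in> unit_disc" and \<beta>: "\<beta> \<le> \<alpha>" "0 < \<beta>" "\<beta> \<le> 1"
  shows "(1 - cmod z) powr (\<alpha> - 1) \<le> 2 * (1 - (cmod z)\<^sup>2) powr (\<beta> - 1)"
proof -
  define t where "t = 1 - cmod z"
  define s where "s = 1 - (cmod z)\<^sup>2"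
  have t: "0 < t" "t \<le> 1" using z by (auto simp: t_def mem_unit_disc)
  have s: "0 < s" using one_minus_norm_power2_pos[OF z] by (simp add: s_def)
  have st: "s / 2 \<le> t" using zero_le_power2[of "1 - cmod z"] unfolding s_def t_def power2_diff by simp
  have "t powr (\<alpha> - 1) \<le> t powr (\<beta> - 1)" using t \<beta> by (intro powr_mono') auto
  also have "\<dots> \<le> (s / 2) powr (\<beta> - 1)" using st s \<beta> by (intro powr_mono2') auto
  also have "\<dots> = s powr (\<beta> - 1) * 2 powr (1 - \<beta>)"
    using s by (simp add: powr_divide powr_minus_divide[symmetric] field_simps flip: powr_add)
  also have "\<dots> \<le> s powr (\<beta> - 1) * 2 powr 1" using \<beta> by (intro mult_left_mono powr_mono) auto
  finally show ?thesis by (simp add: t_def s_def mult.commute)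
qed

lemma dA_int_powr_one_minus:
  assumes "0 < \<beta>"
  shows "dA_int unit_disc (\<lambda>z. (1 - (cmod z)\<^sup>2) powr (\<beta> - 1)) = ennreal (1 / \<beta>)"
proof -
  have "dA_int unit_disc (\<lambda>z. (1 - (cmod z)\<^sup>2) powr (\<beta> - 1))
      = (\<integral>\<^sup>+s. ennreal ((1 - s) powr (\<beta> - 1)) * indicator {0<..<1} s \<partial>lborel)"
    using dA_int_radial[of "\<lambda>s. (1 - s) powr (\<beta> - 1)" 1] by (simp add: unit_disc_def)
  also have "\<dots> = (\<integral>\<^sup>+s. ennreal ((1 - (1 + (- 1) * s)) powr (\<beta> - 1)) * indicator {0<..<1} (1 + (- 1) * s) \<partial>lborel)"
    by (subst nn_integral_real_affine[where c = "- 1" and t = 1]) simp_all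
  also have "\<dots> = (\<integral>\<^sup>+s. ennreal (s powr (\<beta> - 1)) * indicator {0<..<1} s \<partial>lborel)"
    by (intro nn_integral_cong) (auto simp: indicator_def)
  also have "\<dots> = ennreal (1 / \<beta>)"
    using nn_integral_powr_Ioo[of 1 "\<beta> - 1"] assms by simp
  finally show ?thesis .
qed

lemma superposition_in_Dp:
  fixes \<zeta> :: "nat \<Rightarrow> complex"
  assumes p: "0 < p" and \<zeta>: "\<And>n. cmod (\<zeta> n) = 1" and hol: "g holomorphic_on unit_disc"
    and g: "\<And>z. z \<in> unit_disc \<Longrightarrow>
      ennreal ((cmod (deriv g z))\<^sup>2) \<le> (\<Sum>n. ennreal ((1/2) ^ Suc n / (cmod (z - \<zeta> n))\<^sup>2))"
  shows "g \<in> Dp p"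
proof -
  \<comment> \<open>The exponent \<open>p / 4\<close> comes from \<open>powr_weight_le\<close>;
    capping it at 1 gives a decreasing power while keeping \<open>\<beta> - 1 > -1\<close>, hence
    integrability.\<close>
  define \<beta> where "\<beta> = min (p / 4) 1"
  have \<beta>: "\<beta> \<le> p / 4" "0 < \<beta>" "\<beta> \<le> 1" using p by (auto simp: \<beta>_def)
  define u where "u z = sqrt (1 - cmod z) * (cmod (deriv g z))\<^sup>2" for z
  define v where "v z = 2 * (1 - (cmod z)\<^sup>2) powr (\<beta> - 1)" for z :: complex
  have um: "(\<lambda>z. indicator unit_disc z * u z) \<in> borel_measurable borel"
  proof -
    have "(\<lambda>z. indicator unit_disc z *\<^sub>R u z) \<in> borel_measurable borel"
      unfolding u_def
      by (intro borel_measurable_continuous_on_indicator continuous_intros continuous_on_deriv_unit_disc hol) auto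
    then show ?thesis by simp
  qed
  have [measurable]: "v \<in> borel_measurable borel" unfolding v_def by measurable
  have "dA_int unit_disc (\<lambda>z. (1 - cmod z) powr (p - 1) * cmod (deriv g z) powr p) \<le> dA_int unit_disc (\<lambda>z. u z + v z)"
  proof (rule dA_int_mono)
    fix z assume z: "z \<in> unit_disc"
    have "(1 - cmod z) powr (p - 1) * cmod (deriv g z) powr p
        \<le> sqrt (1 - cmod z) * (cmod (deriv g z))\<^sup>2 + (1 - cmod z) powr (p / 4 - 1)"
      using z deriv_bound_of_superposition[OF \<zeta> z g[OF z]] p
      by (intro powr_weight_le) (auto simp: mem_unit_disc)
    also have "\<dots> \<le> u z + v z"
      using powr_one_minus_norm_le[OF z \<beta>] by (simp add: u_def v_def)
    finally show "(1 - cmod z) powr (p - 1) * cmod (deriv g z) powr p \<le> u z + v z" .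
  qed simp
  also have "\<dots> = dA_int unit_disc u + dA_int unit_disc v"
    using um by (intro dA_int_add) (auto simp: u_def v_def mem_unit_disc)
  also have "\<dots> \<le> ennreal (5 * sqrt 1) + ennreal 2 * ennreal (1 / \<beta>)"
  proof (rule add_mono)
    show "dA_int unit_disc u \<le> ennreal (5 * sqrt 1)"
      unfolding u_def by (rule sqrt_weighted_energy_le[OF \<zeta> _ _ _ g, where c = 0]) (auto simp: unit_disc_def)
    have "dA_int unit_disc v = ennreal 2 * dA_int unit_disc (\<lambda>z. (1 - (cmod z)\<^sup>2) powr (\<beta> - 1))"
      unfolding v_def by (rule dA_int_cmult) auto
    then show "dA_int unit_disc v \<le> ennreal 2 * ennreal (1 / \<beta>)"
      by (simp add: dA_int_powr_one_minus \<beta>)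
  qed
  also have "\<dots> < \<infinity>" by (simp add: ennreal_mult_less_top)
  finally show ?thesis using hol by (simp add: Dp_def)
qed

section \<open>Multipliers\<close>

lemma one_in_Dp_BMOA:
  assumes "0 < p"
  shows "(\<lambda>_. 1) \<in> Dp p \<inter> BMOA"
proof -
  have z: "dA_int S (\<lambda>_. 0) = 0" for S by (simp add: dA_int_def)
  have "(\<lambda>_. 1) \<in> Dp p" using assms by (simp add: Dp_def z)
  moreover have "(\<lambda>_. 1) \<in> BMOA"
    unfolding mem_BMOA_iff by (auto simp: carleson_mass_def z intro!: exI[of _ 1])
  ultimately show ?thesis by simp
qed

text \<open>A gliding hump: if \<open>w a \<cdot> log_weight a\<close> were unbounded, superposing logarithms that peak at
  points where it exceeds \<open>4\<^sup>n\<close> would give a single function violating the hypothesis.\<close>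
lemma uniform_boundedness_log_weight:
  assumes p: "0 < p" and w: "\<And>a. a \<in> unit_disc \<Longrightarrow> 0 \<le> w a"
    and bdd: "\<And>f. f \<in> Dp p \<inter> BMOA \<Longrightarrow> \<exists>K. \<forall>a\<in>unit_disc. w a * cmod (f a) \<le> K"
  shows "\<exists>K. \<forall>a\<in>unit_disc. w a * log_weight a \<le> K"
proof (rule ccontr)
  assume "\<nexists>K. \<forall>a\<in>unit_disc. w a * log_weight a \<le> K"
  \<comment> \<open>The hump at the \<open>n\<close>-th point is damped by \<open>2^-(n+1)\<close>,
    so an excess of \<open>4^(n+1)\<close> still leaves \<open>2^(n+1)\<close>.\<close>
  then have "\<forall>n. \<exists>a\<in>unit_disc. 4 ^ Suc n < w a * log_weight a"
    by (meson not_le)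
  then obtain a where a: "\<And>n. a n \<in> unit_disc" and big: "\<And>n. 4 ^ Suc n < w (a n) * log_weight (a n)"
    by metis
  \<comment> \<open>The radial projection to the circle; the origin lies on every radius, so there
    the choice 1 is arbitrary.\<close>
  define \<zeta> where "\<zeta> n = (if a n = 0 then 1 else a n / of_real (cmod (a n)))" for n
  have \<zeta>: "cmod (\<zeta> n) = 1" for n by (simp add: \<zeta>_def norm_divide)
  have a_eq: "of_real (cmod (a n)) * \<zeta> n = a n" for n by (simp add: \<zeta>_def)
  obtain g where hol: "g holomorphic_on unit_disc"
    and gd: "\<And>z. z \<in> unit_disc \<Longrightarrow>
      ennreal ((cmod (deriv g z))\<^sup>2) \<le> (\<Sum>n. ennreal ((1/2) ^ Suc n / (cmod (z - \<zeta> n))\<^sup>2))"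
    and gl: "\<And>n r. 0 \<le> r \<Longrightarrow> r < 1 \<Longrightarrow> (1/2) ^ Suc n * ln (2 / (1 - r)) \<le> cmod (g (of_real r * \<zeta> n))"
    using log_superposition_exists[of \<zeta>] \<zeta> by blast
  have "g \<in> Dp p \<inter> BMOA"
    using superposition_in_Dp[OF p \<zeta> hol gd] superposition_in_BMOA[OF \<zeta> hol gd] by simp
  then obtain K where K: "\<And>z. z \<in> unit_disc \<Longrightarrow> w z * cmod (g z) \<le> K" using bdd by blast
  have "2 ^ Suc n < K" for n
  proof -
    have lg: "(1/2) ^ Suc n * log_weight (a n) \<le> cmod (g (a n))"
      using gl[of "cmod (a n)" n] a[of n] unfolding a_eq log_weight_def by (simp add: mem_unit_disc)
    have "(2::real) ^ Suc n = (1/2) ^ Suc n * 4 ^ Suc n"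
      by (simp only: power_mult_distrib[symmetric]) simp
    also have "\<dots> < (1/2) ^ Suc n * (w (a n) * log_weight (a n))"
      using big[of n] by (intro mult_strict_left_mono) auto
    also have "\<dots> = w (a n) * ((1/2) ^ Suc n * log_weight (a n))" by simp
    also have "\<dots> \<le> w (a n) * cmod (g (a n))" by (intro mult_left_mono lg w a)
    also have "\<dots> \<le> K" by (rule K[OF a])
    finally show ?thesis .
  qed
  moreover obtain n where "K < 2 ^ n" using real_arch_pow[of 2 K] by auto
  moreover have "(2::real) ^ n \<le> 2 ^ Suc n" by simp
  ultimately show False by (meson less_irrefl less_le_trans less_trans)
qed

lemma multipliers_into_BMOA_subset:
  assumes p: "0 < p"
  shows "multipliers (Dp p \<inter> BMOA) BMOA \<subseteq> BMOA_log \<inter> Hinf"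
proof
  fix g assume "g \<in> multipliers (Dp p \<inter> BMOA) BMOA"
  then have hol: "g holomorphic_on unit_disc"
    and mult: "\<And>f. f \<in> Dp p \<inter> BMOA \<Longrightarrow> (\<lambda>z. f z * g z) \<in> BMOA"
    by (auto simp: multipliers_def)
  have "\<exists>K. \<forall>a\<in>unit_disc. cmod (g a) / log_weight a * log_weight a \<le> K"
  proof (rule uniform_boundedness_log_weight[OF p])
    show "0 \<le> cmod (g a) / log_weight a" if "a \<in> unit_disc" for a
      using log_weight_pos[OF that] by simp
    fix f assume "f \<in> Dp p \<inter> BMOA"
    then obtain K where K: "\<And>a. a \<in> unit_disc \<Longrightarrow> cmod (f a * g a) \<le> K * log_weight a"
      using BMOA_growth[OF mult] by blast
    have "cmod (g a) / log_weight a * cmod (f a) \<le> K" if a: "a \<in> unit_disc" for a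
      using K[OF a] log_weight_pos[OF a] by (simp add: norm_mult divide_le_eq mult.commute)
    then show "\<exists>K. \<forall>a\<in>unit_disc. cmod (g a) / log_weight a * cmod (f a) \<le> K" by blast
  qed
  then obtain M where "\<And>a. a \<in> unit_disc \<Longrightarrow> cmod (g a) / log_weight a * log_weight a \<le> M" by blast
  then have M: "\<And>a. a \<in> unit_disc \<Longrightarrow> cmod (g a) \<le> M"
    using log_weight_pos by (metis less_irrefl nonzero_eq_divide_eq times_divide_eq_left)
  then have Hinf: "g \<in> Hinf" using hol unfolding Hinf_def bounded_iff by auto
  \<comment> \<open>Testing on the constant 1 makes the energies of \<open>g\<close> finite, so they
    can enter the uniform boundedness argument as real weights.\<close>
  have "(\<lambda>z. 1 * g z) \<in> BMOA" by (rule mult[OF one_in_Dp_BMOA[OF p]])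
  then obtain C0 where C0: "0 \<le> C0" "\<And>a. a \<in> unit_disc \<Longrightarrow> energy a g \<le> ennreal C0"
    unfolding BMOA_iff_energy by auto
  define e where "e a = enn2real (energy a g)" for a
  have e: "energy a g = ennreal (e a)" if "a \<in> unit_disc" for a
    using C0(2)[OF that] by (simp add: e_def ennreal_enn2real_if top_unique) (metis ennreal_neq_top top_unique)
  have e0: "0 \<le> e a" for a by (simp add: e_def)
  \<comment> \<open>The available bound is quadratic in \<open>f a\<close>, while the uniform
    boundedness argument is linear in it; hence the square root.\<close>
  have "\<exists>K. \<forall>a\<in>unit_disc. sqrt (e a) * log_weight a \<le> K"
  proof (rule uniform_boundedness_log_weight[OF p])
    show "0 \<le> sqrt (e a)" for a using e0 by simp
    fix f assume fX: "f \<in> Dp p \<inter> BMOA"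
    then obtain C1 where f: "f holomorphic_on unit_disc" and C1: "0 \<le> C1" "\<And>a. a \<in> unit_disc \<Longrightarrow> energy a f \<le> ennreal C1"
      using BMOA_iff_energy[of f] by blast
    obtain C2 where C2: "0 \<le> C2" "\<And>a. a \<in> unit_disc \<Longrightarrow> energy a (\<lambda>z. f z * g z) \<le> ennreal C2"
      using mult[OF fX] unfolding BMOA_iff_energy by blast
    have "sqrt (e a) * cmod (f a) \<le> sqrt (2 * C2 + 4 * M\<^sup>2 * C1)" if a: "a \<in> unit_disc" for a
    proof -
      have "ennreal ((cmod (f a))\<^sup>2 * e a) = ennreal ((cmod (f a))\<^sup>2) * energy a g"
        using e0 by (simp add: e[OF a] ennreal_mult'')
      also have "\<dots> \<le> 2 * energy a (\<lambda>z. f z * g z) + ennreal (4 * M\<^sup>2) * energy a f"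
        by (rule energy_value_mult_le[OF a f hol M])
      also have "\<dots> \<le> 2 * ennreal C2 + ennreal (4 * M\<^sup>2) * ennreal C1"
        by (intro add_mono mult_left_mono C1 C2 a) auto
      also have "\<dots> = ennreal (2 * C2 + 4 * M\<^sup>2 * C1)"
        using C1 C2 by (simp add: ennreal_mult' ennreal_plus)
      finally have "(cmod (f a))\<^sup>2 * e a \<le> 2 * C2 + 4 * M\<^sup>2 * C1"
        using C1(1) C2(1) by (simp add: ennreal_le_iff del: ennreal_plus)
      then have "(sqrt (e a) * cmod (f a))\<^sup>2 \<le> 2 * C2 + 4 * M\<^sup>2 * C1"
        using e0 by (simp add: power_mult_distrib mult.commute)
      then show ?thesis by (rule real_le_rsqrt)
    qed
    then show "\<exists>K. \<forall>a\<in>unit_disc. sqrt (e a) * cmod (f a) \<le> K" by blast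
  qed
  then obtain K where K: "\<And>a. a \<in> unit_disc \<Longrightarrow> sqrt (e a) * log_weight a \<le> K" by blast
  have "energy a g * ennreal ((log_weight a)\<^sup>2) \<le> ennreal (K\<^sup>2)" if a: "a \<in> unit_disc" for a
  proof -
    have "(sqrt (e a) * log_weight a)\<^sup>2 \<le> K\<^sup>2"
      using K[OF a] e0 log_weight_pos[OF a] by (intro power_mono) auto
    then have "e a * (log_weight a)\<^sup>2 \<le> K\<^sup>2" using e0 by (simp add: power_mult_distrib)
    then show ?thesis unfolding e[OF a] by (subst ennreal_mult''[symmetric]) (auto intro: ennreal_leI)
  qed
  then have "g \<in> BMOA_log" unfolding BMOA_log_iff_energy[OF Hinf] by (intro exI[of _ "K\<^sup>2"]) auto
  with Hinf show "g \<in> BMOA_log \<inter> Hinf" by simp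
qed

theorem mainTheorem14:
  fixes p q :: real
  assumes "0 < p" and "0 < q"
  shows "multipliers (Dp p \<inter> BMOA) (Dp q \<inter> BMOA) \<subseteq> BMOA_log \<inter> Hinf
         \<and> BMOA_log \<inter> Hinf = multipliers BMOA BMOA"
proof (intro conjI equalityI BMOA_log_Hinf_subset_multipliers)
  have "multipliers (Dp p \<inter> BMOA) (Dp q \<inter> BMOA) \<subseteq> multipliers (Dp p \<inter> BMOA) BMOA"
    by (auto simp: multipliers_def)
  also have "\<dots> \<subseteq> BMOA_log \<inter> Hinf"
    by (rule multipliers_into_BMOA_subset[OF \<open>0 < p\<close>])
  finally show "multipliers (Dp p \<inter> BMOA) (Dp q \<inter> BMOA) \<subseteq> BMOA_log \<inter> Hinf" .
  \<comment> \<open>Shrinking the space of test functions enlarges the multiplier space, so the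
    inclusion for \<open>Dp p \<inter> BMOA\<close> also settles the multipliers of BMOA.\<close>
  have "multipliers BMOA BMOA \<subseteq> multipliers (Dp p \<inter> BMOA) BMOA"
    by (auto simp: multipliers_def)
  also have "\<dots> \<subseteq> BMOA_log \<inter> Hinf"
    by (rule multipliers_into_BMOA_subset[OF \<open>0 < p\<close>])
  finally show "multipliers BMOA BMOA \<subseteq> BMOA_log \<inter> Hinf" .
qed

end
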